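(* Let $\{x_t : t\in\mathbb{N}\}$ be an $\mathbb{R}^r$-valued process whose law $P_\theta$ depends on $\theta=(\theta_1,\dots,\theta_m)^T\in\Theta$, with $\Theta\subset\mathbb{R}^m$ open and true value $\theta^0\in\Theta$, and let $e_t(\theta)$, $\Sigma_t(\theta)$, $\alpha_t(\theta)$ and $Q_n(\theta)$ be as defined in the context. Suppose that there exist positive constants $C_1,C_2$ such that for all $t\ge 1$ conditions (a) and (b) hold, and that (c), (d) and (e) hold: (a) $E_{\theta^0}\left\{\left|\frac{\partial\alpha_t(\theta)}{\partial\theta_i}\right|^4\right\}\le C_1$ for $i=1,\dots,m$; (b) $E_{\theta^0}\left\{\left|\frac{\partial^2\alpha_t(\theta)}{\partial\theta_i\partial\theta_j}-E_\theta\left(\frac{\partial^2\alpha_t(\theta)}{\partial\theta_i\partial\theta_j}\,\Big|\,F_{t-1}\right)\right|^2\right\}\le C_2$ for $i,j=1,\dots,m$; (c) $\lim_{n\to\infty}\frac{1}{2n}\sum_{t=1}^n E_{\theta^0}\left\{\frac{\partial^2\alpha_t(\theta)}{\partial\theta_i\partial\theta_j}\,\Big|\,F_{t-1}\right\}=V_{ij}$ a.s. for $i,j=1,\dots,m$, where $V=(V_{ij})_{1\le i,j\le m}$ is a strictly positive definite matrix of constants; (d) for $i,j=1,\dots,m$, $$\lim_{n\to\infty}\ \sup_{\Delta\downarrow 0}\ (n\Delta)^{-1}\left|\sum_{t=1}^n\left(\left\{\frac{\partial^2\alpha_t(\theta)}{\partial\theta_i\partial\theta_j}\right\}_{\theta=\theta^*}-\left\{\frac{\partial^2\alpha_t(\theta)}{\partial\theta_i\partial\theta_j}\right\}_{\theta=\theta^0}\right)\right|<\infty\quad\text{a.s.},$$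 where $\theta^*$ is a point of the straight line joining $\theta^0$ to every $\theta$ such that $\|\theta-\theta^0\|<\Delta$, $0<\Delta$; (e) as $n\to\infty$, $$\frac1n\sum_{t=1}^nE_{\theta^0}\left(\frac{\partial\alpha_t(\theta)}{\partial\theta}\frac{\partial\alpha_t(\theta)}{\partial\theta^T}\,\Big|\,F_{t-1}\right)-\frac1n\sum_{t=1}^nE_{\theta^0}\left(\frac{\partial\alpha_t(\theta)}{\partial\theta}\frac{\partial\alpha_t(\theta)}{\partial\theta^T}\right)\to0\quad\text{a.s.}$$ Then, for the sequence of estimators $\widehat\theta_n$ described in the context, $$n^{1/2}(\widehat\theta_n-\theta^0)\to\mathcal{N}(0,V^{-1}WV^{-1})\quad\text{in law},$$ where $W=(W_{ij})_{1\le i,j\le m}$ is a strictly positive definite matrix defined by $$W=\lim_{n\to\infty}\frac1{4n}\sum_{t=1}^nE_{\theta^0}\left(\frac{\partial\alpha_t(\theta)}{\partial\theta}\frac{\partial\alpha_t(\theta)}{\partial\theta^T}\right).$$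
   Context: The process $\{x_t:t\in\mathbb{N}\}$ ($t\ge1$) is defined on $(\Omega,F,P_\theta)$. $E_\theta(\cdot)$ and $E_\theta(\cdot|\cdot)$ denote expectation and conditional expectation under $P_\theta$. The true value $\theta^0$ is an interior point of the open set $\Theta$; a.s. statements and convergence in law are under $P_{\theta^0}$. $F_t$ is the $\sigma$-algebra generated by $x_1,\dots,x_t$, and $F_0=\{\emptyset,\Omega\}$. $\|\cdot\|$ is the Euclidean norm. Standing assumptions: $E_\theta(\|x_t\|^2)<\infty$ for all $\theta$ and $t$. Put $$e_t(\theta)=x_t-E_\theta(x_t|F_{t-1}),\qquad \Sigma_t(\theta)=E_\theta[e_t(\theta)e_t^T(\theta)|F_{t-1}],$$ where $\Sigma_t(\theta)$ is invertible, and $e_t(\theta)$, $\Sigma_t(\theta)$ are almost surely twice continuously differentiable in $\theta\in\Theta$. Define $$\alpha_t(\theta)=\log\det\Sigma_t(\theta)+e_t^T(\theta)\Sigma_t^{-1}(\theta)e_t(\theta),\qquad Q_n(\theta)=\frac12\sum_{t=1}^n\alpha_t(\theta)+\frac{rn}{2}\log(2\pi),$$ so $Q_n$ is minus the Gaussian quasi-log-likelihood (the process need not be Gaussian). Estimators: $\widehat\theta_n$, based on $x_1,\dots,x_n$, is a sequence such that $\widehat\theta_n\to\theta^0$ a.s. and, for any $\epsilon>0$, there exist an event $E$ with $P_{\theta^0}(E)>1-\epsilon$ and an $n_0$ such that on $E$, for any $n>n_0$, $\{\partial Q_n(\theta)/\partial\theta_i\}_{\theta=\widehat\theta_n}=0$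 for $i=1,\dots,m$ and $Q_n$ attains a relative minimum at $\widehat\theta_n$ (the paper's consistency theorem asserts that such a sequence exists under (a)–(d)). Convention: $E_{\theta^0}\{h(\theta)\}$ means $[E_\theta\{h(\theta)\}]_{\theta=\theta^0}$, i.e. the functions and derivatives inside are evaluated at $\theta=\theta^0$ and the (conditional) expectation is under $P_{\theta^0}$; in (b), $E_\theta(\cdot|F_{t-1})$ is likewise taken at $\theta=\theta^0$. $\partial\alpha_t/\partial\theta$ is the column gradient and $\partial\alpha_t/\partial\theta^T$ its transpose. *)

theory Defs
  imports "HOL-Probability.Probability"
begin

section \<open>Calculus in the parameter\<close>

definition partial :: "'m::finite \<Rightarrow> (real ^ 'm \<Rightarrow> real) \<Rightarrow> real ^ 'm \<Rightarrow> real" where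
  "partial i f \<theta> = deriv (\<lambda>h. f (\<theta> + h *\<^sub>R axis i 1)) 0"

definition C2_on :: "'p::real_normed_vector set \<Rightarrow> ('p \<Rightarrow> 'b::real_normed_vector) \<Rightarrow> bool" where
  "C2_on U f \<longleftrightarrow>
     (\<exists>(f' :: 'p \<Rightarrow> 'p \<Rightarrow>\<^sub>L 'b) (f'' :: 'p \<Rightarrow> 'p \<Rightarrow>\<^sub>L 'p \<Rightarrow>\<^sub>L 'b).
        (\<forall>\<theta>\<in>U. (f has_derivative blinfun_apply (f' \<theta>)) (at \<theta>)) \<and>
        (\<forall>\<theta>\<in>U. (f' has_derivative blinfun_apply (f'' \<theta>)) (at \<theta>)) \<and>
        continuous_on U f'')"

definition rel_min_on :: "'p::metric_space set \<Rightarrow> ('p \<Rightarrow> real) \<Rightarrow> 'p \<Rightarrow> bool" where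
  "rel_min_on U f \<theta> \<longleftrightarrow> (\<exists>\<delta>>0. \<forall>\<theta>'\<in>U. dist \<theta>' \<theta> < \<delta> \<longrightarrow> f \<theta> \<le> f \<theta>')"

definition pos_def :: "real ^ 'm ^ 'm \<Rightarrow> bool" where
  "pos_def A \<longleftrightarrow> transpose A = A \<and> (\<forall>v. v \<noteq> 0 \<longrightarrow> v \<bullet> (A *v v) > 0)"


section \<open>Expectations, convergence in law, normal law\<close>

text \<open>
  Derivatives in \<open>\<theta>\<close> of processes that are only almost surely smooth are determined only up to a
  null set, so they need not be measurable for the original \<open>\<sigma>\<close>-algebra, but they are measurable
  for its completion. Expectations and conditional expectations are therefore taken with respect
  to the completed measure; for measurable integrands this changes nothing (conditional
  expectations up to null sets). The conditioning \<open>\<sigma>\<close>-algebra \<open>G\<close> is not completed.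

  \<open>real_cond_exp\<close> is the difference of the conditional expectations of positive and negative part.
  Hence it is meaningful as soon as these two are almost surely finite, even without
  integrability. This is always so below: \<open>\<alpha>\<^sub>t\<close> and its derivatives are quadratic polynomials in
  the square integrable \<open>x\<^sub>t\<close> with coefficients determined by the past.
\<close>

definition expect :: "'a measure \<Rightarrow> ('a \<Rightarrow> real) \<Rightarrow> real" where
  "expect \<mu> f = (\<integral>\<omega>. f \<omega> \<partial>completion \<mu>)"

definition cond_expect :: "'a measure \<Rightarrow> 'a measure \<Rightarrow> ('a \<Rightarrow> real) \<Rightarrow> 'a \<Rightarrow> real" where
  "cond_expect \<mu> G f = real_cond_exp (completion \<mu>) G f"

definition cond_expect_version ::
  "'a measure \<Rightarrow> 'a measure \<Rightarrow> ('a \<Rightarrow> real) \<Rightarrow> ('a \<Rightarrow> real) \<Rightarrow> bool" where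
  "cond_expect_version \<mu> G f g \<longleftrightarrow>
     g \<in> borel_measurable G \<and> (AE \<omega> in \<mu>. g \<omega> = cond_expect \<mu> G f \<omega>)"

definition weakly_converges :: "(nat \<Rightarrow> 'b::topological_space measure) \<Rightarrow> 'b measure \<Rightarrow> bool" where
  "weakly_converges \<mu> \<nu> \<longleftrightarrow>
     (\<forall>f :: 'b \<Rightarrow> real. continuous_on UNIV f \<and> bounded (range f) \<longrightarrow>
        (\<lambda>n. \<integral>y. f y \<partial>\<mu> n) \<longlonglongrightarrow> (\<integral>y. f y \<partial>\<nu>))"

text \<open>Intended for positive definite \<open>A\<close> only.\<close>
definition mvnormal :: "real ^ 'm \<Rightarrow> real ^ 'm ^ 'm \<Rightarrow> (real ^ 'm) measure" where
  "mvnormal \<mu> A = density lborel (\<lambda>y.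
     ennreal (exp (- ((y - \<mu>) \<bullet> (matrix_inv A *v (y - \<mu>))) / 2)
              / sqrt ((2 * pi) ^ CARD('m) * det A)))"


section \<open>The process and its quasi-likelihood\<close>

text \<open>
  Conditional expectations under \<open>P \<theta>\<close> are only determined up to \<open>P \<theta>\<close>-null sets, for each
  \<open>\<theta>\<close> separately, so the functions of \<open>\<theta>\<close> below depend on a choice of versions:
  \<open>m t \<theta>\<close> stands for a version of \<open>E\<^sub>\<theta>(x\<^sub>t | F\<^bsub>t-1\<^esub>)\<close> and \<open>S t \<theta>\<close> for a version of
  \<open>\<Sigma>\<^sub>t(\<theta>) = E\<^sub>\<theta>(e\<^sub>t(\<theta>) e\<^sub>t(\<theta>)\<^sup>T | F\<^bsub>t-1\<^esub>)\<close>. Time starts at 1; values at time 0 are irrelevant.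
\<close>

definition past :: "'a measure \<Rightarrow> (nat \<Rightarrow> 'a \<Rightarrow> 'b::topological_space) \<Rightarrow> nat \<Rightarrow> 'a measure" where
  "past M x t = sigma (space M) {x s -` B \<inter> space M | s B. s \<in> {1..t} \<and> B \<in> sets borel}"

lemma sets_past_0: "sets (past M x 0) = {{}, space M}"
  by (simp add: past_def sigma_sets_empty_eq)

definition innov ::
  "(nat \<Rightarrow> 'a \<Rightarrow> real ^ 'r) \<Rightarrow> (nat \<Rightarrow> real ^ 'm \<Rightarrow> 'a \<Rightarrow> real ^ 'r) \<Rightarrow>
   nat \<Rightarrow> real ^ 'm \<Rightarrow> 'a \<Rightarrow> real ^ 'r" where
  "innov x m t \<theta> \<omega> = x t \<omega> - m t \<theta> \<omega>"

definition alpha ::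
  "(nat \<Rightarrow> 'a \<Rightarrow> real ^ 'r) \<Rightarrow> (nat \<Rightarrow> real ^ 'm \<Rightarrow> 'a \<Rightarrow> real ^ 'r) \<Rightarrow>
   (nat \<Rightarrow> real ^ 'm \<Rightarrow> 'a \<Rightarrow> real ^ 'r ^ 'r) \<Rightarrow> nat \<Rightarrow> real ^ 'm \<Rightarrow> 'a \<Rightarrow> real" where
  "alpha x m S t \<theta> \<omega> =
     ln (det (S t \<theta> \<omega>)) + innov x m t \<theta> \<omega> \<bullet> (matrix_inv (S t \<theta> \<omega>) *v innov x m t \<theta> \<omega>)"

definition Q ::
  "(nat \<Rightarrow> 'a \<Rightarrow> real ^ 'r) \<Rightarrow> (nat \<Rightarrow> real ^ 'm \<Rightarrow> 'a \<Rightarrow> real ^ 'r) \<Rightarrow>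
   (nat \<Rightarrow> real ^ 'm \<Rightarrow> 'a \<Rightarrow> real ^ 'r ^ 'r) \<Rightarrow> nat \<Rightarrow> real ^ 'm \<Rightarrow> 'a \<Rightarrow> real" where
  "Q x m S n \<theta> \<omega> =
     1 / 2 * (\<Sum>t = 1..n. alpha x m S t \<theta> \<omega>) + real CARD('r) * real n / 2 * ln (2 * pi)"

definition grad_alpha ::
  "(nat \<Rightarrow> 'a \<Rightarrow> real ^ 'r) \<Rightarrow> (nat \<Rightarrow> real ^ 'm \<Rightarrow> 'a \<Rightarrow> real ^ 'r) \<Rightarrow>
   (nat \<Rightarrow> real ^ 'm \<Rightarrow> 'a \<Rightarrow> real ^ 'r ^ 'r) \<Rightarrow> nat \<Rightarrow> real ^ 'm \<Rightarrow> 'a \<Rightarrow> real ^ 'm" where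
  "grad_alpha x m S t \<theta> \<omega> = (\<chi> i. partial i (\<lambda>\<eta>. alpha x m S t \<eta> \<omega>) \<theta>)"

definition hess_alpha ::
  "(nat \<Rightarrow> 'a \<Rightarrow> real ^ 'r) \<Rightarrow> (nat \<Rightarrow> real ^ 'm \<Rightarrow> 'a \<Rightarrow> real ^ 'r) \<Rightarrow>
   (nat \<Rightarrow> real ^ 'm \<Rightarrow> 'a \<Rightarrow> real ^ 'r ^ 'r) \<Rightarrow> nat \<Rightarrow> real ^ 'm \<Rightarrow> 'a \<Rightarrow> real ^ 'm ^ 'm" where
  "hess_alpha x m S t \<theta> \<omega> = (\<chi> i j. partial i (partial j (\<lambda>\<eta>. alpha x m S t \<eta> \<omega>)) \<theta>)"

text \<open>\<open>grad_sq_cond \<mu> x m S t \<theta>\<close> and \<open>grad_sq_mean \<mu> x m S t \<theta>\<close> are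
  \<open>E((\<partial>\<alpha>\<^sub>t/\<partial>\<theta>)(\<partial>\<alpha>\<^sub>t/\<partial>\<theta>)\<^sup>T | F\<^bsub>t-1\<^esub>)\<close> and \<open>E((\<partial>\<alpha>\<^sub>t/\<partial>\<theta>)(\<partial>\<alpha>\<^sub>t/\<partial>\<theta>)\<^sup>T)\<close> under \<open>\<mu>\<close>.\<close>

definition grad_sq_cond ::
  "'a measure \<Rightarrow> (nat \<Rightarrow> 'a \<Rightarrow> real ^ 'r) \<Rightarrow> (nat \<Rightarrow> real ^ 'm \<Rightarrow> 'a \<Rightarrow> real ^ 'r) \<Rightarrow>
   (nat \<Rightarrow> real ^ 'm \<Rightarrow> 'a \<Rightarrow> real ^ 'r ^ 'r) \<Rightarrow> nat \<Rightarrow> real ^ 'm \<Rightarrow> 'a \<Rightarrow> real ^ 'm ^ 'm" where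
  "grad_sq_cond \<mu> x m S t \<theta> \<omega> = (\<chi> i j. cond_expect \<mu> (past \<mu> x (t - 1))
     (\<lambda>\<omega>. grad_alpha x m S t \<theta> \<omega> $ i * grad_alpha x m S t \<theta> \<omega> $ j) \<omega>)"

definition grad_sq_mean ::
  "'a measure \<Rightarrow> (nat \<Rightarrow> 'a \<Rightarrow> real ^ 'r) \<Rightarrow> (nat \<Rightarrow> real ^ 'm \<Rightarrow> 'a \<Rightarrow> real ^ 'r) \<Rightarrow>
   (nat \<Rightarrow> real ^ 'm \<Rightarrow> 'a \<Rightarrow> real ^ 'r ^ 'r) \<Rightarrow> nat \<Rightarrow> real ^ 'm \<Rightarrow> real ^ 'm ^ 'm" where
  "grad_sq_mean \<mu> x m S t \<theta> = (\<chi> i j. expect \<mu>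
     (\<lambda>\<omega>. grad_alpha x m S t \<theta> \<omega> $ i * grad_alpha x m S t \<theta> \<omega> $ j))"

text \<open>
  A sequence of estimators, the \<open>n\<close>-th one based on \<open>x\<^sub>1, \<dots>, x\<^sub>n\<close>, which is strongly consistent
  and with probability arbitrarily close to 1 eventually consists of stationary points and
  relative minimizers of \<open>Q\<^sub>n\<close>. \<open>\<mu>\<close> is the law of the true parameter \<open>\<theta>0\<close>.
\<close>
definition qml_estimators ::
  "'a measure \<Rightarrow> (real ^ 'm) set \<Rightarrow> real ^ 'm \<Rightarrow>
   (nat \<Rightarrow> 'a \<Rightarrow> real ^ 'r) \<Rightarrow> (nat \<Rightarrow> real ^ 'm \<Rightarrow> 'a \<Rightarrow> real ^ 'r) \<Rightarrow>
   (nat \<Rightarrow> real ^ 'm \<Rightarrow> 'a \<Rightarrow> real ^ 'r ^ 'r) \<Rightarrow> (nat \<Rightarrow> 'a \<Rightarrow> real ^ 'm) \<Rightarrow> bool" where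
  "qml_estimators \<mu> \<Theta> \<theta>0 x m S est \<longleftrightarrow>
     (\<forall>n\<ge>1. est n \<in> borel_measurable (past \<mu> x n)) \<and>
     (AE \<omega> in \<mu>. (\<lambda>n. est n \<omega>) \<longlonglongrightarrow> \<theta>0) \<and>
     (\<forall>\<epsilon>>0. \<exists>E\<in>sets \<mu>. measure \<mu> E > 1 - \<epsilon> \<and>
        (\<exists>n0. \<forall>\<omega>\<in>E. \<forall>n>n0. est n \<omega> \<in> \<Theta> \<and>
           (\<forall>i. partial i (\<lambda>\<theta>. Q x m S n \<theta> \<omega>) (est n \<omega>) = 0) \<and>
           rel_min_on \<Theta> (\<lambda>\<theta>. Q x m S n \<theta> \<omega>) (est n \<omega>)))"

end

theory Submission
  imports Defs
begin

text \<open>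
  At the true parameter the gradient of \<open>\<alpha>\<^sub>t\<close> is a martingale difference. Indeed \<open>\<alpha>\<^sub>t\<close> is a quadratic
  form in \<open>(1, e\<^sub>t(\<theta>0))\<close> whose coefficients are determined by the past, so its gradient is one too, and
  the conditional expectation of the latter vanishes by Jacobi's formula for the derivative of the
  determinant. Since these coefficients need not be bounded, conditional expectations are computed on the
  events of the past where they are.

  Expanding the stationarity equations at the estimator gives
  \<open>V u\<^sub>n + (2 n)\<^sup>-\<^sup>1 \<Sum>\<^sub>t \<partial>\<alpha>\<^sub>t = o\<^sub>P(|u\<^sub>n|)\<close> for the estimation error \<open>u\<^sub>n\<close>: the centered Hessians average out
  by orthogonality in \<open>L\<^sup>2\<close>, and the remainder is controlled by (c), (d) and consistency. By Slutsky's
  argument on characteristic functions it remains to prove a central limit theorem for the normalized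
  score. For each linear combination of its components this is a martingale central limit theorem,
  obtained by stopping the conditional variance and telescoping \<open>exp (i S\<^sub>k + T\<^sub>k / 2)\<close>, where \<open>S\<^sub>k\<close> is the
  martingale and \<open>T\<^sub>k\<close> its conditional variance. Convergence of the multivariate characteristic functions
  implies convergence in law by smoothing test functions with a Gaussian, itself an average of
  characters.
\<close>

section \<open>A central limit theorem for martingale differences\<close>

text \<open>No rate of the estimator is known in advance. The remainder of the expansion is
  therefore kept proportional to the norm of the estimation error, with a factor that tends to zero
  in probability; it is absorbed into the left side, and tightness of the error follows from that of
  the score. Two more obstacles shape the proof. The derivatives of \<open>alpha\<close> exist only
  almost surely and are in general measurable only for the completion, whereas martingale arguments
  need adapted versions. These are limits of difference quotients along a fixed sequence of steps:
  countably many parameters enter, and at each of them the coefficients are determined by the past.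
  Moreover \<open>m t \<theta>\<close> and \<open>S t \<theta>\<close> are conditional moments only
  up to null sets of \<open>P \<theta>\<close>, so under \<open>P \<theta>0\<close> this information
  is available at \<open>\<theta>0\<close> alone; the sign of the determinant nearby comes from
  invertibility and continuity. In the central limit theorem bounded fourth moments do the work of a
  Lindeberg condition.\<close>

locale filtered_prob_space = prob_space M for M :: "'a measure" +
  fixes F :: "nat \<Rightarrow> 'a measure"
  assumes sub: "\<And>t. subalgebra M (F t)"
    and F_mono: "\<And>s t. s \<le> t \<Longrightarrow> sets (F s) \<subseteq> sets (F t)"
begin

lemma sigma_finite_sub: "sigma_finite_subalgebra M (F t)"
  by (simp add: finite_measure_subalgebra.intro finite_measure_subalgebra_axioms.intro sub
      finite_measure_axioms finite_measure_subalgebra_is_sigma_finite)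

lemma measurable_F_mono: "s \<le> t \<Longrightarrow> f \<in> measurable (F s) N \<Longrightarrow> f \<in> measurable (F t) N"
  using sub[of s] sub[of t] F_mono[of s t]
  by (auto simp: measurable_def subalgebra_def)

lemma measurable_F: "f \<in> measurable (F s) N \<Longrightarrow> f \<in> measurable M N"
  using measurable_from_subalg[OF sub] .

end

text \<open>Since \<open>exp (-u)\<close> lies between \<open>1 - u\<close> and
  \<open>1 / (1 + u)\<close>, hence below \<open>1 - u + u\<^sup>2\<close>, multiplication by
  \<open>exp u\<close> gives both sides. With \<open>u = v / 2\<close> this is the error left when
  the compensator \<open>exp (v / 2)\<close> meets the second-order factor \<open>1 - v / 2\<close>
  of a characteristic function.\<close>

lemma abs_exp_mult_one_minus_le:
  fixes u :: real assumes "0 \<le> u"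
  shows "\<bar>exp u * (1 - u) - 1\<bar> \<le> u\<^sup>2 * exp u"
proof -
  have "exp (-u) \<ge> 1 - u" using exp_ge_add_one_self[of "-u"] by simp
  then have "exp u * (1 - u) \<le> exp u * exp (-u)" by (intro mult_left_mono) auto
  then have up: "exp u * (1 - u) \<le> 1" by (simp add: exp_minus)
  have "exp u \<ge> 1 + u" by simp
  then have "exp (-u) \<le> 1 / (1 + u)" using assms by (simp add: exp_minus field_simps)
  also have "\<dots> \<le> 1 - u + u\<^sup>2"
  proof -
    have "1 \<le> (1 - u + u\<^sup>2) * (1 + u)" using assms
      by (simp add: algebra_simps power2_eq_square)
    then show ?thesis using assms by (simp add: divide_le_eq)
  qed
  finally have "exp u * exp (-u) \<le> exp u * (1 - u + u\<^sup>2)" by (intro mult_left_mono) auto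
  then have "1 \<le> exp u * (1 - u) + u\<^sup>2 * exp u"
    by (simp add: exp_minus algebra_simps)
  with up show ?thesis by auto
qed

lemma abs_cube_le: "\<bar>x::real\<bar> ^ 3 \<le> 1 + x ^ 4"
proof (cases "\<bar>x\<bar> \<le> 1")
  case True then have "\<bar>x\<bar>^3 \<le> 1" by (simp add: power_le_one)
  moreover have "0 \<le> x ^ 4" by simp
  ultimately show ?thesis by linarith
next
  case False then have "\<bar>x\<bar>^3 \<le> \<bar>x\<bar>^4" by (intro power_increasing) auto
  then show ?thesis by simp
qed

lemma square_le: "(x::real) ^ 2 \<le> 1 + x ^ 4"
proof (cases "\<bar>x\<bar> \<le> 1")
  case True then have "x^2 \<le> 1" by (simp add: abs_square_le_1)
  moreover have "0 \<le> x ^ 4" by simp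
  ultimately show ?thesis by linarith
next
  case False then have "\<bar>x\<bar>^2 \<le> \<bar>x\<bar>^4" by (intro power_increasing) auto
  then show ?thesis by simp
qed

lemma (in prob_space) integrable_of_fourth_power:
  fixes f :: "'a \<Rightarrow> real"
  assumes f[measurable]: "f \<in> borel_measurable M" and f4: "integrable M (\<lambda>\<omega>. f \<omega> ^ 4)"
  shows "integrable M f" "integrable M (\<lambda>\<omega>. (f \<omega>)\<^sup>2)" "integrable M (\<lambda>\<omega>. \<bar>f \<omega>\<bar> ^ 3)"
proof -
  show f2: "integrable M (\<lambda>\<omega>. (f \<omega>)\<^sup>2)"
    using square_integrable_imp_integrable[of "\<lambda>\<omega>. (f \<omega>)\<^sup>2"] f4 by (simp flip: power_mult)
  show "integrable M f" by (rule square_integrable_imp_integrable[OF f f2])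
  show "integrable M (\<lambda>\<omega>. \<bar>f \<omega>\<bar> ^ 3)"
    by (rule Bochner_Integration.integrable_bound[where f = "\<lambda>\<omega>. 1 + f \<omega> ^ 4"])
       (use f4 abs_cube_le in auto)
qed

lemma abs_le_one_plus_square: "\<bar>x::real\<bar> \<le> 1 + x ^ 2"
  using sum_power2_ge_zero[of "\<bar>x\<bar> - 1" 0] zero_le_power2[of x]
  by (simp add: power2_eq_square algebra_simps)

lemma (in prob_space) integrable_cmult_bounded:
  fixes H :: "'a \<Rightarrow> 'b::{real_normed_algebra, banach, second_countable_topology}"
  assumes "integrable M Z" "H \<in> borel_measurable M" "\<And>\<omega>. norm (H \<omega>) \<le> B"
  shows "integrable M (\<lambda>\<omega>. H \<omega> * Z \<omega>)"
proof (rule Bochner_Integration.integrable_bound[where f = "\<lambda>\<omega>. B * norm (Z \<omega>)"])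
  show "integrable M (\<lambda>\<omega>. B * norm (Z \<omega>))" using assms by auto
  show "(\<lambda>\<omega>. H \<omega> * Z \<omega>) \<in> borel_measurable M" using assms by measurable
  have "norm (H \<omega> * Z \<omega>) \<le> B * norm (Z \<omega>)" for \<omega>
    by (rule order_trans[OF norm_mult_ineq]) (intro mult_right_mono assms(3) norm_ge_zero)
  then show "AE \<omega> in M. norm (H \<omega> * Z \<omega>) \<le> norm (B * norm (Z \<omega>))"
    by (intro AE_I2) (smt (verit) norm_ge_zero real_norm_def)
qed

text \<open>Taylor expansion of the character to second order: the linear term vanishes by
  \<open>orth\<close>, the quadratic term is exchanged for \<open>v\<close>, and
  \<open>G * exp (v / 2) * (1 - v / 2)\<close> equals \<open>G\<close> up to a multiple of
  \<open>v\<^sup>2\<close>. The conditional moments enter in weak form, tested against bounded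
  past-measurable weights; the bound \<open>B\<close> on the compensated weight makes such tests
  admissible.\<close>

lemma (in prob_space) mds_char_step:
  fixes X v :: "'a \<Rightarrow> real" and G :: "'a \<Rightarrow> complex"
  assumes F: "subalgebra M F"
    and X[measurable]: "X \<in> borel_measurable M" and X4: "integrable M (\<lambda>\<omega>. X \<omega> ^ 4)"
    and v: "v \<in> borel_measurable F" "\<And>\<omega>. 0 \<le> v \<omega>" and v2: "integrable M (\<lambda>\<omega>. (v \<omega>)\<^sup>2)"
    and orth: "\<And>Y K. Y \<in> borel_measurable F \<Longrightarrow> (\<And>\<omega>. \<bar>Y \<omega>\<bar> \<le> K) \<Longrightarrow>
      (\<integral>\<omega>. Y \<omega> * X \<omega> \<partial>M) = 0 \<and> (\<integral>\<omega>. Y \<omega> * (X \<omega>)\<^sup>2 \<partial>M) = (\<integral>\<omega>. Y \<omega> * v \<omega> \<partial>M)"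
    and G: "G \<in> borel_measurable F" and B: "\<And>\<omega>. cmod (G \<omega>) * exp (v \<omega> / 2) \<le> B"
  shows "cmod ((\<integral>\<omega>. G \<omega> * iexp (X \<omega>) * exp (v \<omega> / 2) \<partial>M) - (\<integral>\<omega>. G \<omega> \<partial>M))
     \<le> B * ((\<integral>\<omega>. \<bar>X \<omega>\<bar> ^ 3 \<partial>M) + (\<integral>\<omega>. (v \<omega>)\<^sup>2 \<partial>M))"
proof -
  define H where "H = (\<lambda>\<omega>. G \<omega> * exp (v \<omega> / 2))"
  have HF: "H \<in> borel_measurable F" unfolding H_def using G v(1) by measurable
  have [measurable]: "v \<in> borel_measurable M" "G \<in> borel_measurable M" "H \<in> borel_measurable M"
    using measurable_from_subalg[OF F] v(1) G HF by auto
  have HB: "cmod (H \<omega>) \<le> B" for \<omega> unfolding H_def using B[of \<omega>] by (simp add: norm_mult)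
  have GB: "cmod (G \<omega>) \<le> B" for \<omega>
  proof -
    have "cmod (G \<omega>) * 1 \<le> cmod (G \<omega>) * exp (v \<omega> / 2)" using v(2) by (intro mult_left_mono) auto
    then show ?thesis using B[of \<omega>] by simp
  qed
  have B0: "0 \<le> B" using GB[of undefined] norm_ge_zero order_trans by blast
  note X1 = integrable_of_fourth_power(1)[OF X X4] and X2 = integrable_of_fourth_power(2)[OF X X4]
    and X3 = integrable_of_fourth_power(3)[OF X X4]
  have v1: "integrable M v" by (rule square_integrable_imp_integrable[OF _ v2]) simp
  have iH: "integrable M (\<lambda>\<omega>. H \<omega> * complex_of_real (Z \<omega>))" if "integrable M Z" for Z
    by (rule integrable_cmult_bounded[OF _ _ HB]) (use that in auto)
  \<comment> \<open>\<open>orth\<close> admits real weights only, so it is applied to the real and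
    the imaginary part of \<open>H\<close>.\<close>
  have cplx: "(\<integral>\<omega>. H \<omega> * complex_of_real (Z \<omega>) \<partial>M)
       = (\<integral>\<omega>. Re (H \<omega>) * Z \<omega> \<partial>M) + \<i> * (\<integral>\<omega>. Im (H \<omega>) * Z \<omega> \<partial>M)"
    if "integrable M Z" for Z
    using integral_Re[OF iH[OF that]] integral_Im[OF iH[OF that]]
    by (simp add: complex_eq_iff)
  have ReB: "\<bar>Re (H \<omega>)\<bar> \<le> B" "\<bar>Im (H \<omega>)\<bar> \<le> B" for \<omega>
    using HB[of \<omega>] abs_Re_le_cmod[of "H \<omega>"] abs_Im_le_cmod[of "H \<omega>"] by auto
  have ReF: "(\<lambda>\<omega>. Re (H \<omega>)) \<in> borel_measurable F" "(\<lambda>\<omega>. Im (H \<omega>)) \<in> borel_measurable F"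
    using HF by measurable
  note oR = orth[OF ReF(1) ReB(1)] and oI = orth[OF ReF(2) ReB(2)]
  have z1: "(\<integral>\<omega>. H \<omega> * complex_of_real (X \<omega>) \<partial>M) = 0"
    unfolding cplx[OF X1] using oR oI by simp
  have z2: "(\<integral>\<omega>. H \<omega> * complex_of_real ((X \<omega>)\<^sup>2) \<partial>M) = (\<integral>\<omega>. H \<omega> * complex_of_real (v \<omega>) \<partial>M)"
    unfolding cplx[OF X2] cplx[OF v1] using oR oI by simp
  \<comment> \<open>\<open>R1\<close> carries the third-order Taylor remainder of the character,
    \<open>R2\<close> the second-order error of the compensation.\<close>
  define R1 where "R1 = (\<lambda>\<omega>. H \<omega> * (iexp (X \<omega>) - 1 - \<i> * X \<omega> + (X \<omega>)\<^sup>2 / 2))"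
  define R2 where "R2 = (\<lambda>\<omega>. H \<omega> * (1 - v \<omega> / 2) - G \<omega>)"
  have R1b: "cmod (R1 \<omega>) \<le> B * \<bar>X \<omega>\<bar> ^ 3" for \<omega>
  proof -
    have "cmod (iexp (X \<omega>) - (\<Sum>k \<le> 2. (\<i> * X \<omega>)^k / fact k)) \<le> \<bar>X \<omega>\<bar>^(Suc 2) / fact (Suc 2)"
      by (rule iexp_approx1)
    also have "\<dots> \<le> \<bar>X \<omega>\<bar> ^ 3" by (simp add: fact_numeral)
    also have "iexp (X \<omega>) - (\<Sum>k \<le> 2. (\<i> * X \<omega>)^k / fact k) = iexp (X \<omega>) - 1 - \<i> * X \<omega> + (X \<omega>)\<^sup>2 / 2"
      by (simp add: eval_nat_numeral algebra_simps)
    finally have "cmod (iexp (X \<omega>) - 1 - \<i> * X \<omega> + (X \<omega>)\<^sup>2 / 2) \<le> \<bar>X \<omega>\<bar> ^ 3" .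
    then show ?thesis unfolding R1_def norm_mult by (intro mult_mono HB B0) auto
  qed
  have R2b: "cmod (R2 \<omega>) \<le> B * (v \<omega>)\<^sup>2" for \<omega>
  proof -
    have "R2 \<omega> = G \<omega> * complex_of_real (exp (v \<omega> / 2) * (1 - v \<omega> / 2) - 1)"
      by (simp add: R2_def H_def algebra_simps)
    then have "cmod (R2 \<omega>) = cmod (G \<omega>) * \<bar>exp (v \<omega> / 2) * (1 - v \<omega> / 2) - 1\<bar>"
      by (simp add: norm_mult del: of_real_diff of_real_mult)
    also have "\<dots> \<le> cmod (G \<omega>) * ((v \<omega> / 2)\<^sup>2 * exp (v \<omega> / 2))"
      using v(2) by (intro mult_left_mono abs_exp_mult_one_minus_le) auto
    also have "\<dots> = (cmod (G \<omega>) * exp (v \<omega> / 2)) * (v \<omega> / 2)\<^sup>2" by simp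
    also have "\<dots> \<le> B * (v \<omega> / 2)\<^sup>2" by (intro mult_right_mono B) auto
    also have "\<dots> \<le> B * (v \<omega>)\<^sup>2" using B0 by (intro mult_left_mono) (auto simp: power2_eq_square)
    finally show ?thesis .
  qed
  have [measurable]: "R1 \<in> borel_measurable M" "R2 \<in> borel_measurable M"
    unfolding R1_def R2_def by measurable
  have iR1: "integrable M R1"
    by (rule Bochner_Integration.integrable_bound[where f = "\<lambda>\<omega>. B * \<bar>X \<omega>\<bar>^3"])
       (use X3 R1b B0 in \<open>auto simp: abs_mult\<close>)
  have iR2: "integrable M R2"
    by (rule Bochner_Integration.integrable_bound[where f = "\<lambda>\<omega>. B * (v \<omega>)\<^sup>2"])
       (use v2 R2b B0 in \<open>auto simp: abs_mult\<close>)
  have iG: "integrable M G"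
    by (rule integrable_const_bound[where B = B]) (use GB in auto)
  have "(\<integral>\<omega>. G \<omega> * iexp (X \<omega>) * exp (v \<omega> / 2) \<partial>M)
     = (\<integral>\<omega>. R1 \<omega> + R2 \<omega> + G \<omega> + \<i> * (H \<omega> * complex_of_real (X \<omega>))
          - (H \<omega> * complex_of_real ((X \<omega>)\<^sup>2)) / 2 + (H \<omega> * complex_of_real (v \<omega>)) / 2 \<partial>M)"
    by (intro Bochner_Integration.integral_cong refl)
       (simp add: R1_def R2_def H_def algebra_simps add_divide_distrib diff_divide_distrib)
  also have "\<dots> = (\<integral>\<omega>. R1 \<omega> \<partial>M) + (\<integral>\<omega>. R2 \<omega> \<partial>M) + (\<integral>\<omega>. G \<omega> \<partial>M)"
    using iR1 iR2 iG iH[OF X1] iH[OF X2] iH[OF v1] z1 z2 by simp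
  finally have "cmod ((\<integral>\<omega>. G \<omega> * iexp (X \<omega>) * exp (v \<omega> / 2) \<partial>M) - (\<integral>\<omega>. G \<omega> \<partial>M))
     = cmod ((\<integral>\<omega>. R1 \<omega> \<partial>M) + (\<integral>\<omega>. R2 \<omega> \<partial>M))" by simp
  also have "\<dots> \<le> (\<integral>\<omega>. B * \<bar>X \<omega>\<bar>^3 \<partial>M) + (\<integral>\<omega>. B * (v \<omega>)\<^sup>2 \<partial>M)"
  proof (rule norm_triangle_le, rule add_mono)
    show "cmod (\<integral>\<omega>. R1 \<omega> \<partial>M) \<le> (\<integral>\<omega>. B * \<bar>X \<omega>\<bar>^3 \<partial>M)"
      by (rule order_trans[OF integral_norm_bound integral_mono]) (use iR1 X3 R1b in auto)
    show "cmod (\<integral>\<omega>. R2 \<omega> \<partial>M) \<le> (\<integral>\<omega>. B * (v \<omega>)\<^sup>2 \<partial>M)"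
      by (rule order_trans[OF integral_norm_bound integral_mono]) (use iR2 v2 R2b in auto)
  qed
  finally show ?thesis by (simp add: algebra_simps)
qed

section \<open>Characteristic functions of sums of martingale differences\<close>

context filtered_prob_space begin

text \<open>The one-step errors telescope, because the compensated character at time
  \<open>k\<close> is the past-measurable weight \<open>G\<close> of the next step. Its modulus is
  \<open>exp\<close> of half the accumulated variance, whence the bound \<open>B\<close> on that
  variance at every sample point; stopping provides it later.\<close>

lemma char_mds_bounded:
  fixes X v :: "nat \<Rightarrow> 'a \<Rightarrow> real"
  assumes X: "\<And>t. 1 \<le> t \<Longrightarrow> X t \<in> borel_measurable (F t)"
    and X4: "\<And>t. 1 \<le> t \<Longrightarrow> integrable M (\<lambda>\<omega>. X t \<omega> ^ 4)"
    and v: "\<And>t. 1 \<le> t \<Longrightarrow> v t \<in> borel_measurable (F (t - 1))" "\<And>t \<omega>. 0 \<le> v t \<omega>"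
    and v2: "\<And>t. 1 \<le> t \<Longrightarrow> integrable M (\<lambda>\<omega>. (v t \<omega>)\<^sup>2)"
    and orth: "\<And>t Y K. 1 \<le> t \<Longrightarrow> Y \<in> borel_measurable (F (t - 1)) \<Longrightarrow> (\<And>\<omega>. \<bar>Y \<omega>\<bar> \<le> K) \<Longrightarrow>
      (\<integral>\<omega>. Y \<omega> * X t \<omega> \<partial>M) = 0 \<and> (\<integral>\<omega>. Y \<omega> * (X t \<omega>)\<^sup>2 \<partial>M) = (\<integral>\<omega>. Y \<omega> * v t \<omega> \<partial>M)"
    and B: "\<And>k \<omega>. k \<le> n \<Longrightarrow> (\<Sum>t=1..k. v t \<omega>) \<le> B"
  shows "k \<le> n \<Longrightarrow> cmod ((\<integral>\<omega>. iexp (\<Sum>t=1..k. X t \<omega>) * exp ((\<Sum>t=1..k. v t \<omega>) / 2) \<partial>M) - 1)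
     \<le> exp (B / 2) * (\<Sum>t=1..k. (\<integral>\<omega>. \<bar>X t \<omega>\<bar> ^ 3 \<partial>M) + (\<integral>\<omega>. (v t \<omega>)\<^sup>2 \<partial>M))"
proof (induction k)
  case 0
  then show ?case by (simp add: prob_space)
next
  case (Suc k)
  define G where "G = (\<lambda>\<omega>. iexp (\<Sum>t=1..k. X t \<omega>) * exp ((\<Sum>t=1..k. v t \<omega>) / 2))"
  have XFk: "X t \<in> borel_measurable (F k)" if "t \<in> {1..k}" for t
    using that X[of t] measurable_F_mono[of t k] by auto
  have vFk: "v t \<in> borel_measurable (F k)" if "t \<in> {1..k}" for t
    using that v(1)[of t] by (auto intro!: measurable_F_mono[of "t - 1" k])
  have GF: "G \<in> borel_measurable (F k)"
  proof -
    have [measurable]: "(\<lambda>\<omega>. \<Sum>t=1..k. X t \<omega>) \<in> borel_measurable (F k)"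
      "(\<lambda>\<omega>. \<Sum>t=1..k. v t \<omega>) \<in> borel_measurable (F k)"
      using XFk vFk by (auto intro!: borel_measurable_sum)
    show ?thesis unfolding G_def by measurable
  qed
  have "cmod ((\<integral>\<omega>. G \<omega> * iexp (X (Suc k) \<omega>) * exp (v (Suc k) \<omega> / 2) \<partial>M) - (\<integral>\<omega>. G \<omega> \<partial>M))
     \<le> exp (B / 2) * ((\<integral>\<omega>. \<bar>X (Suc k) \<omega>\<bar> ^ 3 \<partial>M) + (\<integral>\<omega>. (v (Suc k) \<omega>)\<^sup>2 \<partial>M))"
  proof (rule mds_char_step[OF sub[of k]])
    show "X (Suc k) \<in> borel_measurable M" using X[of "Suc k"] measurable_F by auto
    show "v (Suc k) \<in> borel_measurable (F k)" using v(1)[of "Suc k"] by auto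
    show "cmod (G \<omega>) * exp (v (Suc k) \<omega> / 2) \<le> exp (B / 2)" for \<omega>
    proof -
      have "cmod (G \<omega>) * exp (v (Suc k) \<omega> / 2) = exp ((\<Sum>t=1..Suc k. v t \<omega>) / 2)"
        unfolding G_def norm_mult norm_exp_i_times by (simp add: mult_exp_exp add_divide_distrib)
      then show ?thesis using B[of "Suc k" \<omega>] Suc.prems by simp
    qed
    show "(\<integral>\<omega>. Y \<omega> * X (Suc k) \<omega> \<partial>M) = 0 \<and> (\<integral>\<omega>. Y \<omega> * (X (Suc k) \<omega>)\<^sup>2 \<partial>M) = (\<integral>\<omega>. Y \<omega> * v (Suc k) \<omega> \<partial>M)"
      if "Y \<in> borel_measurable (F k)" "\<And>\<omega>. \<bar>Y \<omega>\<bar> \<le> K" for Y K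
      by (rule orth) (use that in auto)
  qed (use X4[of "Suc k"] v(2) v2[of "Suc k"] GF in auto)
  moreover have "(\<lambda>\<omega>. G \<omega> * iexp (X (Suc k) \<omega>) * exp (v (Suc k) \<omega> / 2))
     = (\<lambda>\<omega>. iexp (\<Sum>t=1..Suc k. X t \<omega>) * exp ((\<Sum>t=1..Suc k. v t \<omega>) / 2))"
    unfolding G_def by (auto simp: exp_add ring_distribs add_divide_distrib fun_eq_iff)
  moreover have "cmod ((\<integral>\<omega>. G \<omega> \<partial>M) - 1)
     \<le> exp (B / 2) * (\<Sum>t=1..k. (\<integral>\<omega>. \<bar>X t \<omega>\<bar> ^ 3 \<partial>M) + (\<integral>\<omega>. (v t \<omega>)\<^sup>2 \<partial>M))"
    using Suc unfolding G_def by auto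
  ultimately show ?case
    using norm_triangle_sub[of "(\<integral>\<omega>. iexp (\<Sum>t=1..Suc k. X t \<omega>) * exp ((\<Sum>t=1..Suc k. v t \<omega>) / 2) \<partial>M) - 1"
        "(\<integral>\<omega>. G \<omega> \<partial>M) - 1"]
    by (simp add: distrib_left)
qed

text \<open>The martingale is stopped before its conditional variance exceeds \<open>n * B\<close>.
  For the stopped sums the compensated characteristic function tends to 1. Almost surely the
  stopping is eventually inactive and the normalized variance tends to \<open>s\<close>, so
  dominated convergence replaces the random compensator by the constant \<open>exp (s / 2)\<close>
  and the stopped sum by the full one.\<close>

lemma martingale_clt_char:
  fixes X :: "nat \<Rightarrow> 'a \<Rightarrow> real"
  assumes X: "\<And>t. 1 \<le> t \<Longrightarrow> X t \<in> borel_measurable (F t)"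
    and X4: "\<And>t. 1 \<le> t \<Longrightarrow> integrable M (\<lambda>\<omega>. X t \<omega> ^ 4)"
    and X4C: "\<And>t. 1 \<le> t \<Longrightarrow> (\<integral>\<omega>. X t \<omega> ^ 4 \<partial>M) \<le> C"
    and cond0: "\<And>t. 1 \<le> t \<Longrightarrow> AE \<omega> in M. real_cond_exp M (F (t - 1)) (X t) \<omega> = 0"
    and lim: "AE \<omega> in M. (\<lambda>n. (\<Sum>t=1..n. real_cond_exp M (F (t - 1)) (\<lambda>\<omega>. (X t \<omega>)\<^sup>2) \<omega>) / real n) \<longlonglongrightarrow> s"
  shows "(\<lambda>n. \<integral>\<omega>. iexp ((\<Sum>t=1..n. X t \<omega>) / sqrt (real n)) \<partial>M) \<longlonglongrightarrow> exp (- s / 2)"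
proof -
  \<comment> \<open>A conditional expectation of squares is nonnegative only almost everywhere; the
    maximum makes it so everywhere and keeps it measurable with respect to the past.\<close>
  define v where "v = (\<lambda>t \<omega>. max 0 (real_cond_exp M (F (t - 1)) (\<lambda>\<omega>. (X t \<omega>)\<^sup>2) \<omega>))"
  \<comment> \<open>Strictly above the limit \<open>s\<close>, so that the stopping is eventually
    inactive, and positive, as the empty sum requires.\<close>
  define B where "B = \<bar>s\<bar> + 1"
  have XM[measurable]: "X t \<in> borel_measurable M" if "1 \<le> t" for t
    using X[OF that] measurable_F by auto
  have vF: "v t \<in> borel_measurable (F (t - 1))" for t unfolding v_def by measurable
  have vM[measurable]: "v t \<in> borel_measurable M" for t using vF measurable_F by auto
  have v0: "0 \<le> v t \<omega>" for t \<omega> by (simp add: v_def)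
  have X1: "integrable M (X t)" and X2: "integrable M (\<lambda>\<omega>. (X t \<omega>)\<^sup>2)"
    and X3: "integrable M (\<lambda>\<omega>. \<bar>X t \<omega>\<bar> ^ 3)" if "1 \<le> t" for t
    by (rule integrable_of_fourth_power[OF XM[OF that] X4[OF that]])+
  have vAE: "AE \<omega> in M. v t \<omega> = real_cond_exp M (F (t - 1)) (\<lambda>\<omega>. (X t \<omega>)\<^sup>2) \<omega>" if "1 \<le> t" for t
  proof -
    interpret S: sigma_finite_subalgebra M "F (t - 1)" by (rule sigma_finite_sub)
    have "AE \<omega> in M. real_cond_exp M (F (t - 1)) (\<lambda>\<omega>. (X t \<omega>)\<^sup>2) \<omega> \<ge> 0"
      by (rule S.real_cond_exp_pos) (use XM[OF that] in auto)
    then show ?thesis by eventually_elim (simp add: v_def)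
  qed
  \<comment> \<open>Conditional Jensen bounds the square of \<open>v\<close> by the conditional
    fourth moment, so \<open>v\<close> inherits the constant \<open>C\<close>.\<close>
  have v2: "integrable M (\<lambda>\<omega>. (v t \<omega>)\<^sup>2) \<and> (\<integral>\<omega>. (v t \<omega>)\<^sup>2 \<partial>M) \<le> C" if "1 \<le> t" for t
  proof -
    interpret S: sigma_finite_subalgebra M "F (t - 1)" by (rule sigma_finite_sub)
    let ?c = "real_cond_exp M (F (t - 1)) (\<lambda>\<omega>. (X t \<omega>)\<^sup>2)"
    have eq4: "((X t \<omega>)\<^sup>2)\<^sup>2 = X t \<omega> ^ 4" for \<omega> by (simp flip: power_mult)
    have i: "integrable M (\<lambda>\<omega>. (?c \<omega>)\<^sup>2)"
      by (rule S.integrable_convex_cond_exp[where I = UNIV and q = "\<lambda>x. x\<^sup>2"])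
         (use X2[OF that] X4[OF that] eq4 convex_power2 emeasure_space_1 in auto)
    have j: "AE \<omega> in M. (?c \<omega>)\<^sup>2 \<le> real_cond_exp M (F (t - 1)) (\<lambda>\<omega>. ((X t \<omega>)\<^sup>2)\<^sup>2) \<omega>"
      by (rule S.real_cond_exp_jensens_inequality[where I = UNIV and q = "\<lambda>x. x\<^sup>2"])
         (use X2[OF that] X4[OF that] eq4 convex_power2 in auto)
    have eqi: "(\<integral>\<omega>. (v t \<omega>)\<^sup>2 \<partial>M) = (\<integral>\<omega>. (?c \<omega>)\<^sup>2 \<partial>M)"
      using vAE[OF that] by (intro integral_cong_AE) auto
    also have "\<dots> \<le> (\<integral>\<omega>. real_cond_exp M (F (t - 1)) (\<lambda>\<omega>. ((X t \<omega>)\<^sup>2)\<^sup>2) \<omega> \<partial>M)"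
      by (intro integral_mono_AE i j S.real_cond_exp_int) (use X4[OF that] eq4 in simp)
    also have "\<dots> = (\<integral>\<omega>. X t \<omega> ^ 4 \<partial>M)"
      using S.real_cond_exp_int(2)[of "\<lambda>\<omega>. X t \<omega> ^ 4"] X4[OF that] eq4 by simp
    finally have "(\<integral>\<omega>. (v t \<omega>)\<^sup>2 \<partial>M) \<le> C" using X4C[OF that] by simp
    moreover have "integrable M (\<lambda>\<omega>. (v t \<omega>)\<^sup>2)"
      using vAE[OF that] by (subst integrable_cong_AE[where g = "\<lambda>\<omega>. (?c \<omega>)\<^sup>2"]) (auto simp: i[simplified])
    ultimately show ?thesis by simp
  qed
  have orth: "(\<integral>\<omega>. Y \<omega> * X t \<omega> \<partial>M) = 0 \<and> (\<integral>\<omega>. Y \<omega> * (X t \<omega>)\<^sup>2 \<partial>M) = (\<integral>\<omega>. Y \<omega> * v t \<omega> \<partial>M)"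
    if t: "1 \<le> t" and Y: "Y \<in> borel_measurable (F (t - 1))" "\<And>\<omega>. \<bar>Y \<omega>\<bar> \<le> K" for t Y K
  proof -
    interpret S: sigma_finite_subalgebra M "F (t - 1)" by (rule sigma_finite_sub)
    have YM[measurable]: "Y \<in> borel_measurable M" using Y measurable_F by auto
    have "(\<integral>\<omega>. Y \<omega> * X t \<omega> \<partial>M) = (\<integral>\<omega>. Y \<omega> * real_cond_exp M (F (t - 1)) (X t) \<omega> \<partial>M)"
      by (rule S.real_cond_exp_intg(2)[symmetric])
         (use integrable_cmult_bounded[OF X1[OF t] YM] Y XM[OF t] in auto)
    also have "\<dots> = 0" using cond0[OF t] by (intro integral_eq_zero_AE) auto
    finally have "(\<integral>\<omega>. Y \<omega> * X t \<omega> \<partial>M) = 0" .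
    moreover have "(\<integral>\<omega>. Y \<omega> * (X t \<omega>)\<^sup>2 \<partial>M)
       = (\<integral>\<omega>. Y \<omega> * real_cond_exp M (F (t - 1)) (\<lambda>\<omega>. (X t \<omega>)\<^sup>2) \<omega> \<partial>M)"
      by (rule S.real_cond_exp_intg(2)[symmetric])
         (use integrable_cmult_bounded[OF X2[OF t] YM] Y XM[OF t] in auto)
    moreover have "\<dots> = (\<integral>\<omega>. Y \<omega> * v t \<omega> \<partial>M)"
      using vAE[OF t] by (intro integral_cong_AE) auto
    ultimately show ?thesis by simp
  qed
  \<comment> \<open>The sum runs up to \<open>t\<close> itself, yet the weight is determined at time
    \<open>t - 1\<close> because \<open>v t\<close> is; including \<open>v t\<close> guarantees that
    the bound is never overshot.\<close>
  define w where "w = (\<lambda>n t \<omega>. if (\<Sum>u=1..t. v u \<omega>) \<le> real n * B then 1 else 0 :: real)"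
  have wF: "w n t \<in> borel_measurable (F (t - 1))" for n t
  proof -
    have "(\<lambda>\<omega>. \<Sum>u=1..t. v u \<omega>) \<in> borel_measurable (F (t - 1))"
      by (intro borel_measurable_sum measurable_F_mono[OF _ vF]) (simp add: diff_le_mono)
    then show ?thesis unfolding w_def by measurable
  qed
  have wM[measurable]: "w n t \<in> borel_measurable M" for n t by (rule measurable_F[OF wF])
  have w01: "w n t \<omega> = 0 \<or> w n t \<omega> = 1" for n t \<omega> by (simp add: w_def)
  define X' where "X' = (\<lambda>n t \<omega>. w n t \<omega> * X t \<omega> / sqrt (real n))"
  define v' where "v' = (\<lambda>n t \<omega>. w n t \<omega> * v t \<omega> / real n)"
  define T where "T = (\<lambda>n \<omega>. \<Sum>t=1..n. v' n t \<omega>)"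
  have X'M[measurable]: "X' n t \<in> borel_measurable M" if "1 \<le> t" for n t
    using XM[OF that] unfolding X'_def by measurable
  have v'M[measurable]: "v' n t \<in> borel_measurable M" for n t unfolding v'_def by measurable
  have wB: "(\<Sum>t=1..k. w n t \<omega> * v t \<omega>) \<le> real n * B" for k n \<omega>
  proof (induction k)
    case 0 then show ?case by (simp add: B_def)
  next
    case (Suc k)
    show ?case
    proof (cases "w n (Suc k) \<omega> = 0")
      case True then show ?thesis using Suc by simp
    next
      case False
      then have "(\<Sum>u=1..Suc k. v u \<omega>) \<le> real n * B" by (simp add: w_def split: if_splits)
      moreover have "(\<Sum>t=1..Suc k. w n t \<omega> * v t \<omega>) \<le> (\<Sum>u=1..Suc k. v u \<omega>)"
        by (intro sum_mono) (auto simp: w_def v0)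
      ultimately show ?thesis by linarith
    qed
  qed
  have TB: "(\<Sum>t=1..k. v' n t \<omega>) \<le> B" if "1 \<le> n" for k n \<omega>
  proof -
    have "(\<Sum>t=1..k. v' n t \<omega>) = (\<Sum>t=1..k. w n t \<omega> * v t \<omega>) / real n"
      by (simp add: v'_def sum_divide_distrib)
    also have "\<dots> \<le> B" using wB that by (simp add: divide_le_eq mult.commute)
    finally show ?thesis .
  qed
  have v'0: "0 \<le> v' n t \<omega>" for n t \<omega> by (simp add: v'_def w_def v0)
  have X'le: "\<bar>X' n t \<omega>\<bar> ^ p \<le> \<bar>X t \<omega>\<bar> ^ p / sqrt (real n) ^ p" for n t p \<omega>
  proof -
    have "\<bar>X' n t \<omega>\<bar> \<le> \<bar>X t \<omega>\<bar> / sqrt (real n)"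
      using w01[of n t \<omega>] by (auto simp: X'_def)
    then have "\<bar>X' n t \<omega>\<bar> ^ p \<le> (\<bar>X t \<omega>\<bar> / sqrt (real n)) ^ p" by (intro power_mono) auto
    then show ?thesis by (simp add: power_divide)
  qed
  have v'le: "(v' n t \<omega>)\<^sup>2 \<le> (v t \<omega>)\<^sup>2 / (real n)\<^sup>2" for n t \<omega>
    using w01[of n t \<omega>] by (auto simp: v'_def power_divide)
  \<comment> \<open>There are \<open>n\<close> summands; the third moments are scaled by the power
    \<open>-3/2\<close> of \<open>n\<close>, the squared variances by the power
    \<open>-2\<close>.\<close>
  have bound: "cmod ((\<integral>\<omega>. iexp (\<Sum>t=1..n. X' n t \<omega>) * exp (T n \<omega> / 2) \<partial>M) - 1)
      \<le> exp (B / 2) * ((1 + C) / sqrt (real n) + C / real n)" if n: "1 \<le> n" for n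
  proof -
    have X'4: "integrable M (\<lambda>\<omega>. X' n t \<omega> ^ 4)" if "1 \<le> t" for t
      by (rule Bochner_Integration.integrable_bound[where f = "\<lambda>\<omega>. X t \<omega> ^ 4 / (sqrt n)^4"])
         (use X4[OF that] X'M[OF that] X'le[of n t _ 4] in \<open>auto simp: power_abs\<close>)
    have v'2: "integrable M (\<lambda>\<omega>. (v' n t \<omega>)\<^sup>2)" if "1 \<le> t" for t
      by (rule Bochner_Integration.integrable_bound[where f = "\<lambda>\<omega>. (v t \<omega>)\<^sup>2 / (real n)^2"])
         (use v2[OF that] v'le[of n t] in auto)
    have "cmod ((\<integral>\<omega>. iexp (\<Sum>t=1..n. X' n t \<omega>) * exp ((\<Sum>t=1..n. v' n t \<omega>) / 2) \<partial>M) - 1)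
     \<le> exp (B / 2) * (\<Sum>t=1..n. (\<integral>\<omega>. \<bar>X' n t \<omega>\<bar> ^ 3 \<partial>M) + (\<integral>\<omega>. (v' n t \<omega>)\<^sup>2 \<partial>M))"
    proof (rule char_mds_bounded[where n = n])
      show "X' n t \<in> borel_measurable (F t)" if "1 \<le> t" for t
        using X[OF that] measurable_F_mono[OF _ wF, of t t n] unfolding X'_def by simp
      show "v' n t \<in> borel_measurable (F (t - 1))" for t
        using vF[of t] wF[of n t] unfolding v'_def by measurable
      show "(\<integral>\<omega>. Y \<omega> * X' n t \<omega> \<partial>M) = 0 \<and> (\<integral>\<omega>. Y \<omega> * (X' n t \<omega>)\<^sup>2 \<partial>M) = (\<integral>\<omega>. Y \<omega> * v' n t \<omega> \<partial>M)"
        if t: "1 \<le> t" and Y: "Y \<in> borel_measurable (F (t - 1))" "\<And>\<omega>. \<bar>Y \<omega>\<bar> \<le> K" for t Y K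
      proof -
        have 1: "(\<lambda>\<omega>. w n t \<omega> * Y \<omega>) \<in> borel_measurable (F (t - 1))" using Y wF by measurable
        have 2: "\<bar>w n t \<omega> * Y \<omega>\<bar> \<le> K" for \<omega>
          using Y(2)[of \<omega>] by (auto simp: w_def)
        have w2: "(w n t \<omega>)\<^sup>2 = w n t \<omega>" for \<omega> by (simp add: w_def)
        have "(\<integral>\<omega>. Y \<omega> * X' n t \<omega> \<partial>M) = (\<integral>\<omega>. (w n t \<omega> * Y \<omega>) * X t \<omega> \<partial>M) / sqrt (real n)"
          "(\<integral>\<omega>. Y \<omega> * (X' n t \<omega>)\<^sup>2 \<partial>M) = (\<integral>\<omega>. (w n t \<omega> * Y \<omega>) * (X t \<omega>)\<^sup>2 \<partial>M) / real n"
          "(\<integral>\<omega>. Y \<omega> * v' n t \<omega> \<partial>M) = (\<integral>\<omega>. (w n t \<omega> * Y \<omega>) * v t \<omega> \<partial>M) / real n"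
          unfolding Bochner_Integration.integral_divide_zero[symmetric]
          by (intro Bochner_Integration.integral_cong refl;
              simp add: X'_def v'_def power_divide power_mult_distrib w2 mult_ac)+
        then show ?thesis using orth[OF t 1 2] by simp
      qed
    qed (use X'4 v'2 v'0 TB[OF n] in auto)
    also have "\<dots> \<le> exp (B / 2) * (\<Sum>t=1..n. (1 + C) / (real n * sqrt (real n)) + C / (real n)\<^sup>2)"
    proof (intro mult_left_mono sum_mono add_mono)
      fix t assume "t \<in> {1..n}"
      then have t: "1 \<le> t" by auto
      have s3: "sqrt (real n) ^ 3 = real n * sqrt (real n)" by (simp add: power3_eq_cube)
      have "(\<integral>\<omega>. \<bar>X' n t \<omega>\<bar> ^ 3 \<partial>M) \<le> (\<integral>\<omega>. (1 + X t \<omega> ^ 4) / (real n * sqrt (real n)) \<partial>M)"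
      proof (rule integral_mono)
        show "integrable M (\<lambda>\<omega>. \<bar>X' n t \<omega>\<bar> ^ 3)"
          by (rule Bochner_Integration.integrable_bound[where f = "\<lambda>\<omega>. \<bar>X t \<omega>\<bar> ^ 3 / (sqrt n)^3"])
            (use X3[OF t] X'M[OF t] X'le[of n t _ 3] in auto)
        show "\<bar>X' n t \<omega>\<bar> ^ 3 \<le> (1 + X t \<omega> ^ 4) / (real n * sqrt (real n))" for \<omega>
          unfolding s3[symmetric]
          by (rule order_trans[OF X'le divide_right_mono[OF abs_cube_le]]) simp
      qed (use X4[OF t] in auto)
      also have "\<dots> = (1 + (\<integral>\<omega>. X t \<omega> ^ 4 \<partial>M)) / (real n * sqrt (real n))"
        using X4[OF t] by (simp add: prob_space)
      also have "\<dots> \<le> (1 + C) / (real n * sqrt (real n))" using X4C[OF t] by (intro divide_right_mono) auto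
      finally show "(\<integral>\<omega>. \<bar>X' n t \<omega>\<bar> ^ 3 \<partial>M) \<le> (1 + C) / (real n * sqrt (real n))" .
      have "(\<integral>\<omega>. (v' n t \<omega>)\<^sup>2 \<partial>M) \<le> (\<integral>\<omega>. (v t \<omega>)\<^sup>2 / (real n)\<^sup>2 \<partial>M)"
        by (rule integral_mono) (use v'2[OF t] v2[OF t] v'le in auto)
      also have "\<dots> \<le> C / (real n)\<^sup>2" using v2[OF t] by (auto intro: divide_right_mono)
      finally show "(\<integral>\<omega>. (v' n t \<omega>)\<^sup>2 \<partial>M) \<le> C / (real n)\<^sup>2" .
    qed auto
    also have "\<dots> = exp (B / 2) * ((1 + C) / sqrt (real n) + C / real n)"
      using n by (simp add: sum.distrib field_simps power2_eq_square)
    finally show ?thesis unfolding T_def .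
  qed
  have "(\<lambda>n. (1 + C) / sqrt (real n)) \<longlonglongrightarrow> 0"
    by (rule real_tendsto_divide_at_top[OF tendsto_const filterlim_compose[OF sqrt_at_top filterlim_real_sequentially]])
  moreover have "(\<lambda>n. C / real n) \<longlonglongrightarrow> 0"
    by (rule real_tendsto_divide_at_top[OF tendsto_const filterlim_real_sequentially])
  ultimately have "(\<lambda>n. exp (B / 2) * ((1 + C) / sqrt (real n) + C / real n)) \<longlonglongrightarrow> exp (B / 2) * (0 + 0)"
    by (intro tendsto_mult tendsto_add tendsto_const)
  then have "(\<lambda>n. exp (B / 2) * ((1 + C) / sqrt (real n) + C / real n)) \<longlonglongrightarrow> 0" by simp
  then have "(\<lambda>n. (\<integral>\<omega>. iexp (\<Sum>t=1..n. X' n t \<omega>) * exp (T n \<omega> / 2) \<partial>M) - 1) \<longlonglongrightarrow> 0"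
    by (rule Lim_null_comparison[rotated]) (use bound in \<open>auto intro: eventually_sequentiallyI[of 1]\<close>)
  then have lim1: "(\<lambda>n. (\<integral>\<omega>. iexp (\<Sum>t=1..n. X' n t \<omega>) * exp (T n \<omega> / 2) \<partial>M)) \<longlonglongrightarrow> 1"
    by (rule Lim_null[THEN iffD2])
  have "AE \<omega> in M. \<forall>t\<in>{1..}. v t \<omega> = real_cond_exp M (F (t - 1)) (\<lambda>\<omega>. (X t \<omega>)\<^sup>2) \<omega>"
    using vAE by (subst AE_ball_countable) auto
  with lim have limv: "AE \<omega> in M. (\<lambda>n. (\<Sum>t=1..n. v t \<omega>) / real n) \<longlonglongrightarrow> s"
  proof eventually_elim
    case (elim \<omega>)
    then have "(\<Sum>t=1..n. v t \<omega>) = (\<Sum>t=1..n. real_cond_exp M (F (t - 1)) (\<lambda>\<omega>. (X t \<omega>)\<^sup>2) \<omega>)" for n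
      by (intro sum.cong) auto
    with elim(1) show ?case by simp
  qed
  \<comment> \<open>The partial sums increase in \<open>t\<close>, so the one inequality at
    \<open>t = n\<close> switches on all weights up to \<open>n\<close>.\<close>
  then have ev: "AE \<omega> in M. \<forall>\<^sub>F n in sequentially. \<forall>t\<in>{1..n}. w n t \<omega> = 1"
  proof eventually_elim
    case (elim \<omega>)
    have "\<forall>\<^sub>F n in sequentially. (\<Sum>t=1..n. v t \<omega>) / real n < B"
      using elim by (rule order_tendstoD) (simp add: B_def)
    with eventually_gt_at_top[of 0] show ?case
    proof eventually_elim
      case (elim n)
      then have "(\<Sum>t=1..n. v t \<omega>) \<le> real n * B" by (simp add: divide_less_eq mult.commute)
      moreover have "(\<Sum>u=1..t. v u \<omega>) \<le> (\<Sum>u=1..n. v u \<omega>)" if "t \<in> {1..n}" for t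
        using that v0 by (intro sum_mono2) auto
      ultimately have "(\<Sum>u=1..t. v u \<omega>) \<le> real n * B" if "t \<in> {1..n}" for t
        using order_trans that by blast
      then show ?case by (simp add: w_def)
    qed
  qed
  have T0: "0 \<le> T n \<omega>" for n \<omega> unfolding T_def by (intro sum_nonneg v'0)
  have TM[measurable]: "T n \<in> borel_measurable M" for n unfolding T_def by measurable
  have SM[measurable]: "(\<lambda>\<omega>. \<Sum>t=1..n. X t \<omega>) \<in> borel_measurable M"
     "(\<lambda>\<omega>. \<Sum>t=1..n. X' n t \<omega>) \<in> borel_measurable M" for n
    using XM X'M by (auto intro!: borel_measurable_sum)
  \<comment> \<open>The random compensator is traded for its limit. Stopping bounds
    \<open>T n\<close> by \<open>B\<close>, which supplies the constant majorant.\<close>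
  have lim2: "(\<lambda>n. \<integral>\<omega>. iexp (\<Sum>t=1..n. X' n t \<omega>) * (complex_of_real (exp (s / 2)) - exp (T n \<omega> / 2)) \<partial>M) \<longlonglongrightarrow> (\<integral>\<omega>. 0 \<partial>M)"
  proof (rule integral_dominated_convergence[where w = "\<lambda>_. exp (s/2) + exp (B/2)"])
    have "AE \<omega> in M. (\<lambda>n. T n \<omega>) \<longlonglongrightarrow> s"
      using ev limv
    proof eventually_elim
      case (elim \<omega>)
      have "\<forall>\<^sub>F n in sequentially. (\<Sum>t=1..n. v t \<omega>) / real n = T n \<omega>"
        using elim(1) by eventually_elim (simp add: T_def v'_def sum_divide_distrib)
      then show ?case using elim(2) by (rule Lim_transform_eventually[rotated])
    qed
    then show "AE \<omega> in M. (\<lambda>n. iexp (\<Sum>t=1..n. X' n t \<omega>) * (complex_of_real (exp (s / 2)) - exp (T n \<omega> / 2))) \<longlonglongrightarrow> 0"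
    proof eventually_elim
      case (elim \<omega>)
      then have "(\<lambda>n. exp (s / 2) - exp (T n \<omega> / 2)) \<longlonglongrightarrow> exp (s/2) - exp (s/2)"
        by (intro tendsto_intros) auto
      then have "(\<lambda>n. norm (iexp (\<Sum>t=1..n. X' n t \<omega>) * complex_of_real (exp (s / 2) - exp (T n \<omega> / 2)))) \<longlonglongrightarrow> 0"
        unfolding norm_mult norm_exp_i_times norm_of_real by (simp add: tendsto_rabs_zero)
      then show ?case by (simp add: tendsto_norm_zero_iff)
    qed
    show "AE \<omega> in M. norm (iexp (\<Sum>t=1..n. X' n t \<omega>) * (complex_of_real (exp (s / 2)) - exp (T n \<omega> / 2))) \<le> exp (s/2) + exp (B/2)" for n
    proof (rule AE_I2)
      fix \<omega>
      have "T n \<omega> \<le> B" using TB[of n \<omega> n] by (cases "n = 0") (auto simp: T_def B_def)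
      then have "\<bar>exp (s / 2) - exp (T n \<omega> / 2)\<bar> \<le> exp (s/2) + exp (B/2)"
        using exp_gt_zero[of "s/2"] exp_gt_zero[of "T n \<omega>/2"] exp_le_cancel_iff[of "T n \<omega>/2" "B/2"]
        by linarith
      then show "norm (iexp (\<Sum>t=1..n. X' n t \<omega>) * (complex_of_real (exp (s / 2)) - exp (T n \<omega> / 2))) \<le> exp (s/2) + exp (B/2)"
        unfolding norm_mult norm_exp_i_times of_real_diff[symmetric] norm_of_real by simp
    qed
  qed simp_all
  have lim3: "(\<lambda>n. \<integral>\<omega>. iexp ((\<Sum>t=1..n. X t \<omega>) / sqrt (real n)) - iexp (\<Sum>t=1..n. X' n t \<omega>) \<partial>M) \<longlonglongrightarrow> (\<integral>\<omega>. 0 \<partial>M)"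
  proof (rule integral_dominated_convergence[where w = "\<lambda>_. 2"])
    show "AE \<omega> in M. (\<lambda>n. iexp ((\<Sum>t=1..n. X t \<omega>) / sqrt (real n)) - iexp (\<Sum>t=1..n. X' n t \<omega>)) \<longlonglongrightarrow> 0"
      using ev
    proof eventually_elim
      case (elim \<omega>)
      have "\<forall>\<^sub>F n in sequentially. 0 = iexp ((\<Sum>t=1..n. X t \<omega>) / sqrt (real n)) - iexp (\<Sum>t=1..n. X' n t \<omega>)"
        using elim by eventually_elim (simp add: X'_def sum_divide_distrib)
      then show ?case by (rule Lim_transform_eventually[rotated]) simp
    qed
    show "AE \<omega> in M. norm (iexp ((\<Sum>t=1..n. X t \<omega>) / sqrt (real n)) - iexp (\<Sum>t=1..n. X' n t \<omega>)) \<le> 2" for n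
      by (intro AE_I2 order_trans[OF norm_triangle_ineq4]) (simp del: of_real_sum of_real_divide)
  qed simp_all
  have iX': "integrable M (\<lambda>\<omega>. iexp (\<Sum>t=1..n. X' n t \<omega>))" for n
    by (rule integrable_const_bound[where B = 1]) (auto simp del: of_real_sum)
  have iX: "integrable M (\<lambda>\<omega>. iexp ((\<Sum>t=1..n. X t \<omega>) / sqrt (real n)))" for n
    by (rule integrable_const_bound[where B = 1]) (auto simp del: of_real_sum of_real_divide)
  have iT: "integrable M (\<lambda>\<omega>. iexp (\<Sum>t=1..n. X' n t \<omega>) * exp (T n \<omega> / 2))" for n
  proof (rule integrable_const_bound[where B = "exp (B/2)"])
    have "T n \<omega> \<le> B" for \<omega> using TB[of n \<omega> n] by (cases "n = 0") (auto simp: T_def B_def)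
    then show "AE \<omega> in M. cmod (iexp (\<Sum>t=1..n. X' n t \<omega>) * exp (T n \<omega> / 2)) \<le> exp (B/2)"
      unfolding norm_mult norm_exp_i_times by auto
  qed measurable
  have eq: "(\<integral>\<omega>. iexp (\<Sum>t=1..n. X' n t \<omega>) \<partial>M) * exp (s / 2)
     = (\<integral>\<omega>. iexp (\<Sum>t=1..n. X' n t \<omega>) * (complex_of_real (exp (s / 2)) - exp (T n \<omega> / 2)) \<partial>M)
      + (\<integral>\<omega>. iexp (\<Sum>t=1..n. X' n t \<omega>) * exp (T n \<omega> / 2) \<partial>M)" for n
    using iX' iT by (simp add: ring_distribs)
  have "(\<lambda>n. (\<integral>\<omega>. iexp (\<Sum>t=1..n. X' n t \<omega>) \<partial>M) * exp (s / 2)) \<longlonglongrightarrow> 0 + 1"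
    unfolding eq using tendsto_add[OF lim2 lim1] by simp
  then have "(\<lambda>n. (\<integral>\<omega>. iexp (\<Sum>t=1..n. X' n t \<omega>) \<partial>M) * exp (s / 2) * exp (- s / 2)) \<longlonglongrightarrow> (0 + 1) * complex_of_real (exp (- s/2))"
    by (intro tendsto_mult tendsto_const)
  moreover have "complex_of_real (exp (s / 2)) * complex_of_real (exp (- s / 2)) = 1"
    by (simp flip: of_real_mult exp_add)
  ultimately have "(\<lambda>n. (\<integral>\<omega>. iexp (\<Sum>t=1..n. X' n t \<omega>) \<partial>M)) \<longlonglongrightarrow> exp (- s/2)"
    by (simp add: mult.assoc)
  with lim3 have "(\<lambda>n. (\<integral>\<omega>. iexp ((\<Sum>t=1..n. X t \<omega>) / sqrt (real n)) - iexp (\<Sum>t=1..n. X' n t \<omega>) \<partial>M)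
     + (\<integral>\<omega>. iexp (\<Sum>t=1..n. X' n t \<omega>) \<partial>M)) \<longlonglongrightarrow> (\<integral>\<omega>. 0 \<partial>M) + complex_of_real (exp (- s/2))"
    by (intro tendsto_add)
  then show ?thesis using iX iX' by simp
qed

end

section \<open>Multivariate normal laws and Levy continuity\<close>

lemma Basis_vec_real: "(Basis :: (real ^ 'n) set) = range (\<lambda>i. axis i 1)"
  by (auto simp: Basis_vec_def)

lemma inj_axis_one: "inj (\<lambda>i. axis i (1::real) :: real ^ 'n)"
  by (auto simp: inj_def axis_eq_axis)

lemma borel_measurable_vec_iff:
  fixes f :: "'a \<Rightarrow> real ^ 'n"
  shows "f \<in> borel_measurable M \<longleftrightarrow> (\<forall>i. (\<lambda>x. f x $ i) \<in> borel_measurable M)"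
  by (auto simp: borel_measurable_euclidean_space[of f] Basis_vec_real inner_axis)

lemma borel_measurable_vec_nth[measurable (raw)]:
  fixes f :: "'a \<Rightarrow> real ^ 'n"
  shows "f \<in> borel_measurable M \<Longrightarrow> (\<lambda>x. f x $ i) \<in> borel_measurable M"
  by (simp add: borel_measurable_vec_iff)

lemma borel_measurable_vec_lambda[measurable (raw)]:
  fixes f :: "'n::finite \<Rightarrow> 'a \<Rightarrow> real"
  shows "(\<And>i. f i \<in> borel_measurable M) \<Longrightarrow> (\<lambda>x. \<chi> i. f i x) \<in> borel_measurable M"
  by (simp add: borel_measurable_vec_iff)

lemma borel_measurable_matrix_vector_mult[measurable]:
  "(\<lambda>x. (A :: real ^ 'n ^ 'm) *v x) \<in> borel_measurable borel"
  by (intro borel_measurable_continuous_onI matrix_vector_mult_linear_continuous_on)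

lemma measurable_vec_lambda_PiM[measurable]:
  "vec_lambda \<in> borel_measurable (\<Pi>\<^sub>M i\<in>UNIV. (lborel :: real measure))"
  unfolding borel_measurable_vec_iff by (auto intro!: measurable_component_singleton)

text \<open>Both measures agree on boxes. The product representation makes Fubini's theorem
  available one coordinate at a time.\<close>

lemma lborel_vec: "(lborel :: (real ^ 'n) measure) = distr (\<Pi>\<^sub>M i\<in>UNIV. lborel) borel vec_lambda"
proof (rule lborel_eqI)
  fix l u :: "real ^ 'n" assume le: "\<And>b. b \<in> Basis \<Longrightarrow> l \<bullet> b \<le> u \<bullet> b"
  interpret product_sigma_finite "\<lambda>_::'n. lborel :: real measure" ..
  have le': "l $ i \<le> u $ i" for i using le[of "axis i 1"] by (simp add: inner_axis)
  have eq: "vec_lambda -` box l u = (\<Pi>\<^sub>E i\<in>UNIV. {l $ i <..< u $ i})"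
    by (auto simp: mem_box_cart PiE_def Pi_iff)
  have "emeasure (distr (\<Pi>\<^sub>M i\<in>UNIV. lborel) borel vec_lambda) (box l u)
     = emeasure (\<Pi>\<^sub>M i\<in>UNIV. (lborel :: real measure)) (\<Pi>\<^sub>E i\<in>UNIV. {l $ i <..< u $ i})"
    by (subst emeasure_distr) (auto simp: eq space_PiM)
  also have "\<dots> = (\<Prod>i\<in>UNIV. ennreal (u $ i - l $ i))"
    by (subst emeasure_PiM) (auto simp: le')
  also have "\<dots> = ennreal (\<Prod>i\<in>UNIV. u $ i - l $ i)" by (rule prod_ennreal) (simp add: le')
  also have "(\<Prod>i\<in>UNIV. u $ i - l $ i) = (\<Prod>b\<in>Basis. (u - l) \<bullet> b)"
    unfolding Basis_vec_real by (subst prod.reindex[OF inj_axis_one]) (simp add: inner_axis)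
  finally show "emeasure (distr (\<Pi>\<^sub>M i\<in>UNIV. lborel) borel vec_lambda) (box l u) = (\<Prod>b\<in>Basis. (u - l) \<bullet> b)" .
qed simp

lemma nn_integral_lborel_vec:
  fixes f :: "real ^ 'n \<Rightarrow> ennreal"
  assumes "f \<in> borel_measurable borel"
  shows "(\<integral>\<^sup>+x. f x \<partial>lborel) = (\<integral>\<^sup>+x. f (vec_lambda x) \<partial>(\<Pi>\<^sub>M i\<in>UNIV. lborel))"
  by (subst lborel_vec) (use assms in \<open>simp add: nn_integral_distr\<close>)

text \<open>For fixed remaining coordinates the shear translates coordinate \<open>m\<close> by
  \<open>c * x $ n\<close>, and one-dimensional Lebesgue measure is translation invariant. The
  condition \<open>m \<noteq> n\<close> makes the translation independent of the integrated
  coordinate.\<close>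

lemma nn_integral_lborel_shear:
  fixes f :: "real ^ 'n \<Rightarrow> ennreal"
  assumes [measurable]: "f \<in> borel_measurable borel" and mn: "m \<noteq> n"
  shows "(\<integral>\<^sup>+x. f x \<partial>lborel) = (\<integral>\<^sup>+x. f (\<chi> i. if i = m then x $ m + c * x $ n else x $ i) \<partial>lborel)"
proof -
  interpret product_sigma_finite "\<lambda>_::'n. lborel :: real measure" ..
  have U: "(UNIV :: 'n set) = insert m (UNIV - {m})" by blast
  let ?g = "\<lambda>x. f (\<chi> i. if i = m then x $ m + c * x $ n else x $ i)"
  have [measurable]: "?g \<in> borel_measurable borel"
  proof -
    have "(\<lambda>x::real^'n. \<chi> i. if i = m then x $ m + c * x $ n else x $ i) \<in> borel_measurable borel"
      by (intro borel_measurable_vec_lambda) measurable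
    then show ?thesis by measurable
  qed
  have m1: "(\<lambda>x. f (vec_lambda x)) \<in> borel_measurable (\<Pi>\<^sub>M i\<in>UNIV. (lborel :: real measure))"
    by measurable
  have m2: "(\<lambda>x. ?g (vec_lambda x)) \<in> borel_measurable (\<Pi>\<^sub>M i\<in>UNIV. (lborel :: real measure))"
    by measurable
  have split: "(\<integral>\<^sup>+x. h x \<partial>(\<Pi>\<^sub>M i\<in>UNIV. lborel))
      = (\<integral>\<^sup>+x. (\<integral>\<^sup>+y. h (x(m := y)) \<partial>lborel) \<partial>(\<Pi>\<^sub>M i\<in>UNIV - {m}. lborel))"
    if "h \<in> borel_measurable (\<Pi>\<^sub>M i\<in>UNIV. (lborel :: real measure))" for h :: "('n \<Rightarrow> real) \<Rightarrow> ennreal"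
    using product_nn_integral_insert[of "UNIV - {m}" m h] that unfolding U[symmetric] by simp
  have "(\<integral>\<^sup>+x. ?g x \<partial>lborel)
    = (\<integral>\<^sup>+x. (\<integral>\<^sup>+y. ?g (vec_lambda (x(m := y))) \<partial>lborel) \<partial>(\<Pi>\<^sub>M i\<in>UNIV - {m}. lborel))"
    unfolding nn_integral_lborel_vec[OF \<open>?g \<in> _\<close>] by (rule split[OF m2])
  also have "\<dots> = (\<integral>\<^sup>+x. (\<integral>\<^sup>+y. f (vec_lambda (x(m := c * x n + 1 * y))) \<partial>lborel) \<partial>(\<Pi>\<^sub>M i\<in>UNIV - {m}. lborel))"
    by (intro nn_integral_cong arg_cong[where f = f]) (use mn in \<open>auto simp: vec_eq_iff\<close>)
  also have "\<dots> = (\<integral>\<^sup>+x. (\<integral>\<^sup>+y. f (vec_lambda (x(m := y))) \<partial>lborel) \<partial>(\<Pi>\<^sub>M i\<in>UNIV - {m}. lborel))"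
  proof (rule nn_integral_cong)
    fix x
    have [measurable]: "(\<lambda>y. f (vec_lambda (x(m := y)))) \<in> borel_measurable borel"
    proof -
      have "(\<lambda>y. vec_lambda (x(m := y)) :: real^'n) \<in> borel_measurable borel"
        unfolding borel_measurable_vec_iff by (auto simp: fun_upd_def)
      then show ?thesis by measurable
    qed
    show "(\<integral>\<^sup>+y. f (vec_lambda (x(m := c * x n + 1 * y))) \<partial>lborel) = (\<integral>\<^sup>+y. f (vec_lambda (x(m := y))) \<partial>lborel)"
      using nn_integral_real_affine[of "\<lambda>y. f (vec_lambda (x(m := y)))" 1 "c * x n"] by simp
  qed
  also have "\<dots> = (\<integral>\<^sup>+x. f x \<partial>lborel)"
    unfolding nn_integral_lborel_vec[OF assms(1)] by (rule split[OF m1, symmetric])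
  finally show ?thesis ..
qed

text \<open>The transformation formula is multiplicative in the matrix, so it is checked on
  elementary matrices: diagonal ones rescale the axes, transpositions permute the sides of boxes,
  shears are translations along one axis. The zero-row case of the induction is excluded by the
  determinant.\<close>

lemma nn_integral_lborel_linear:
  fixes A :: "real ^ 'n ^ 'n" and f :: "real ^ 'n \<Rightarrow> ennreal"
  assumes "det A \<noteq> 0" "f \<in> borel_measurable borel"
  shows "(\<integral>\<^sup>+x. f x \<partial>lborel) = ennreal \<bar>det A\<bar> * (\<integral>\<^sup>+x. f (A *v x) \<partial>lborel)"
proof -
  have "det A \<noteq> 0 \<longrightarrow> (\<forall>f \<in> borel_measurable borel.
     (\<integral>\<^sup>+x. f x \<partial>lborel) = ennreal \<bar>det A\<bar> * (\<integral>\<^sup>+x. f (A *v x) \<partial>lborel))" (is "?P A")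
  proof (induction A rule: induct_matrix_elementary)
    case (1 A B)
    show ?case
    proof (intro impI ballI)
      fix f :: "real ^ 'n \<Rightarrow> ennreal" assume d: "det (A ** B) \<noteq> 0" and [measurable]: "f \<in> borel_measurable borel"
      have dA: "det A \<noteq> 0" and dB: "det B \<noteq> 0" using d by (auto simp: det_mul)
      have "(\<integral>\<^sup>+x. f x \<partial>lborel) = ennreal \<bar>det A\<bar> * (\<integral>\<^sup>+x. f (A *v x) \<partial>lborel)"
        by (rule 1(1)[rule_format, OF dA]) measurable
      also have "(\<integral>\<^sup>+x. f (A *v x) \<partial>lborel) = ennreal \<bar>det B\<bar> * (\<integral>\<^sup>+x. f (A *v (B *v x)) \<partial>lborel)"
        by (rule 1(2)[rule_format, OF dB]) measurable
      finally show "(\<integral>\<^sup>+x. f x \<partial>lborel) = ennreal \<bar>det (A ** B)\<bar> * (\<integral>\<^sup>+x. f ((A ** B) *v x) \<partial>lborel)"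
        by (simp add: det_mul abs_mult ennreal_mult matrix_vector_mul_assoc mult.assoc)
    qed
  next
    case (2 A i)
    then show ?case by (simp add: det_zero_row)
  next
    case (3 A)
    show ?case
    proof (intro impI ballI)
      fix f :: "real ^ 'n \<Rightarrow> ennreal" assume d: "det A \<noteq> 0" and [measurable]: "f \<in> borel_measurable borel"
      have dA: "det A = (\<Prod>i\<in>UNIV. A $ i $ i)" by (rule det_diagonal) (use 3 in auto)
      \<comment> \<open>The scaling formula indexes its factors by basis vectors; on
        \<open>axis i 1\<close> this quadratic form returns the diagonal entry.\<close>
      define c where "c = (\<lambda>b::real^'n. b \<bullet> (A *v b))"
      have c: "c (axis i 1) = A $ i $ i" for i
        by (simp add: c_def inner_axis' matrix_vector_mult_basis column_def)
      have T: "0 + (\<Sum>j\<in>Basis. (c j * (x \<bullet> j)) *\<^sub>R j) = A *v x" for x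
      proof -
        have "(\<Sum>j\<in>Basis. (c j * (x \<bullet> j)) *\<^sub>R j) = (\<Sum>i\<in>UNIV. (A $ i $ i * x $ i) *\<^sub>R axis i 1)"
          unfolding Basis_vec_real by (subst sum.reindex[OF inj_axis_one]) (simp add: c inner_axis)
        also have "\<dots> = A *v x"
        proof (subst vec_eq_iff, intro allI)
          fix i
          have "(\<Sum>j\<in>UNIV. A $ i $ j * x $ j) = (\<Sum>j\<in>UNIV. if j = i then A $ i $ i * x $ i else 0)"
            by (rule sum.cong) (use 3 in auto)
          then show "(\<Sum>i\<in>UNIV. (A $ i $ i * x $ i) *\<^sub>R axis i 1) $ i = (A *v x) $ i"
            by (simp add: matrix_vector_mult_def axis_def if_distrib cong: if_cong)
        qed
        finally show ?thesis by simp
      qed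
      have "(\<integral>\<^sup>+x. f x \<partial>lborel) = (\<integral>\<^sup>+x. f x \<partial>density (distr lborel borel (\<lambda>x. 0 + (\<Sum>j\<in>Basis. (c j * (x \<bullet> j)) *\<^sub>R j))) (\<lambda>_. (\<Prod>j\<in>Basis. \<bar>c j\<bar>)))"
        by (subst lborel_affine_euclidean[where c = c and t = 0])
           (use d c in \<open>auto simp: dA Basis_vec_real\<close>)
      also have "\<dots> = (\<integral>\<^sup>+x. ennreal (\<Prod>j\<in>Basis. \<bar>c j\<bar>) * f (A *v x) \<partial>lborel)"
        unfolding T by (simp add: nn_integral_density nn_integral_distr)
      also have "\<dots> = ennreal (\<Prod>j\<in>Basis. \<bar>c j\<bar>) * (\<integral>\<^sup>+x. f (A *v x) \<partial>lborel)"
        by (rule nn_integral_cmult) measurable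
      also have "(\<Prod>j\<in>Basis. \<bar>c j\<bar>) = \<bar>det A\<bar>"
        unfolding Basis_vec_real dA by (subst prod.reindex[OF inj_axis_one]) (simp add: c abs_prod)
      finally show "(\<integral>\<^sup>+x. f x \<partial>lborel) = ennreal \<bar>det A\<bar> * (\<integral>\<^sup>+x. f (A *v x) \<partial>lborel)" .
    qed
  next
    case (4 m n)
    let ?S = "(\<chi> i j. mat 1 $ i $ Transposition.transpose m n j) :: real ^ 'n ^ 'n"
    have p: "Transposition.transpose m n permutes (UNIV :: 'n set)" by (simp add: permutes_swap_id)
    have dS: "\<bar>det ?S\<bar> = 1"
      by (subst det_permute_columns[OF p]) (simp add: abs_mult sign_def)
    have S: "?S *v x = (\<chi> i. x $ Transposition.transpose m n i)" for x
    proof (subst vec_eq_iff, intro allI)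
      fix i
      have "(\<Sum>j\<in>UNIV. (if i = Transposition.transpose m n j then 1 else 0) * x $ j)
         = (\<Sum>j\<in>UNIV. if j = Transposition.transpose m n i then x $ j else 0)"
        by (rule sum.cong) auto
      then show "(?S *v x) $ i = (\<chi> i. x $ Transposition.transpose m n i) $ i"
        by (simp add: matrix_vector_mult_def mat_def)
    qed
    \<comment> \<open>A coordinate swap maps boxes to boxes with permuted sides, hence of the same
      volume.\<close>
    have l: "lborel = distr lborel borel ((*v) ?S)"
    proof (rule lborel_eqI)
      fix l u :: "real ^ 'n" assume le: "\<And>b. b \<in> Basis \<Longrightarrow> l \<bullet> b \<le> u \<bullet> b"
      have le': "l $ i \<le> u $ i" for i using le[of "axis i 1"] by (simp add: inner_axis)
      let ?l = "\<chi> i. l $ Transposition.transpose m n i" and ?u = "\<chi> i. u $ Transposition.transpose m n i"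
      have eq: "(*v) ?S -` box l u = box ?l ?u"
        unfolding S mem_box_cart set_eq_iff vimage_eq
        by (simp add: mem_box_cart) (metis transpose_involutory)
      have "emeasure (distr lborel borel ((*v) ?S)) (box l u) = emeasure lborel (box ?l ?u)"
        by (subst emeasure_distr) (auto simp: eq)
      also have "\<dots> = (\<Prod>i\<in>UNIV. u $ Transposition.transpose m n i - l $ Transposition.transpose m n i)"
        by (subst emeasure_lborel_box)
           (auto simp: Basis_vec_real le' inner_axis prod.reindex[OF inj_axis_one])
      also have "(\<Prod>i\<in>UNIV. u $ Transposition.transpose m n i - l $ Transposition.transpose m n i) = (\<Prod>i\<in>UNIV. u $ i - l $ i)"
        using prod.permute[OF p, of "\<lambda>i. u $ i - l $ i"] by (simp add: o_def)
      also have "\<dots> = (\<Prod>b\<in>Basis. (u - l) \<bullet> b)"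
        unfolding Basis_vec_real by (subst prod.reindex[OF inj_axis_one]) (simp add: inner_axis)
      finally show "emeasure (distr lborel borel ((*v) ?S)) (box l u) = (\<Prod>b\<in>Basis. (u - l) \<bullet> b)" .
    qed simp
    show ?case
    proof (intro impI ballI)
      fix f :: "real ^ 'n \<Rightarrow> ennreal" assume [measurable]: "f \<in> borel_measurable borel"
      have "(\<integral>\<^sup>+x. f x \<partial>lborel) = (\<integral>\<^sup>+x. f (?S *v x) \<partial>lborel)"
        by (subst l) (simp add: nn_integral_distr)
      then show "(\<integral>\<^sup>+x. f x \<partial>lborel) = ennreal \<bar>det ?S\<bar> * (\<integral>\<^sup>+x. f (?S *v x) \<partial>lborel)"
        by (simp add: dS)
    qed
  next
    case (5 m n c)
    let ?S = "(\<chi> i j. if i = m \<and> j = n then c else of_bool (i = j)) :: real ^ 'n ^ 'n"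
    \<comment> \<open>Written as a row operation on the identity, the shear visibly has determinant
      1.\<close>
    have eqS: "?S = (\<chi> k. if k = m then row m (mat 1) + c *s row n (mat 1) else row k (mat 1))"
      using 5 by (auto simp: vec_eq_iff row_def mat_def)
    have dS: "det ?S = 1" unfolding eqS by (subst det_row_operation[OF 5]) simp
    have S: "?S *v x = (\<chi> i. if i = m then x $ m + c * x $ n else x $ i)" for x
    proof (subst vec_eq_iff, intro allI)
      fix i
      have "(\<Sum>j\<in>UNIV. (if i = m \<and> j = n then c else of_bool (i = j)) * x $ j)
         = (\<Sum>j\<in>UNIV. (if j = i then x $ i else 0) + (if j = n then (if i = m then c * x $ n else 0) else 0))"
        by (rule sum.cong) (use 5 in auto)
      also have "\<dots> = (if i = m then x $ m + c * x $ n else x $ i)"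
        by (simp add: sum.distrib)
      finally show "(?S *v x) $ i = (\<chi> i. if i = m then x $ m + c * x $ n else x $ i) $ i"
        by (simp add: matrix_vector_mult_def)
    qed
    show ?case
    proof (intro impI ballI)
      fix f :: "real ^ 'n \<Rightarrow> ennreal" assume f: "f \<in> borel_measurable borel"
      show "(\<integral>\<^sup>+x. f x \<partial>lborel) = ennreal \<bar>det ?S\<bar> * (\<integral>\<^sup>+x. f (?S *v x) \<partial>lborel)"
        unfolding S dS using nn_integral_lborel_shear[OF f 5, of c] by simp
    qed
  qed
  then show ?thesis using assms by blast
qed

section \<open>The multivariate normal law and its characteristic function\<close>

lemma matrix_inv_mult:
  fixes A :: "real ^ 'n ^ 'n"
  assumes "invertible A"
  shows "A ** matrix_inv A = mat 1" "matrix_inv A ** A = mat 1"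
  using someI_ex[OF assms[unfolded invertible_def]] by (auto simp: matrix_inv_def)

lemma integral_lborel_vec:
  fixes f :: "real ^ 'n \<Rightarrow> 'b::{banach, second_countable_topology}"
  assumes "f \<in> borel_measurable borel"
  shows "(\<integral>x. f x \<partial>lborel) = (\<integral>x. f (vec_lambda x) \<partial>(\<Pi>\<^sub>M i\<in>UNIV. lborel))"
  by (subst lborel_vec) (use assms in \<open>simp add: integral_distr\<close>)

text \<open>Product form of the density, so that total mass and characteristic function reduce to
  dimension one; \<open>prod_std_normal_density\<close> connects it with the exponential of the
  inner product.\<close>

definition std_mvnormal :: "(real ^ 'n) measure" where
  "std_mvnormal = density lborel (\<lambda>y. ennreal (\<Prod>i\<in>UNIV. std_normal_density (y $ i)))"

lemma prod_std_normal_density: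
  fixes y :: "real ^ 'n"
  shows "(\<Prod>i\<in>UNIV. std_normal_density (y $ i)) = exp (- (y \<bullet> y) / 2) / sqrt ((2 * pi) ^ CARD('n))"
proof -
  have "(\<Prod>i\<in>UNIV. std_normal_density (y $ i)) = (\<Prod>i\<in>UNIV. exp (- (y $ i)\<^sup>2 / 2) / sqrt (2 * pi))"
    by (simp add: std_normal_density_def)
  also have "\<dots> = exp (\<Sum>i\<in>UNIV. - (y $ i)\<^sup>2 / 2) / sqrt (2 * pi) ^ CARD('n)"
    by (simp add: prod_dividef exp_sum)
  also have "(\<Sum>i\<in>UNIV. - (y $ i)\<^sup>2 / 2) = - (y \<bullet> y) / 2"
    by (simp add: inner_vec_def power2_eq_square sum_divide_distrib sum_negf)
  finally show ?thesis unfolding real_sqrt_power by simp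
qed

lemma std_mvnormal_sets[simp, measurable_cong]: "sets std_mvnormal = sets borel"
  and std_mvnormal_space[simp]: "space std_mvnormal = UNIV"
  by (simp_all add: std_mvnormal_def)

lemma prob_space_std_mvnormal: "prob_space (std_mvnormal :: (real ^ 'n) measure)"
proof
  interpret product_sigma_finite "\<lambda>_::'n. lborel :: real measure" ..
  interpret n: prob_space std_normal_distribution by (rule prob_space_normal_density) simp
  have 1: "(\<integral>\<^sup>+x. ennreal (std_normal_density x) \<partial>lborel) = 1"
    using n.emeasure_space_1 by (simp add: emeasure_density)
  have "emeasure (std_mvnormal :: (real ^ 'n) measure) (space std_mvnormal)
     = (\<integral>\<^sup>+y. (\<Prod>i\<in>UNIV. ennreal (std_normal_density ((y :: real ^ 'n) $ i))) \<partial>lborel)"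
    by (simp add: std_mvnormal_def emeasure_density prod_ennreal)
  also have "\<dots> = (\<integral>\<^sup>+y. (\<Prod>i\<in>UNIV. ennreal (std_normal_density (y i))) \<partial>(\<Pi>\<^sub>M i\<in>(UNIV :: 'n set). lborel))"
    by (subst nn_integral_lborel_vec) simp_all
  also have "\<dots> = 1"
    by (subst product_nn_integral_prod) (simp_all add: 1)
  finally show "emeasure (std_mvnormal :: (real ^ 'n) measure) (space std_mvnormal) = 1" .
qed

text \<open>Character and density factorize over the coordinates, so the integral is a product of
  one-dimensional characteristic functions.\<close>

lemma char_std_mvnormal:
  fixes u :: "real ^ 'n"
  shows "(\<integral>y. iexp (u \<bullet> y) \<partial>std_mvnormal) = complex_of_real (exp (- (u \<bullet> u) / 2))"
proof -
  interpret product_sigma_finite "\<lambda>_::'n. lborel :: real measure" ..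
  have 1: "(\<integral>x. std_normal_density x *\<^sub>R iexp (t * x) \<partial>lborel) = complex_of_real (exp (- t\<^sup>2 / 2))" for t
  proof -
    have "char std_normal_distribution t = (\<integral>x. std_normal_density x *\<^sub>R iexp (t * x) \<partial>lborel)"
      unfolding char_def by (subst integral_density) auto
    then show ?thesis by (simp add: char_std_normal_distribution)
  qed
  have i: "integrable lborel (\<lambda>x. std_normal_density x *\<^sub>R iexp (t * x))" for t
    by (rule Bochner_Integration.integrable_bound[OF integrable_normal_density[of 1 0]])
       (auto simp del: of_real_mult)
  have "(\<integral>y. iexp (u \<bullet> y) \<partial>std_mvnormal)
    = (\<integral>y. (\<Prod>i\<in>UNIV. std_normal_density (y $ i)) *\<^sub>R iexp (u \<bullet> y) \<partial>lborel)"
    unfolding std_mvnormal_def by (subst integral_density) (auto intro!: prod_nonneg)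
  also have "\<dots> = (\<integral>y. (\<Prod>i\<in>UNIV. std_normal_density (y $ i) *\<^sub>R iexp (u $ i * y $ i)) \<partial>lborel)"
    by (intro Bochner_Integration.integral_cong refl)
       (simp add: inner_vec_def scaleR_conv_of_real prod.distrib exp_sum sum_distrib_left)
  also have "\<dots> = (\<integral>y. (\<Prod>i\<in>UNIV. std_normal_density (y i) *\<^sub>R iexp (u $ i * y i)) \<partial>(\<Pi>\<^sub>M i\<in>UNIV. lborel))"
    by (subst integral_lborel_vec) simp_all
  also have "\<dots> = (\<Prod>i\<in>UNIV. complex_of_real (exp (- (u $ i)\<^sup>2 / 2)))"
    by (subst product_integral_prod) (simp_all only: 1 i finite UNIV_I)
  also have "\<dots> = complex_of_real (exp (\<Sum>i\<in>UNIV. - (u $ i)\<^sup>2 / 2))"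
    by (simp add: exp_sum)
  also have "(\<Sum>i\<in>UNIV. - (u $ i)\<^sup>2 / 2) = - (u \<bullet> u) / 2"
    by (simp add: inner_vec_def power2_eq_square sum_divide_distrib sum_negf)
  finally show ?thesis .
qed

text \<open>Gram--Schmidt orthogonalization for the inner product defined by \<open>A\<close>.\<close>

lemma pos_def_factor:
  fixes A :: "real ^ 'n ^ 'n"
  assumes "pos_def A"
  obtains C where "det C \<noteq> 0" "A = C ** transpose C"
proof -
  have sym: "transpose A = A" and pos: "\<And>v. v \<noteq> 0 \<Longrightarrow> v \<bullet> (A *v v) > 0"
    using assms by (auto simp: pos_def_def)
  have symi: "u \<bullet> (A *v v) = v \<bullet> (A *v u)" for u v
    by (metis dot_lmul_matrix inner_commute sym transpose_matrix_vector)
  have "\<exists>b :: 'n \<Rightarrow> real ^ 'n. \<forall>i\<in>I. \<forall>j\<in>I. b i \<bullet> (A *v b j) = (if i = j then 1 else 0)" if "finite I" for I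
    using that
  proof induction
    case empty then show ?case by auto
  next
    case (insert k I)
    then obtain b where b: "\<forall>i\<in>I. \<forall>j\<in>I. b i \<bullet> (A *v b j) = (if i = j then 1 else (0::real))" by auto
    have "dim (b ` I) \<le> card (b ` I)" using insert(1) by (intro dim_le_card') auto
    also have "\<dots> \<le> card I" by (rule card_image_le[OF insert(1)])
    also have "\<dots> < card (insert k I)" using insert by simp
    also have "\<dots> \<le> CARD('n)" by (rule card_mono) auto
    finally have "span (b ` I) \<noteq> UNIV" by (metis dim_UNIV dim_span DIM_cart DIM_real mult.right_neutral less_irrefl)
    then obtain v where v: "v \<notin> span (b ` I)" by auto
    define w where "w = v - (\<Sum>i\<in>I. (b i \<bullet> (A *v v)) *\<^sub>R b i)"
    have "w \<noteq> 0"
    proof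
      assume "w = 0"
      then have "v = (\<Sum>i\<in>I. (b i \<bullet> (A *v v)) *\<^sub>R b i)" by (simp add: w_def)
      moreover have "\<dots> \<in> span (b ` I)" by (intro span_sum span_scale span_base) auto
      ultimately show False using v by simp
    qed
    then have wpos: "w \<bullet> (A *v w) > 0" by (rule pos)
    have bw: "b j \<bullet> (A *v w) = 0" if "j \<in> I" for j
    proof -
      have "b j \<bullet> (A *v w) = b j \<bullet> (A *v v) - (\<Sum>i\<in>I. (b i \<bullet> (A *v v)) * (b j \<bullet> (A *v b i)))"
        unfolding w_def
        by (simp add: matrix_vector_mult_diff_distrib inner_diff_right mult.commute
            linear_sum[OF matrix_vector_mul_linear] inner_sum_right linear_scale[OF matrix_vector_mul_linear])
      also have "(\<Sum>i\<in>I. (b i \<bullet> (A *v v)) * (b j \<bullet> (A *v b i))) = (\<Sum>i\<in>I. if i = j then b i \<bullet> (A *v v) else 0)"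
        using b that by (intro sum.cong) auto
      also have "\<dots> = b j \<bullet> (A *v v)" using insert(1) that by simp
      finally show ?thesis by simp
    qed
    define b' where "b' = b(k := (1 / sqrt (w \<bullet> (A *v w))) *\<^sub>R w)"
    have b'k: "b' k = (1 / sqrt (w \<bullet> (A *v w))) *\<^sub>R w" and b'I: "\<And>i. i \<in> I \<Longrightarrow> b' i = b i"
      using insert(2) by (auto simp: b'_def)
    have kk: "b' k \<bullet> (A *v b' k) = 1"
      using wpos unfolding b'k by (simp add: linear_scale[OF matrix_vector_mul_linear] field_simps)
    have ik: "b' i \<bullet> (A *v b' k) = 0" "b' k \<bullet> (A *v b' i) = 0" if "i \<in> I" for i
    proof -
      show "b' i \<bullet> (A *v b' k) = 0"
        using bw[OF that] unfolding b'k b'I[OF that] by (simp add: linear_scale[OF matrix_vector_mul_linear])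
      then show "b' k \<bullet> (A *v b' i) = 0" by (simp add: symi)
    qed
    show ?case
    proof (intro exI[of _ b'] ballI)
      fix i j assume "i \<in> insert k I" "j \<in> insert k I"
      then show "b' i \<bullet> (A *v b' j) = (if i = j then 1 else 0)"
        using kk ik b b'I insert(2) by (cases "i = k"; cases "j = k") auto
    qed
  qed
  then obtain b :: "'n \<Rightarrow> real ^ 'n" where b: "\<And>i j. b i \<bullet> (A *v b j) = (if i = j then 1 else 0)"
    by (metis finite UNIV_I)
  \<comment> \<open>The rows of \<open>B\<close> are orthonormal for the form defined by
    \<open>A\<close>, so \<open>B ** A ** transpose B\<close> is the identity and the inverse of
    \<open>B\<close> is the desired factor.\<close>
  define B where "B = (\<chi> i. b i)"
  have BAB: "B ** A ** transpose B = mat 1"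
  proof (subst vec_eq_iff, intro allI, subst vec_eq_iff, intro allI)
    fix i j
    have "(B ** A ** transpose B) $ i $ j = b i \<bullet> (A *v b j)"
      unfolding matrix_mul_assoc[symmetric]
      by (simp add: matrix_matrix_mult_def matrix_vector_mult_def inner_vec_def B_def transpose_def)
    then show "(B ** A ** transpose B) $ i $ j = mat 1 $ i $ j" by (simp add: b mat_def)
  qed
  then have "det B * det A * det B = 1" by (metis det_I det_mul det_transpose)
  then have dB: "det B \<noteq> 0" by auto
  then have inv: "invertible B" by (simp add: invertible_det_nz)
  define C where "C = matrix_inv B"
  have CB: "C ** B = mat 1" "B ** C = mat 1"
    using inv unfolding C_def by (auto simp: matrix_inv_mult)
  have tC: "transpose B ** transpose C = mat 1" by (metis CB(1) matrix_transpose_mul transpose_mat)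
  have "C ** transpose C = C ** (B ** A ** transpose B) ** transpose C" by (simp add: BAB)
  also have "\<dots> = (C ** B) ** A ** (transpose B ** transpose C)" by (simp add: matrix_mul_assoc)
  also have "\<dots> = A" by (simp add: CB tC)
  finally have "A = C ** transpose C" ..
  moreover have "det C * det B = 1" by (metis CB(1) det_I det_mul)
  then have "det C \<noteq> 0" by auto
  ultimately show ?thesis using that by blast
qed

text \<open>The substitution \<open>y = C *v x\<close> turns the quadratic form of the inverse
  covariance into \<open>x \<bullet> x\<close>, and its Jacobian \<open>\<bar>det C\<bar>\<close>
  cancels the square root of the determinant of \<open>C ** transpose C\<close>.\<close>

lemma mvnormal_eq_distr:
  fixes C :: "real ^ 'n ^ 'n"
  assumes dC: "det C \<noteq> 0"
  shows "mvnormal 0 (C ** transpose C) = distr std_mvnormal borel ((*v) C)"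
proof (rule measure_eqI)
  fix B :: "(real ^ 'n) set" assume "B \<in> sets (mvnormal 0 (C ** transpose C))"
  then have [measurable]: "B \<in> sets borel" by (simp add: mvnormal_def)
  let ?A = "C ** transpose C"
  let ?g = "\<lambda>y. ennreal (exp (- ((y - 0) \<bullet> (matrix_inv ?A *v (y - 0))) / 2) / sqrt ((2 * pi) ^ CARD('n) * det ?A))"
  have dA: "det ?A = (det C)\<^sup>2" by (simp add: det_mul power2_eq_square)
  have [measurable]: "?g \<in> borel_measurable borel"
  proof -
    have "(\<lambda>y. (y - 0) \<bullet> (matrix_inv ?A *v (y - 0))) \<in> borel_measurable borel"
      by (simp add: borel_measurable_inner)
    then show ?thesis by measurable
  qed
  have invA: "invertible ?A" using dC dA by (simp add: invertible_det_nz)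
  have tCinv: "invertible (transpose C)" using dC by (simp add: invertible_det_nz)
  \<comment> \<open>The vector \<open>w\<close> solves
    \<open>C *v (transpose C *v w) = C *v x\<close>; injectivity of \<open>C\<close> cancels the
    outer factor, so the inverse of the product need not be computed.\<close>
  have q: "(C *v x) \<bullet> (matrix_inv ?A *v (C *v x)) = x \<bullet> x" for x
  proof -
    define w where "w = matrix_inv ?A *v (C *v x)"
    have "?A *v w = C *v x" 
      by (simp only: w_def matrix_vector_mul_assoc matrix_mul_assoc matrix_inv_mult(1)[OF invA] matrix_mul_lid)
    then have "C *v (transpose C *v w) = C *v x" by (simp only: matrix_vector_mul_assoc)
    then have "transpose C *v w = x" using dC
      by (metis invertible_det_nz inj_matrix_vector_mult injD)
    moreover have "(C *v x) \<bullet> w = x \<bullet> (transpose C *v w)"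
      by (metis dot_lmul_matrix transpose_matrix_vector transpose_transpose)
    ultimately show ?thesis by (simp add: w_def)
  qed
  have "emeasure (mvnormal 0 ?A) B = (\<integral>\<^sup>+y. ?g y * indicator B y \<partial>lborel)"
    unfolding mvnormal_def by (subst emeasure_density) auto
  also have "\<dots> = ennreal \<bar>det C\<bar> * (\<integral>\<^sup>+x. ?g (C *v x) * indicator B (C *v x) \<partial>lborel)"
    by (rule nn_integral_lborel_linear[OF dC]) measurable
  also have "\<dots> = (\<integral>\<^sup>+x. ennreal \<bar>det C\<bar> * (?g (C *v x) * indicator B (C *v x)) \<partial>lborel)"
    by (rule nn_integral_cmult[symmetric]) measurable
  also have "\<dots> = (\<integral>\<^sup>+x. ennreal (\<Prod>i\<in>UNIV. std_normal_density (x $ i)) * indicator ((*v) C -` B) x \<partial>lborel)"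
  proof (intro nn_integral_cong)
    fix x :: "real ^ 'n"
    have g: "?g (C *v x) = ennreal (exp (- (x \<bullet> x) / 2) / (sqrt ((2 * pi) ^ CARD('n)) * \<bar>det C\<bar>))"
      by (simp add: q dA real_sqrt_mult)
    have "ennreal \<bar>det C\<bar> * ?g (C *v x) = ennreal (\<bar>det C\<bar> * (exp (- (x \<bullet> x) / 2) / (sqrt ((2 * pi) ^ CARD('n)) * \<bar>det C\<bar>)))"
      unfolding g by (rule ennreal_mult'[symmetric]) simp
    also have "\<dots> = ennreal (\<Prod>i\<in>UNIV. std_normal_density (x $ i))"
      using dC unfolding prod_std_normal_density by simp
    finally show "ennreal \<bar>det C\<bar> * (?g (C *v x) * indicator B (C *v x))
      = ennreal (\<Prod>i\<in>UNIV. std_normal_density (x $ i)) * indicator ((*v) C -` B) x"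
      by (simp add: mult.assoc[symmetric] indicator_vimage)
  qed
  also have "\<dots> = emeasure std_mvnormal ((*v) C -` B)"
    unfolding std_mvnormal_def by (subst emeasure_density) (auto intro!: measurable_sets_borel[OF borel_measurable_matrix_vector_mult])
  also have "\<dots> = emeasure (distr std_mvnormal borel ((*v) C)) B"
    by (subst emeasure_distr) auto
  finally show "emeasure (mvnormal 0 ?A) B = emeasure (distr std_mvnormal borel ((*v) C)) B" .
qed (simp add: mvnormal_def)

text \<open>Both facts are transported from the standard normal law along \<open>y = C *v x\<close>.
  The transpose of \<open>C\<close> moves onto the argument \<open>u\<close>, whose squared length
  then is the quadratic form of \<open>A\<close>.\<close>

lemma
  fixes A :: "real ^ 'n ^ 'n"
  assumes A: "pos_def A"
  shows prob_space_mvnormal: "prob_space (mvnormal 0 A)"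
    and char_mvnormal: "(\<integral>y. iexp (u \<bullet> y) \<partial>mvnormal 0 A) = complex_of_real (exp (- (u \<bullet> (A *v u)) / 2))"
proof -
  obtain C where C: "det C \<noteq> 0" "A = C ** transpose C" using pos_def_factor[OF A] .
  interpret prob_space "std_mvnormal :: (real ^ 'n) measure" by (rule prob_space_std_mvnormal)
  note eq = mvnormal_eq_distr[OF C(1), folded C(2)]
  show "prob_space (mvnormal 0 A)" unfolding eq by (rule prob_space_distr) simp
  have i: "u \<bullet> (C *v y) = (transpose C *v u) \<bullet> y" for y
    by (metis dot_lmul_matrix transpose_matrix_vector)
  have "(\<integral>y. iexp (u \<bullet> y) \<partial>mvnormal 0 A) = (\<integral>y. iexp (u \<bullet> (C *v y)) \<partial>std_mvnormal)"
    unfolding eq by (rule integral_distr) auto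
  also have "\<dots> = complex_of_real (exp (- ((transpose C *v u) \<bullet> (transpose C *v u)) / 2))"
    unfolding i by (rule char_std_mvnormal)
  also have "(transpose C *v u) \<bullet> (transpose C *v u) = u \<bullet> (A *v u)"
    unfolding i[symmetric] C(2) matrix_vector_mul_assoc ..
  finally show "(\<integral>y. iexp (u \<bullet> y) \<partial>mvnormal 0 A) = complex_of_real (exp (- (u \<bullet> (A *v u)) / 2))" .
qed

section \<open>Gaussian smoothing and the continuity theorem\<close>

lemma nonneg_le_indicator_cball:
  fixes f :: "'b::real_normed_vector \<Rightarrow> real"
  assumes "\<And>y. \<bar>f y\<bar> \<le> K" "\<And>y. R < norm y \<Longrightarrow> f y = 0"
  shows "\<bar>f y\<bar> \<le> K * indicator (cball 0 R) y"
  using assms(1)[of y] assms(2)[of y] by (cases "norm y \<le> R") (auto simp: indicator_def)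

text \<open>The substitution \<open>b = y + s *\<^sub>R z\<close> moves the dependence on
  \<open>y\<close> from \<open>f\<close> into a Gaussian kernel. Fubini's theorem then isolates the
  average of that kernel under \<open>\<mu>\<close> at each fixed \<open>b\<close>, the only place
  where \<open>\<mu>\<close> enters.\<close>

lemma gaussian_smoothing_eq:
  fixes f :: "real ^ 'n \<Rightarrow> real" and \<mu> :: "(real ^ 'n) measure"
  assumes \<mu>: "prob_space \<mu>" "sets \<mu> = sets borel"
    and f[measurable]: "f \<in> borel_measurable borel"
    and K: "\<And>y. \<bar>f y\<bar> \<le> K" and R: "\<And>y. R < norm y \<Longrightarrow> f y = 0" and s: "0 < s"
  shows "(\<integral>y. (\<integral>z. f (y + s *\<^sub>R z) \<partial>std_mvnormal) \<partial>\<mu>) =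
    (\<integral>b. f b * (\<integral>y. exp (- (((b - y) /\<^sub>R s) \<bullet> ((b - y) /\<^sub>R s)) / 2) \<partial>\<mu>) \<partial>lborel) / (s ^ CARD('n) * sqrt ((2 * pi) ^ CARD('n)))"
proof -
  interpret prob_space \<mu> by fact
  note [measurable_cong] = \<mu>(2)
  have sp: "space \<mu> = UNIV" using sets_eq_imp_space_eq[OF \<mu>(2)] by simp
  let ?e = "\<lambda>b y. exp (- (((b - y) /\<^sub>R s) \<bullet> ((b - y) /\<^sub>R s)) / 2)"
  let ?c = "s ^ CARD('n) * sqrt ((2 * pi) ^ CARD('n))"
  have inner: "(\<integral>z. f (y + s *\<^sub>R z) \<partial>std_mvnormal) = (\<integral>b. f b * ?e b y \<partial>lborel) / ?c" for y
  proof -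
    define G where "G = (\<lambda>b. f b * ?e b y)"
    have [measurable]: "G \<in> borel_measurable borel" unfolding G_def by measurable
    have "(\<integral>b. G b \<partial>lborel) = (\<integral>b. G b \<partial>density (distr lborel borel (\<lambda>x. y + s *\<^sub>R x)) (\<lambda>_. \<bar>s\<bar> ^ DIM(real^'n)))"
      by (subst lborel_affine[of s y]) (use s in auto)
    also have "\<dots> = s ^ CARD('n) * (\<integral>z. G (y + s *\<^sub>R z) \<partial>lborel)"
      using s by (subst integral_density) (auto simp: integral_distr)
    finally have "(\<integral>b. f b * ?e b y \<partial>lborel) = s ^ CARD('n) * (\<integral>z. f (y + s *\<^sub>R z) * ?e (y + s *\<^sub>R z) y \<partial>lborel)"
      unfolding G_def .
    also have "\<dots> = s ^ CARD('n) * (\<integral>z. f (y + s *\<^sub>R z) * exp (- (z \<bullet> z) / 2) \<partial>lborel)"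
    proof -
      have eq: "((y + s *\<^sub>R z) - y) /\<^sub>R s = z" for z using s by simp
      show ?thesis unfolding eq by simp
    qed
    also have "(\<integral>z. f (y + s *\<^sub>R z) * exp (- (z \<bullet> z) / 2) \<partial>lborel)
      = (\<integral>z. sqrt ((2 * pi) ^ CARD('n)) * ((\<Prod>i\<in>UNIV. std_normal_density (z $ i)) *\<^sub>R f (y + s *\<^sub>R z)) \<partial>lborel)"
      by (intro Bochner_Integration.integral_cong refl) (simp add: prod_std_normal_density)
    also have "\<dots> = sqrt ((2 * pi) ^ CARD('n)) * (\<integral>z. f (y + s *\<^sub>R z) \<partial>std_mvnormal)"
      unfolding std_mvnormal_def by (subst integral_density) (auto intro!: prod_nonneg)
    finally show ?thesis using s by simp
  qed
  interpret pair_sigma_finite \<mu> lborel ..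
  \<comment> \<open>Bounded support of \<open>f\<close> and finiteness of \<open>\<mu>\<close> make
    the constant \<open>K\<close> on a ball an integrable majorant on the product space.\<close>
  have int: "integrable (\<mu> \<Otimes>\<^sub>M lborel) (\<lambda>(y, b). f b * ?e b y)"
  proof (rule Bochner_Integration.integrable_bound)
    have "emeasure (\<mu> \<Otimes>\<^sub>M lborel) (space \<mu> \<times> cball (0::real^'n) R) = emeasure \<mu> (space \<mu>) * emeasure lborel (cball (0::real^'n) R)"
      by (rule lborel.emeasure_pair_measure_Times) auto
    also have "\<dots> < \<infinity>" by (simp add: emeasure_space_1 emeasure_lborel_cball_finite[unfolded infinity_ennreal_def])
    finally show "integrable (\<mu> \<Otimes>\<^sub>M lborel) (\<lambda>z. K * indicator (space \<mu> \<times> cball (0::real^'n) R) z)"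
      by (intro integrable_mult_right integrable_real_indicator) auto
    show "AE z in \<mu> \<Otimes>\<^sub>M lborel. norm ((case z of (y, b) \<Rightarrow> f b * ?e b y)) \<le> norm (K * indicator (space \<mu> \<times> cball (0::real^'n) R) z)"
    proof -
      have "\<bar>f b\<bar> * ?e b y \<le> K * indicator (cball 0 R) b" for y b
      proof -
        have "\<bar>f b\<bar> * ?e b y \<le> (K * indicator (cball 0 R) b) * 1"
          by (intro mult_mono nonneg_le_indicator_cball[OF K R]) (use order_trans[OF abs_ge_zero K] s in \<open>auto simp: less_imp_le\<close>)
        then show ?thesis by simp
      qed
      then have *: "norm (f b * ?e b y) \<le> \<bar>K * indicator (cball 0 R) b\<bar>" for y b
        unfolding real_norm_def abs_mult[of "f b" for b] abs_exp_cancel by (rule order_trans[OF _ abs_ge_self])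
      have "norm (f b * ?e b y) \<le> norm (K * indicator (space \<mu> \<times> cball (0::real^'n) R) (y, b))" for y b
        using *[of b y] unfolding real_norm_def by (simp only: indicator_times sp) simp
      then show ?thesis by (intro AE_I2) (auto simp: split_beta)
    qed
  qed measurable
  have "(\<integral>y. (\<integral>z. f (y + s *\<^sub>R z) \<partial>std_mvnormal) \<partial>\<mu>) = (\<integral>y. (\<integral>b. f b * ?e b y \<partial>lborel) \<partial>\<mu>) / ?c"
    unfolding inner by simp
  also have "(\<integral>y. (\<integral>b. f b * ?e b y \<partial>lborel) \<partial>\<mu>) = (\<integral>b. (\<integral>y. f b * ?e b y \<partial>\<mu>) \<partial>lborel)"
    by (rule Fubini_integral[symmetric, OF int])
  finally show ?thesis by simp
qed

text \<open>The Gaussian kernel is the characteristic function of the standard normal law at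
  \<open>(b - y) /\<^sub>R s\<close>. After Fubini the measure \<open>\<mu>\<close> is seen only
  through its own characteristic function.\<close>

lemma gaussian_expectation_char:
  fixes \<mu> :: "(real ^ 'n) measure"
  assumes \<mu>: "prob_space \<mu>" "sets \<mu> = sets borel"
  shows "complex_of_real (\<integral>y. exp (- (((b - y) /\<^sub>R s) \<bullet> ((b - y) /\<^sub>R s)) / 2) \<partial>\<mu>)
     = (\<integral>z. iexp ((b /\<^sub>R s) \<bullet> z) * (\<integral>y. iexp ((- (z /\<^sub>R s)) \<bullet> y) \<partial>\<mu>) \<partial>std_mvnormal)"
proof -
  interpret prob_space \<mu> by fact
  interpret g: prob_space "std_mvnormal :: (real ^ 'n) measure" by (rule prob_space_std_mvnormal)
  interpret pair_prob_space \<mu> "std_mvnormal :: (real ^ 'n) measure" ..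
  note [measurable_cong] = \<mu>(2)
  have "complex_of_real (\<integral>y. exp (- (((b - y) /\<^sub>R s) \<bullet> ((b - y) /\<^sub>R s)) / 2) \<partial>\<mu>)
     = (\<integral>y. (\<integral>z. iexp (((b - y) /\<^sub>R s) \<bullet> z) \<partial>std_mvnormal) \<partial>\<mu>)"
    unfolding char_std_mvnormal by simp
  also have "\<dots> = (\<integral>z. (\<integral>y. iexp (((b - y) /\<^sub>R s) \<bullet> z) \<partial>\<mu>) \<partial>std_mvnormal)"
  proof (rule Fubini_integral[symmetric])
    show "integrable (\<mu> \<Otimes>\<^sub>M std_mvnormal) (\<lambda>(y, z). iexp (((b - y) /\<^sub>R s) \<bullet> z))"
      by (rule P.integrable_const_bound[where B = 1]) auto
  qed
  also have "\<dots> = (\<integral>z. iexp ((b /\<^sub>R s) \<bullet> z) * (\<integral>y. iexp ((- (z /\<^sub>R s)) \<bullet> y) \<partial>\<mu>) \<partial>std_mvnormal)"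
  proof (intro Bochner_Integration.integral_cong refl)
    fix z
    have "(\<integral>y. iexp (((b - y) /\<^sub>R s) \<bullet> z) \<partial>\<mu>) = (\<integral>y. iexp ((b /\<^sub>R s) \<bullet> z) * iexp ((- (z /\<^sub>R s)) \<bullet> y) \<partial>\<mu>)"
    proof (intro Bochner_Integration.integral_cong refl)
      fix y
      have "((b - y) /\<^sub>R s) \<bullet> z = (b /\<^sub>R s) \<bullet> z + (- (z /\<^sub>R s)) \<bullet> y"
        by (simp add: inner_diff_left inner_diff_right inner_commute right_diff_distrib)
      then show "iexp (((b - y) /\<^sub>R s) \<bullet> z) = iexp ((b /\<^sub>R s) \<bullet> z) * iexp ((- (z /\<^sub>R s)) \<bullet> y)"
        by (simp only: of_real_add distrib_left exp_add)
    qed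
    also have "\<dots> = iexp ((b /\<^sub>R s) \<bullet> z) * (\<integral>y. iexp ((- (z /\<^sub>R s)) \<bullet> y) \<partial>\<mu>)"
      by (rule integral_mult_right_zero)
    finally show "(\<integral>y. iexp (((b - y) /\<^sub>R s) \<bullet> z) \<partial>\<mu>) = iexp ((b /\<^sub>R s) \<bullet> z) * (\<integral>y. iexp ((- (z /\<^sub>R s)) \<bullet> y) \<partial>\<mu>)" .
  qed
  finally show ?thesis .
qed

text \<open>Uniform continuity holds on the compact ball of radius \<open>R + 1\<close>. Of two
  points at distance below 1, either both lie in that ball or \<open>f\<close> vanishes at
  both.\<close>

lemma uniformly_continuous_bounded_support:
  fixes f :: "'b::{real_normed_vector, heine_borel} \<Rightarrow> real"
  assumes c: "continuous_on UNIV f" and R: "\<And>y. R < norm y \<Longrightarrow> f y = 0" and e: "0 < e"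
  obtains d where "0 < d" "\<And>x y. dist x y < d \<Longrightarrow> \<bar>f x - f y\<bar> < e"
proof -
  have "uniformly_continuous_on (cball 0 (R + 1)) f"
    by (rule compact_uniformly_continuous) (auto intro: continuous_on_subset[OF c])
  then obtain d where d: "0 < d" "\<And>x y. x \<in> cball 0 (R + 1) \<Longrightarrow> y \<in> cball 0 (R + 1) \<Longrightarrow> dist y x < d \<Longrightarrow> dist (f y) (f x) < e"
    using e unfolding uniformly_continuous_on_def by metis
  show ?thesis
  proof (rule that[of "min d 1"])
    fix x y :: 'b assume xy: "dist x y < min d 1"
    have n: "norm x \<le> norm y + dist x y" "norm y \<le> norm x + dist x y"
      using norm_triangle_sub[of x y] norm_triangle_sub[of y x] by (auto simp: dist_norm norm_minus_commute)
    show "\<bar>f x - f y\<bar> < e"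
    proof (cases "norm x \<le> R \<or> norm y \<le> R")
      case True
      then have "x \<in> cball 0 (R + 1)" "y \<in> cball 0 (R + 1)" using n xy by auto
      then show ?thesis using d(2)[of y x] xy by (simp add: dist_real_def)
    next
      case False then show ?thesis using R e by simp
    qed
  qed (use d in auto)
qed

text \<open>The events decrease in \<open>N\<close> and have empty intersection. This is tightness
  of a single law.\<close>

lemma (in prob_space) norm_tail_small:
  fixes Y :: "'a \<Rightarrow> 'b::{real_normed_vector, second_countable_topology}"
  assumes [measurable]: "Y \<in> borel_measurable M" and e: "0 < e"
  obtains N :: nat where "prob {\<omega> \<in> space M. real N \<le> norm (Y \<omega>)} < e"
proof -
  have "(\<lambda>N. prob {\<omega> \<in> space M. real N \<le> norm (Y \<omega>)}) \<longlonglongrightarrow> prob (\<Inter>N. {\<omega> \<in> space M. real N \<le> norm (Y \<omega>)})"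
    by (rule finite_Lim_measure_decseq) (auto simp: decseq_def)
  moreover have "(\<Inter>N. {\<omega> \<in> space M. real N \<le> norm (Y \<omega>)}) = {}"
  proof -
    have "\<exists>N. \<not> real N \<le> norm (Y \<omega>)" for \<omega> using reals_Archimedean2[of "norm (Y \<omega>)"] by (auto simp: not_le)
    then show ?thesis by auto
  qed
  ultimately have "\<forall>\<^sub>F N in sequentially. prob {\<omega> \<in> space M. real N \<le> norm (Y \<omega>)} < e"
    using e by (intro order_tendstoD) auto
  then show ?thesis using that by (auto simp: eventually_sequentially)
qed

text \<open>On a ball that carries most of the Gaussian mass the displacement
  \<open>s *\<^sub>R z\<close> stays below the modulus of continuity; off that ball the difference
  is at most \<open>2 * K\<close>.\<close>

lemma gaussian_smoothing_approx:
  fixes f :: "real ^ 'n \<Rightarrow> real"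
  assumes c: "continuous_on UNIV f" and K: "\<And>y. \<bar>f y\<bar> \<le> K"
    and R: "\<And>y. R < norm y \<Longrightarrow> f y = 0" and e: "0 < e"
  obtains s where "0 < s" "\<And>y. \<bar>(\<integral>z. f (y + s *\<^sub>R z) \<partial>std_mvnormal) - f y\<bar> \<le> e"
proof -
  interpret g: prob_space "std_mvnormal :: (real ^ 'n) measure" by (rule prob_space_std_mvnormal)
  have K0: "0 \<le> K" using order_trans[OF abs_ge_zero K] .
  have [measurable]: "f \<in> borel_measurable borel" by (rule borel_measurable_continuous_onI[OF c])
  obtain d where d: "0 < d" "\<And>x y. dist x y < d \<Longrightarrow> \<bar>f x - f y\<bar> < e / 2"
    by (rule uniformly_continuous_bounded_support[where f = f and R = R and e = "e / 2"]) (use c R e in auto)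
  \<comment> \<open>The tail is weighted by \<open>2 * K\<close>, so this bound costs at most
    \<open>e / 2\<close>; the summand 1 covers \<open>K = 0\<close>.\<close>
  have "0 < e / (4 * K + 1)" using e K0 by simp
  then obtain N where N: "g.prob {z \<in> space std_mvnormal. real N \<le> norm z} < e / (4 * K + 1)"
    using g.norm_tail_small[of "\<lambda>z. z"] by auto
  define s where "s = d / (real N + 1)"
  have s: "0 < s" using d by (simp add: s_def)
  have "\<bar>(\<integral>z. f (y + s *\<^sub>R z) \<partial>std_mvnormal) - f y\<bar> \<le> e" for y
  proof -
    let ?A = "{z :: real ^ 'n. real N \<le> norm z}"
    have bd: "\<bar>f (y + s *\<^sub>R z) - f y\<bar> \<le> e / 2 + 2 * K * indicator ?A z" for z
    proof (cases "z \<in> ?A")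
      case True
      then show ?thesis using K[of y] K[of "y + s *\<^sub>R z"] e by (auto simp: indicator_def)
    next
      case False
      then have "s * norm z < d" 
      proof -
        have "d * norm z < d * (real N + 1)" using False d(1) by (intro mult_strict_left_mono) auto
        then show ?thesis unfolding s_def by (simp add: field_simps)
      qed
      then have "\<bar>f (y + s *\<^sub>R z) - f y\<bar> < e / 2" using s by (intro d(2)) (simp add: dist_norm)
      then show ?thesis using False by simp
    qed
    have i: "integrable std_mvnormal (\<lambda>z. f (y + s *\<^sub>R z))"
      by (rule g.integrable_const_bound[where B = K]) (auto simp: K)
    have i2: "integrable std_mvnormal (\<lambda>z. e / 2 + 2 * K * indicator ?A z)"
      by (intro Bochner_Integration.integrable_add integrable_mult_right integrable_real_indicator) (auto simp: less_top[symmetric])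
    have "(\<integral>z. f (y + s *\<^sub>R z) \<partial>std_mvnormal) - f y = (\<integral>z. f (y + s *\<^sub>R z) - f y \<partial>std_mvnormal)"
      using i g.prob_space by simp
    also have "\<bar>\<dots>\<bar> \<le> (\<integral>z. \<bar>f (y + s *\<^sub>R z) - f y\<bar> \<partial>std_mvnormal)" by (rule integral_abs_bound)
    also have "\<dots> \<le> (\<integral>z. e / 2 + 2 * K * indicator ?A z \<partial>std_mvnormal)"
      by (intro integral_mono bd i2) (use i in auto)
    also have "\<dots> = e / 2 + 2 * K * g.prob ?A"
      using g.prob_space by (subst Bochner_Integration.integral_add) (auto simp: less_top[symmetric])
    also have "\<dots> \<le> e / 2 + 2 * K * (e / (4 * K + 1))"
      using N K0 by (intro add_left_mono mult_left_mono) auto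
    also have "\<dots> \<le> e / 2 + e / 2"
      using K0 e by (intro add_left_mono) (simp add: field_simps)
    finally show ?thesis by simp
  qed
  with s show ?thesis using that by blast
qed

text \<open>Smoothing changes the integrals by at most \<open>e / 4\<close>, uniformly over all
  probability measures. For the smoothed function, convergence of characteristic functions passes
  through two dominated limits: over \<open>z\<close> for each kernel average, and over
  \<open>b\<close> with majorant \<open>\<bar>f b\<bar>\<close>.\<close>

lemma integral_conv_compact_support:
  fixes \<mu> :: "nat \<Rightarrow> (real ^ 'n) measure" and f :: "real ^ 'n \<Rightarrow> real"
  assumes \<mu>: "\<And>n. prob_space (\<mu> n)" "\<And>n. sets (\<mu> n) = sets borel"
    and \<nu>: "prob_space \<nu>" "sets \<nu> = sets borel"
    and conv: "\<And>u. (\<lambda>n. \<integral>y. iexp (u \<bullet> y) \<partial>\<mu> n) \<longlonglongrightarrow> (\<integral>y. iexp (u \<bullet> y) \<partial>\<nu>)"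
    and c: "continuous_on UNIV f" and K: "\<And>y. \<bar>f y\<bar> \<le> K" and R: "\<And>y. R < norm y \<Longrightarrow> f y = 0"
  shows "(\<lambda>n. \<integral>y. f y \<partial>\<mu> n) \<longlonglongrightarrow> (\<integral>y. f y \<partial>\<nu>)"
proof -
  have f[measurable]: "f \<in> borel_measurable borel" by (rule borel_measurable_continuous_onI[OF c])
  interpret g: prob_space "std_mvnormal :: (real ^ 'n) measure" by (rule prob_space_std_mvnormal)
  have smooth: "(\<lambda>n. \<integral>y. (\<integral>z. f (y + s *\<^sub>R z) \<partial>std_mvnormal) \<partial>\<mu> n) \<longlonglongrightarrow> (\<integral>y. (\<integral>z. f (y + s *\<^sub>R z) \<partial>std_mvnormal) \<partial>\<nu>)"
    if s: "0 < s" for s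
  proof -
    define h where "h = (\<lambda>\<kappa> b :: real ^ 'n. \<integral>y. exp (- (((b - y) /\<^sub>R s) \<bullet> ((b - y) /\<^sub>R s)) / 2) \<partial>\<kappa>)"
    have h01: "\<bar>h \<kappa> b\<bar> \<le> 1" if "prob_space \<kappa>" for \<kappa> b
    proof -
      interpret prob_space \<kappa> by fact
      have "\<bar>h \<kappa> b\<bar> \<le> (\<integral>y. \<bar>exp (- (((b - y) /\<^sub>R s) \<bullet> ((b - y) /\<^sub>R s)) / 2)\<bar> \<partial>\<kappa>)"
        unfolding h_def by (rule integral_abs_bound)
      also have "\<dots> \<le> 1"
        by (cases "integrable \<kappa> (\<lambda>y. \<bar>exp (- (((b - y) /\<^sub>R s) \<bullet> ((b - y) /\<^sub>R s)) / 2)\<bar>)")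
           (auto simp: not_integrable_integral_eq s less_imp_le intro!: integral_le_const)
      finally show ?thesis .
    qed
    have hm[measurable]: "h \<kappa> \<in> borel_measurable borel" if "prob_space \<kappa>" "sets \<kappa> = sets borel" for \<kappa>
    proof -
      interpret prob_space \<kappa> by fact
      note [measurable_cong] = that(2)
      show ?thesis unfolding h_def by measurable
    qed
    \<comment> \<open>For fixed \<open>b\<close> the kernel average is a Gaussian integral of
      characteristic functions, all of modulus at most 1, so their pointwise convergence
      suffices.\<close>
    have hlim: "(\<lambda>n. h (\<mu> n) b) \<longlonglongrightarrow> h \<nu> b" for b
    proof -
      have "(\<lambda>n. \<integral>z. iexp ((b /\<^sub>R s) \<bullet> z) * (\<integral>y. iexp ((- (z /\<^sub>R s)) \<bullet> y) \<partial>\<mu> n) \<partial>std_mvnormal)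
        \<longlonglongrightarrow> (\<integral>z. iexp ((b /\<^sub>R s) \<bullet> z) * (\<integral>y. iexp ((- (z /\<^sub>R s)) \<bullet> y) \<partial>\<nu>) \<partial>std_mvnormal)"
      proof (rule integral_dominated_convergence[where w = "\<lambda>_. 1"])
        have m: "(\<lambda>z. \<integral>y. iexp ((- (z /\<^sub>R s)) \<bullet> y) \<partial>\<kappa>) \<in> borel_measurable borel"
          if "prob_space \<kappa>" "sets \<kappa> = sets borel" for \<kappa> :: "(real ^ 'n) measure"
        proof -
          interpret prob_space \<kappa> by fact
          note [measurable_cong] = that(2)
          show ?thesis by measurable
        qed
        show "(\<lambda>z. iexp ((b /\<^sub>R s) \<bullet> z) * (\<integral>y. iexp ((- (z /\<^sub>R s)) \<bullet> y) \<partial>\<nu>)) \<in> borel_measurable std_mvnormal"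
          using m[OF \<nu>] by measurable
        show "(\<lambda>z. iexp ((b /\<^sub>R s) \<bullet> z) * (\<integral>y. iexp ((- (z /\<^sub>R s)) \<bullet> y) \<partial>\<mu> n)) \<in> borel_measurable std_mvnormal" for n
          using m[OF \<mu>] by measurable
        show "AE z in std_mvnormal. norm (iexp ((b /\<^sub>R s) \<bullet> z) * (\<integral>y. iexp ((- (z /\<^sub>R s)) \<bullet> y) \<partial>\<mu> n)) \<le> 1" for n
        proof (rule AE_I2)
          fix z
          interpret prob_space "\<mu> n" by (rule \<mu>)
          note [measurable_cong] = \<mu>(2)[of n]
          have "norm (\<integral>y. iexp ((- (z /\<^sub>R s)) \<bullet> y) \<partial>\<mu> n) \<le> (\<integral>y. norm (iexp ((- (z /\<^sub>R s)) \<bullet> y)) \<partial>\<mu> n)"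
            by (rule integral_norm_bound)
          also have "\<dots> = 1" using prob_space by (simp only: norm_exp_i_times) simp
          finally show "norm (iexp ((b /\<^sub>R s) \<bullet> z) * (\<integral>y. iexp ((- (z /\<^sub>R s)) \<bullet> y) \<partial>\<mu> n)) \<le> 1"
            by (simp only: norm_mult norm_exp_i_times mult_1_left)
        qed
        show "AE z in std_mvnormal. (\<lambda>n. iexp ((b /\<^sub>R s) \<bullet> z) * (\<integral>y. iexp ((- (z /\<^sub>R s)) \<bullet> y) \<partial>\<mu> n))
           \<longlonglongrightarrow> iexp ((b /\<^sub>R s) \<bullet> z) * (\<integral>y. iexp ((- (z /\<^sub>R s)) \<bullet> y) \<partial>\<nu>)"
          by (intro AE_I2 tendsto_mult tendsto_const conv)
      qed simp
      then have "(\<lambda>n. complex_of_real (h (\<mu> n) b)) \<longlonglongrightarrow> complex_of_real (h \<nu> b)"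
        unfolding h_def gaussian_expectation_char[OF \<mu>] gaussian_expectation_char[OF \<nu>] .
      then show ?thesis by (simp add: tendsto_of_real_iff)
    qed
    have fi: "integrable lborel (\<lambda>b. \<bar>f b\<bar>)"
    proof (rule Bochner_Integration.integrable_bound)
      show "integrable lborel (\<lambda>b. K * indicator (cball (0 :: real ^ 'n) R) b)"
        by (intro integrable_mult_right integrable_real_indicator) (auto simp: emeasure_lborel_cball_finite[unfolded infinity_ennreal_def])
      have "\<bar>f b\<bar> \<le> K * indicator (cball 0 R) b" for b
        by (rule nonneg_le_indicator_cball) (use K R in auto)
      then show "AE b in lborel. norm \<bar>f b\<bar> \<le> norm (K * indicator (cball 0 R) b)"
        by (intro AE_I2) (auto intro: order_trans[OF _ abs_ge_self])
    qed simp
    have "(\<lambda>n. \<integral>b. f b * h (\<mu> n) b \<partial>lborel) \<longlonglongrightarrow> (\<integral>b. f b * h \<nu> b \<partial>lborel)"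
    proof (rule integral_dominated_convergence[where w = "\<lambda>b. \<bar>f b\<bar>"])
      show "AE b in lborel. norm (f b * h (\<mu> n) b) \<le> \<bar>f b\<bar>" for n
        using mult_left_mono[OF h01[OF \<mu>(1)] abs_ge_zero] by (intro AE_I2) (simp add: abs_mult)
      show "AE b in lborel. (\<lambda>n. f b * h (\<mu> n) b) \<longlonglongrightarrow> f b * h \<nu> b"
        by (intro AE_I2 tendsto_mult tendsto_const hlim)
      show "(\<lambda>b. f b * h \<nu> b) \<in> borel_measurable lborel" using hm[OF \<nu>] by measurable
      show "(\<lambda>b. f b * h (\<mu> n) b) \<in> borel_measurable lborel" for n using hm[OF \<mu>] by measurable
    qed (rule fi)
    moreover have "(\<integral>y. (\<integral>z. f (y + s *\<^sub>R z) \<partial>std_mvnormal) \<partial>\<kappa>)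
        = (\<integral>b. f b * h \<kappa> b \<partial>lborel) / (s ^ CARD('n) * sqrt ((2 * pi) ^ CARD('n)))"
      if "prob_space \<kappa>" "sets \<kappa> = sets borel" for \<kappa>
      unfolding h_def by (rule gaussian_smoothing_eq[where K = K and R = R]) (use that f K R s in auto)
    ultimately show ?thesis
      using s by (simp add: \<mu> \<nu>) (intro tendsto_divide tendsto_const, auto)
  qed
  show ?thesis
  proof (rule LIMSEQ_I)
    fix e :: real assume e: "0 < e"
    obtain s where s: "0 < s" and ap: "\<And>y. \<bar>(\<integral>z. f (y + s *\<^sub>R z) \<partial>std_mvnormal) - f y\<bar> \<le> e / 4"
      by (rule gaussian_smoothing_approx[where f = f and K = K and R = R and e = "e / 4"]) (use c K R e in auto)
    let ?g = "\<lambda>y. \<integral>z. f (y + s *\<^sub>R z) \<partial>std_mvnormal"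
    have gm: "?g \<in> borel_measurable borel" by measurable
    have close: "\<bar>(\<integral>y. ?g y \<partial>\<kappa>) - (\<integral>y. f y \<partial>\<kappa>)\<bar> \<le> e / 4"
      if k: "prob_space \<kappa>" "sets \<kappa> = sets borel" for \<kappa>
    proof -
      interpret prob_space \<kappa> by fact
      note [measurable_cong] = k(2)
      have [measurable]: "?g \<in> borel_measurable \<kappa>" using gm by measurable
      have fk: "f \<in> borel_measurable \<kappa>" using f k(2) by (simp cong: measurable_cong_sets)
      have i1: "integrable \<kappa> f" by (rule integrable_const_bound[where B = K]) (use fk K in auto)
      have i3: "integrable \<kappa> (\<lambda>y. ?g y - f y)"
        by (rule integrable_const_bound[where B = "e / 4"]) (use ap in auto)
      have i2: "integrable \<kappa> ?g" using Bochner_Integration.integrable_add[OF i3 i1] by simp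
      have "\<bar>(\<integral>y. ?g y \<partial>\<kappa>) - (\<integral>y. f y \<partial>\<kappa>)\<bar> = \<bar>\<integral>y. ?g y - f y \<partial>\<kappa>\<bar>" using i1 i2 by simp
      also have "\<dots> \<le> (\<integral>y. \<bar>?g y - f y\<bar> \<partial>\<kappa>)" by (rule integral_abs_bound)
      also have "\<dots> \<le> e / 4" by (rule integral_le_const) (use i3 ap in auto)
      finally show ?thesis .
    qed
    obtain n0 where n0: "\<And>n. n0 \<le> n \<Longrightarrow> norm ((\<integral>y. ?g y \<partial>\<mu> n) - (\<integral>y. ?g y \<partial>\<nu>)) < e / 4"
      using LIMSEQ_D[OF smooth[OF s], of "e / 4"] e by auto
    show "\<exists>n0. \<forall>n\<ge>n0. norm ((\<integral>y. f y \<partial>\<mu> n) - (\<integral>y. f y \<partial>\<nu>)) < e"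
    proof (intro exI allI impI)
      fix n assume "n0 \<le> n"
      with n0[of n] close[OF \<mu>, of n] close[OF \<nu>] e
      show "norm ((\<integral>y. f y \<partial>\<mu> n) - (\<integral>y. f y \<partial>\<nu>)) < e" unfolding real_norm_def by linarith
    qed
  qed
qed

text \<open>Tightness is extracted from the convergence itself: the continuous cutoff
  \<open>cut\<close> has bounded support, so its integrals converge, and the mass it misses under
  \<open>\<mu> n\<close> is eventually as small as demanded of the limit. The test function is then
  replaced by its product with \<open>cut\<close>.\<close>

theorem levy_continuity_vec:
  fixes \<mu> :: "nat \<Rightarrow> (real ^ 'n) measure"
  assumes \<mu>: "\<And>n. prob_space (\<mu> n)" "\<And>n. sets (\<mu> n) = sets borel"
    and \<nu>: "prob_space \<nu>" "sets \<nu> = sets borel"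
    and conv: "\<And>u. (\<lambda>n. \<integral>y. iexp (u \<bullet> y) \<partial>\<mu> n) \<longlonglongrightarrow> (\<integral>y. iexp (u \<bullet> y) \<partial>\<nu>)"
  shows "weakly_converges \<mu> \<nu>"
  unfolding weakly_converges_def
proof (intro allI impI, elim conjE)
  fix f :: "real ^ 'n \<Rightarrow> real" assume c: "continuous_on UNIV f" and b: "bounded (range f)"
  have f[measurable]: "f \<in> borel_measurable borel" by (rule borel_measurable_continuous_onI[OF c])
  obtain K where K: "\<And>y. \<bar>f y\<bar> \<le> K" "0 < K" using b unfolding bounded_pos by auto
  show "(\<lambda>n. \<integral>y. f y \<partial>\<mu> n) \<longlonglongrightarrow> (\<integral>y. f y \<partial>\<nu>)"
  proof (rule LIMSEQ_I)
    fix e :: real assume e: "0 < e"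
    interpret n: prob_space \<nu> by (rule \<nu>(1))
    have [measurable]: "(\<lambda>y. y) \<in> borel_measurable \<nu>" using \<nu>(2) by (simp add: measurable_ident_sets)
    obtain N :: nat where N: "n.prob {y \<in> space \<nu>. real N \<le> norm y} < e / (4 * K)"
      using n.norm_tail_small[of "\<lambda>y. y" "e / (4 * K)"] e K(2) by auto
    define cut where "cut = (\<lambda>y :: real ^ 'n. max 0 (min 1 (real N + 1 - norm y)))"
    have cut01: "0 \<le> cut y" "cut y \<le> 1" for y by (auto simp: cut_def)
    have cutc: "continuous_on UNIV cut" unfolding cut_def by (intro continuous_intros)
    have cut0: "cut y = 0" if "real N + 1 < norm y" for y using that by (simp add: cut_def)
    have cut1: "cut y = 1" if "norm y < real N" for y using that by (simp add: cut_def)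
    have cutm[measurable]: "cut \<in> borel_measurable borel" by (rule borel_measurable_continuous_onI[OF cutc])
    have conv1: "(\<lambda>n. \<integral>y. cut y \<partial>\<mu> n) \<longlonglongrightarrow> (\<integral>y. cut y \<partial>\<nu>)"
      by (rule integral_conv_compact_support[OF \<mu> \<nu> conv cutc, where K = 1 and R = "real N + 1"])
         (use cut01 cut0 in auto)
    have conv2: "(\<lambda>n. \<integral>y. f y * cut y \<partial>\<mu> n) \<longlonglongrightarrow> (\<integral>y. f y * cut y \<partial>\<nu>)"
    proof (rule integral_conv_compact_support[OF \<mu> \<nu> conv, where K = K and R = "real N + 1"])
      show "continuous_on UNIV (\<lambda>y. f y * cut y)" by (intro continuous_intros c cutc)
      show "\<bar>f y * cut y\<bar> \<le> K" for y
        using mult_mono[OF K(1)[of y] cut01(2)[of y]] K(2) cut01[of y] by (simp add: abs_mult)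
    qed (use cut0 in auto)
    have split: "\<bar>(\<integral>y. f y \<partial>\<kappa>) - (\<integral>y. f y * cut y \<partial>\<kappa>)\<bar> \<le> K * (1 - (\<integral>y. cut y \<partial>\<kappa>))"
      and icut: "integrable \<kappa> cut"
      if k: "prob_space \<kappa>" "sets \<kappa> = sets borel" for \<kappa>
    proof -
      interpret prob_space \<kappa> by fact
      note [measurable_cong] = k(2)
      have fk: "f \<in> borel_measurable \<kappa>" using f k(2) by (simp cong: measurable_cong_sets)
      have i1: "integrable \<kappa> f" by (rule integrable_const_bound[where B = K]) (use fk K in auto)
      have cutk: "cut \<in> borel_measurable \<kappa>" using cutm k(2) by (simp cong: measurable_cong_sets)
      show i2: "integrable \<kappa> cut" by (rule integrable_const_bound[where B = 1]) (use cut01 cutk in auto)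
      have i3: "integrable \<kappa> (\<lambda>y. f y * cut y)"
        by (rule integrable_cmult_bounded[OF i2 fk, where B = K]) (auto simp: K)
      have "\<bar>(\<integral>y. f y \<partial>\<kappa>) - (\<integral>y. f y * cut y \<partial>\<kappa>)\<bar> = \<bar>\<integral>y. f y - f y * cut y \<partial>\<kappa>\<bar>" using i1 i3 by simp
      also have "\<dots> \<le> (\<integral>y. \<bar>f y - f y * cut y\<bar> \<partial>\<kappa>)" by (rule integral_abs_bound)
      also have "\<dots> \<le> (\<integral>y. K * (1 - cut y) \<partial>\<kappa>)"
      proof (rule integral_mono)
        show "\<bar>f y - f y * cut y\<bar> \<le> K * (1 - cut y)" for y
        proof -
          have "\<bar>f y - f y * cut y\<bar> = \<bar>f y\<bar> * (1 - cut y)"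
            using cut01[of y] abs_mult[of "f y" "1 - cut y"] by (simp add: right_diff_distrib)
          also have "\<dots> \<le> K * (1 - cut y)" using K cut01 by (intro mult_right_mono) auto
          finally show ?thesis .
        qed
      qed (use i1 i2 i3 in auto)
      also have "\<dots> = K * (1 - (\<integral>y. cut y \<partial>\<kappa>))" using i2 prob_space by simp
      finally show "\<bar>(\<integral>y. f y \<partial>\<kappa>) - (\<integral>y. f y * cut y \<partial>\<kappa>)\<bar> \<le> K * (1 - (\<integral>y. cut y \<partial>\<kappa>))" .
    qed
    have "1 - (\<integral>y. cut y \<partial>\<nu>) \<le> n.prob {y \<in> space \<nu>. real N \<le> norm y}"
    proof -
      have "1 - (\<integral>y. cut y \<partial>\<nu>) = (\<integral>y. 1 - cut y \<partial>\<nu>)" using icut[OF \<nu>] n.prob_space by simp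
      also have "\<dots> \<le> (\<integral>y. indicator {y \<in> space \<nu>. real N \<le> norm y} y \<partial>\<nu>)"
      proof (rule integral_mono)
        show "integrable \<nu> (\<lambda>y. indicator {y \<in> space \<nu>. real N \<le> norm y} y :: real)"
          by (rule integrable_real_indicator) (auto simp: less_top[symmetric])
        show "1 - cut y \<le> indicator {y \<in> space \<nu>. real N \<le> norm y} y" if "y \<in> space \<nu>" for y
          using that cut1[of y] cut01[of y] by (cases "norm y < real N") (auto simp: indicator_def)
      qed (use icut[OF \<nu>] in auto)
      also have "\<dots> = n.prob {y \<in> space \<nu>. real N \<le> norm y}" by simp
      finally show ?thesis .
    qed
    with N have "1 - (\<integral>y. cut y \<partial>\<nu>) < e / (4 * K)" by linarith
    then have nu: "K * (1 - (\<integral>y. cut y \<partial>\<nu>)) < e / 4"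
      using K(2) by (simp add: pos_less_divide_eq mult.commute mult.left_commute)
    \<comment> \<open>This is the tightness of the sequence: the bound on the missing mass passes
      from \<open>\<nu>\<close> to \<open>\<mu> n\<close>.\<close>
    have "\<forall>\<^sub>F n in sequentially. K * (1 - (\<integral>y. cut y \<partial>\<mu> n)) < e / 4"
      by (rule order_tendstoD(2)[OF _ nu]) (intro tendsto_intros conv1)
    moreover have "\<forall>\<^sub>F n in sequentially. \<bar>(\<integral>y. f y * cut y \<partial>\<mu> n) - (\<integral>y. f y * cut y \<partial>\<nu>)\<bar> < e / 4"
      using tendstoD[OF conv2, of "e / 4"] e by (simp add: dist_real_def)
    ultimately have "\<forall>\<^sub>F n in sequentially. norm ((\<integral>y. f y \<partial>\<mu> n) - (\<integral>y. f y \<partial>\<nu>)) < e"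
    proof eventually_elim
      case (elim n)
      with split[OF \<mu>, of n] split[OF \<nu>] nu show ?case unfolding real_norm_def by linarith
    qed
    then show "\<exists>n0. \<forall>n\<ge>n0. norm ((\<integral>y. f y \<partial>\<mu> n) - (\<integral>y. f y \<partial>\<nu>)) < e"
      by (simp add: eventually_sequentially)
  qed
qed

section \<open>Twice differentiable functions of the parameter\<close>

lemma has_derivative_along_axis:
  fixes f :: "real ^ 'm \<Rightarrow> real"
  assumes "(f has_derivative f') (at \<theta>)"
  shows "((\<lambda>h. f (\<theta> + h *\<^sub>R axis i 1)) has_real_derivative f' (axis i 1)) (at 0)"
proof -
  have "((\<lambda>h. f (\<theta> + h *\<^sub>R axis i 1)) has_derivative (\<lambda>h. f' (h *\<^sub>R axis i 1))) (at 0)"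
    by (rule has_derivative_compose[where g = f]) (use assms in \<open>auto intro!: derivative_eq_intros\<close>)
  then show ?thesis
    by (simp add: has_field_derivative_def linear_scale[OF has_derivative_linear[OF assms]] mult_commute_abs)
qed

lemma partial_eq:
  assumes "(f has_derivative f') (at \<theta>)"
  shows "partial i f \<theta> = f' (axis i 1)"
  unfolding partial_def by (rule DERIV_imp_deriv[OF has_derivative_along_axis[OF assms]])

lemma partial_eq_frechet:
  "f differentiable (at \<theta>) \<Longrightarrow> partial i f \<theta> = frechet_derivative f (at \<theta>) (axis i 1)"
  by (rule partial_eq) (simp add: frechet_derivative_works)

lemma partial_cong:
  fixes f g :: "real ^ 'm \<Rightarrow> real"
  assumes "open U" "\<theta> \<in> U" "\<And>x. x \<in> U \<Longrightarrow> f x = g x"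
  shows "partial i f \<theta> = partial i g \<theta>"
proof -
  have "((\<lambda>h. \<theta> + h *\<^sub>R axis i 1) \<longlongrightarrow> \<theta> + 0 *\<^sub>R axis i (1::real)) (nhds 0)"
    by (intro tendsto_intros filterlim_ident)
  then have "\<forall>\<^sub>F h in nhds 0. \<theta> + h *\<^sub>R axis i 1 \<in> U"
    using topological_tendstoD[of _ \<theta> "nhds 0" U] assms by simp
  then show ?thesis
    unfolding partial_def
    by (intro deriv_cong_ev refl) (auto elim!: eventually_mono simp: assms(3))
qed

lemma differentiable_cong_open:
  assumes "open U" "\<theta> \<in> U" "\<And>x. x \<in> U \<Longrightarrow> f x = g x" "f differentiable (at \<theta>)"
  shows "g differentiable (at \<theta>)"
  using assms has_derivative_transform_within_open unfolding differentiable_def by blast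

text \<open>Only Frechet differentiability of the first partial derivatives is needed for the Taylor
  expansion, and this notion is stable under composition with scalar functions.\<close>

definition D2_on :: "(real ^ 'm) set \<Rightarrow> (real ^ 'm \<Rightarrow> real) \<Rightarrow> bool" where
  "D2_on U f \<longleftrightarrow> (\<forall>\<theta>\<in>U. f differentiable (at \<theta>) \<and> (\<forall>i. partial i f differentiable (at \<theta>)))"

lemma D2_onD: "D2_on U f \<Longrightarrow> \<theta> \<in> U \<Longrightarrow> f differentiable (at \<theta>)"
    "D2_on U f \<Longrightarrow> \<theta> \<in> U \<Longrightarrow> partial i f differentiable (at \<theta>)"
  by (auto simp: D2_on_def)

text \<open>Openness of \<open>U\<close> transfers differentiability from the candidates
  \<open>g i\<close> to the partial derivatives, whose agreement is known on \<open>U\<close>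
  only.\<close>

lemma D2_onI:
  assumes "open U" "\<And>\<theta>. \<theta> \<in> U \<Longrightarrow> f differentiable (at \<theta>)"
    "\<And>i \<theta>. \<theta> \<in> U \<Longrightarrow> partial i f \<theta> = g i \<theta>" "\<And>i \<theta>. \<theta> \<in> U \<Longrightarrow> g i differentiable (at \<theta>)"
  shows "D2_on U f"
  unfolding D2_on_def
proof (intro ballI conjI allI assms(2))
  fix \<theta> i assume "\<theta> \<in> U"
  then show "partial i f differentiable (at \<theta>)"
    using differentiable_cong_open[OF assms(1), of \<theta> "g i" "partial i f"] assms(3,4) by simp
qed

lemma D2_on_cong:
  assumes "open U" "\<And>\<theta>. \<theta> \<in> U \<Longrightarrow> f \<theta> = g \<theta>" "D2_on U f"
  shows "D2_on U g"
proof (rule D2_onI[where g = "\<lambda>i. partial i f", OF assms(1)])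
  show "g differentiable (at \<theta>)" if "\<theta> \<in> U" for \<theta>
    by (rule differentiable_cong_open[OF assms(1) that, of f]) (use assms that D2_onD(1) in auto)
  show "partial i g \<theta> = partial i f \<theta>" if "\<theta> \<in> U" for i \<theta>
    using partial_cong[OF assms(1) that, of f g i] assms(2) by simp
qed (rule D2_onD(2)[OF assms(3)])

section \<open>Rules for partial derivatives and closure of \<open>D2_on\<close>\<close>

lemma partial_const[simp]: "partial i (\<lambda>_. c) \<theta> = 0"
  by (simp add: partial_def)

lemma partial_add:
  assumes "f differentiable (at \<theta>)" "g differentiable (at \<theta>)"
  shows "partial i (\<lambda>x. f x + g x) \<theta> = partial i f \<theta> + partial i g \<theta>"
  using assms partial_eq[OF has_derivative_add[OF assms[unfolded frechet_derivative_works]]]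
  by (simp add: partial_eq_frechet)

lemma partial_mult:
  assumes "f differentiable (at \<theta>)" "g differentiable (at \<theta>)"
  shows "partial i (\<lambda>x. f x * g x) \<theta> = f \<theta> * partial i g \<theta> + partial i f \<theta> * g \<theta>"
  using assms partial_eq[OF has_derivative_mult[OF assms[unfolded frechet_derivative_works]]]
  by (simp add: partial_eq_frechet)

lemma partial_compose:
  assumes "f differentiable (at \<theta>)" "(\<phi> has_real_derivative d) (at (f \<theta>))"
  shows "partial i (\<lambda>x. \<phi> (f x)) \<theta> = d * partial i f \<theta>"
  using assms(1) partial_eq[OF has_derivative_compose[OF assms(1)[unfolded frechet_derivative_works]
      assms(2)[unfolded has_field_derivative_def]]]
  by (simp add: partial_eq_frechet)

lemma partial_sum:
  assumes "finite I" "\<And>a. a \<in> I \<Longrightarrow> f a differentiable (at \<theta>)"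
  shows "partial i (\<lambda>x. \<Sum>a\<in>I. f a x) \<theta> = (\<Sum>a\<in>I. partial i (f a) \<theta>)"
  using assms
proof (induction I)
  case (insert a I)
  then show ?case by (simp add: partial_add differentiable_sum)
qed simp

lemma partial_mult_const:
  assumes "f differentiable (at \<theta>)"
  shows "partial i (\<lambda>x. f x * c) \<theta> = partial i f \<theta> * c"
  using partial_mult[OF assms differentiable_const[of c]] by simp

lemma D2_on_const[simp]: "open U \<Longrightarrow> D2_on U (\<lambda>_. c)"
  by (rule D2_onI[where g = "\<lambda>_ _. 0"]) auto

lemma D2_on_add:
  assumes "open U" "D2_on U f" "D2_on U g"
  shows "D2_on U (\<lambda>x. f x + g x)"
  by (rule D2_onI[where g = "\<lambda>i x. partial i f x + partial i g x"])
     (use assms in \<open>auto intro!: partial_add differentiable_add dest: D2_onD\<close>)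

lemma D2_on_mult:
  assumes "open U" "D2_on U f" "D2_on U g"
  shows "D2_on U (\<lambda>x. f x * g x)"
  by (rule D2_onI[where g = "\<lambda>i x. f x * partial i g x + partial i f x * g x"])
     (use assms in \<open>auto intro!: partial_mult differentiable_add differentiable_mult dest: D2_onD\<close>)

lemma D2_on_uminus: "open U \<Longrightarrow> D2_on U f \<Longrightarrow> D2_on U (\<lambda>x. - f x)"
  using D2_on_mult[OF _ D2_on_const, of U f "- 1"] by simp

lemma D2_on_sum:
  assumes "open U" "finite I" "\<And>a. a \<in> I \<Longrightarrow> D2_on U (f a)"
  shows "D2_on U (\<lambda>x. \<Sum>a\<in>I. f a x)"
  using assms(2,3) by (induction I) (auto simp: assms(1) intro: D2_on_add)

lemma D2_on_prod:
  assumes "open U" "finite I" "\<And>a. a \<in> I \<Longrightarrow> D2_on U (f a)"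
  shows "D2_on U (\<lambda>x. \<Prod>a\<in>I. f a x)"
  using assms(2,3) by (induction I) (auto simp: assms(1) intro: D2_on_mult)

lemma D2_on_compose:
  assumes U: "open U" and f: "D2_on U f"
    and d: "\<And>\<theta>. \<theta> \<in> U \<Longrightarrow> (\<phi> has_real_derivative \<phi>' (f \<theta>)) (at (f \<theta>))"
    and d2: "\<And>\<theta>. \<theta> \<in> U \<Longrightarrow> \<phi>' differentiable (at (f \<theta>))"
  shows "D2_on U (\<lambda>x. \<phi> (f x))"
proof (rule D2_onI[where g = "\<lambda>i x. \<phi>' (f x) * partial i f x", OF U])
  fix \<theta> i assume \<theta>: "\<theta> \<in> U"
  have fd: "f differentiable (at \<theta>)" "partial i f differentiable (at \<theta>)" using f \<theta> by (auto dest: D2_onD)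
  show "(\<lambda>x. \<phi> (f x)) differentiable (at \<theta>)"
    using differentiable_chain_at[OF fd(1), of \<phi>] d[OF \<theta>]
    by (auto simp: o_def real_differentiable_def differentiableI)
  show "partial i (\<lambda>x. \<phi> (f x)) \<theta> = \<phi>' (f \<theta>) * partial i f \<theta>"
    by (rule partial_compose[OF fd(1) d[OF \<theta>]])
  show "(\<lambda>x. \<phi>' (f x) * partial i f x) differentiable (at \<theta>)"
    using differentiable_chain_at[OF fd(1) d2[OF \<theta>]] fd(2) by (auto simp: o_def)
qed

lemma D2_on_ln:
  assumes "open U" "D2_on U f" "\<And>\<theta>. \<theta> \<in> U \<Longrightarrow> 0 < f \<theta>"
  shows "D2_on U (\<lambda>x. ln (f x))"
proof (rule D2_on_compose[where \<phi> = ln and \<phi>' = inverse, OF assms(1,2)])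
  show "(ln has_real_derivative inverse (f \<theta>)) (at (f \<theta>))" if "\<theta> \<in> U" for \<theta>
    using DERIV_ln[OF assms(3)[OF that]] .
  show "inverse differentiable (at (f \<theta>))" if "\<theta> \<in> U" for \<theta>
    using assms(3)[OF that] has_derivative_inverse' unfolding differentiable_def by (metis less_irrefl)
qed

lemma D2_on_inverse:
  assumes "open U" "D2_on U f" "\<And>\<theta>. \<theta> \<in> U \<Longrightarrow> f \<theta> \<noteq> 0"
  shows "D2_on U (\<lambda>x. inverse (f x))"
proof (rule D2_on_compose[where \<phi> = inverse and \<phi>' = "\<lambda>x. - (inverse x * inverse x)", OF assms(1,2)])
  show "(inverse has_real_derivative - (inverse (f \<theta>) * inverse (f \<theta>))) (at (f \<theta>))" if "\<theta> \<in> U" for \<theta>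
    using DERIV_inverse[OF assms(3)[OF that]] by (simp add: power2_eq_square numeral_2_eq_2)
  show "(\<lambda>x. - (inverse x * inverse x)) differentiable (at (f \<theta>))" if "\<theta> \<in> U" for \<theta>
    using assms(3)[OF that] by (intro differentiable_minus differentiable_mult differentiable_inverse) auto
qed

text \<open>In the application \<open>L\<close> extracts an entry of a vector or matrix. Evaluation
  of the operator-valued derivative at a fixed axis vector is again bounded linear, so the second
  Frechet derivative yields differentiability of each partial derivative.\<close>

lemma C2_on_imp_D2_on:
  fixes f :: "real ^ 'm \<Rightarrow> 'b::real_normed_vector"
  assumes C: "C2_on V f" and L: "bounded_linear L" and U: "open U" "U \<subseteq> V"
  shows "D2_on U (\<lambda>\<theta>. L (f \<theta>))"
proof -
  obtain f' :: "(real ^ 'm) \<Rightarrow> (real ^ 'm) \<Rightarrow>\<^sub>L 'b" and f'' where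
    f: "\<And>\<theta>. \<theta> \<in> V \<Longrightarrow> (f has_derivative blinfun_apply (f' \<theta>)) (at \<theta>)"
       "\<And>\<theta>. \<theta> \<in> V \<Longrightarrow> (f' has_derivative blinfun_apply (f'' \<theta>)) (at \<theta>)"
    using C unfolding C2_on_def by blast
  have d: "((\<lambda>\<theta>. L (f \<theta>)) has_derivative (\<lambda>v. L (f' \<theta> v))) (at \<theta>)" if "\<theta> \<in> U" for \<theta>
    using bounded_linear.has_derivative[OF L f(1)] that U(2) by blast
  show ?thesis
  proof (rule D2_onI[where g = "\<lambda>i \<theta>. L (f' \<theta> (axis i 1))", OF U(1)])
    fix \<theta> i assume \<theta>: "\<theta> \<in> U"
    show "(\<lambda>\<theta>. L (f \<theta>)) differentiable (at \<theta>)" using d[OF \<theta>] by (auto simp: differentiable_def)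
    show "partial i (\<lambda>\<theta>. L (f \<theta>)) \<theta> = L (f' \<theta> (axis i 1))" by (rule partial_eq[OF d[OF \<theta>]])
    have "((\<lambda>\<theta>. blinfun_apply (f' \<theta>) (axis i 1)) has_derivative (\<lambda>v. blinfun_apply (f'' \<theta> v) (axis i 1))) (at \<theta>)"
      by (rule bounded_linear.has_derivative[OF blinfun.bounded_linear_left f(2)]) (use \<theta> U in auto)
    from bounded_linear.has_derivative[OF L this]
    show "(\<lambda>\<theta>. L (f' \<theta> (axis i 1))) differentiable (at \<theta>)" by (auto simp: differentiable_def)
  qed
qed

section \<open>Determinants and inverse matrices depending on the parameter\<close>

lemma D2_on_det:
  fixes A :: "real ^ 'm \<Rightarrow> real ^ 'r ^ 'r"
  assumes "open U" "\<And>i j. D2_on U (\<lambda>\<theta>. A \<theta> $ i $ j)"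
  shows "D2_on U (\<lambda>\<theta>. det (A \<theta>))"
  unfolding det_def
  by (intro D2_on_sum D2_on_mult D2_on_prod D2_on_const assms) (auto simp: finite_permutations)

text \<open>The entries of the inverse by Cramer's rule.\<close>

definition inv_entry :: "real ^ 'r ^ 'r \<Rightarrow> 'r \<Rightarrow> 'r \<Rightarrow> real" where
  "inv_entry A k l = det (\<chi> i j. if j = k then of_bool (i = l) else A $ i $ j) * inverse (det A)"

lemma matrix_inv_entry:
  fixes A :: "real ^ 'r ^ 'r"
  assumes "det A \<noteq> 0"
  shows "matrix_inv A $ k $ l = inv_entry A k l"
proof -
  have "A ** matrix_inv A = mat 1" using assms by (simp add: matrix_inv_mult invertible_det_nz)
  then have "A *v (matrix_inv A *v axis l 1) = axis l 1"
    by (simp add: matrix_vector_mul_assoc)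
  then have "matrix_inv A *v axis l 1 = (\<chi> k. det (\<chi> i j. if j = k then axis l 1 $ i else A $ i $ j) / det A)"
    using cramer[OF assms] by blast
  moreover have "(matrix_inv A *v axis l 1) $ k = matrix_inv A $ k $ l"
    by (simp add: matrix_vector_mult_basis column_def)
  moreover have "(\<chi> i j. if j = k then axis l 1 $ i else A $ i $ j) = (\<chi> i j. if j = k then of_bool (i = l) else A $ i $ j)"
    by (simp add: vec_eq_iff axis_def)
  ultimately show ?thesis by (simp add: inv_entry_def divide_inverse)
qed

lemma D2_on_inv_entry:
  fixes A :: "real ^ 'm \<Rightarrow> real ^ 'r ^ 'r"
  assumes U: "open U" and A: "\<And>i j. D2_on U (\<lambda>\<theta>. A \<theta> $ i $ j)" and d: "\<And>\<theta>. \<theta> \<in> U \<Longrightarrow> det (A \<theta>) \<noteq> 0"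
  shows "D2_on U (\<lambda>\<theta>. inv_entry (A \<theta>) k l)"
  unfolding inv_entry_def
proof (intro D2_on_mult[OF U] D2_on_det[OF U] D2_on_inverse[OF U] A d)
  show "D2_on U (\<lambda>\<theta>. (\<chi> i j. if j = k then of_bool (i = l) else A \<theta> $ i $ j) $ i $ j)" for i j
    by (cases "j = k") (simp_all add: A U)
qed

text \<open>A permutation other than the identity moves at least two points, so that only the identity
  contributes to the derivative of the determinant at the identity matrix.\<close>

lemma has_derivative_det_at_identity:
  fixes T :: "'p::real_normed_vector \<Rightarrow> real ^ 'r ^ 'r"
  assumes d: "\<And>i j. ((\<lambda>\<theta>. T \<theta> $ i $ j) has_derivative T' i j) (at \<theta>0)" and I: "T \<theta>0 = mat 1"
  shows "((\<lambda>\<theta>. det (T \<theta>)) has_derivative (\<lambda>h. \<Sum>i\<in>UNIV. T' i i h)) (at \<theta>0)"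
proof -
  let ?P = "{p. p permutes (UNIV :: 'r set)}"
  have "((\<lambda>\<theta>. det (T \<theta>)) has_derivative
     (\<lambda>h. \<Sum>p\<in>?P. of_int (sign p) * (\<Sum>i\<in>UNIV. T' i (p i) h * (\<Prod>j\<in>UNIV - {i}. T \<theta>0 $ j $ p j)))) (at \<theta>0)"
    unfolding det_def by (intro has_derivative_sum has_derivative_mult_right has_derivative_prod d)
  moreover have "(\<Sum>p\<in>?P. of_int (sign p) * (\<Sum>i\<in>UNIV. T' i (p i) h * (\<Prod>j\<in>UNIV - {i}. T \<theta>0 $ j $ p j)))
     = (\<Sum>i\<in>UNIV. T' i i h)" for h
  proof -
    have zero: "(\<Prod>j\<in>UNIV - {i}. T \<theta>0 $ j $ p j) = 0" if p: "p \<in> ?P" "p \<noteq> id" for p i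
    proof -
      obtain k where k: "p k \<noteq> k" using p(2) by (auto simp: fun_eq_iff)
      have inj: "inj p" using p(1) permutes_inj by blast
      then have k': "p (p k) \<noteq> p k" using k by (simp add: inj_eq)
      \<comment> \<open>Of the two moved points \<open>k\<close> and \<open>p k\<close> one differs
        from \<open>i\<close>; its factor is an off-diagonal entry of the identity matrix.\<close>
      define j where "j = (if i = k then p k else k)"
      have "j \<noteq> i" "p j \<noteq> j" using k k' by (auto simp: j_def)
      then show ?thesis by (intro prod_zero) (auto simp: I mat_def intro!: bexI[of _ j])
    qed
    have "(\<Sum>p\<in>?P. of_int (sign p) * (\<Sum>i\<in>UNIV. T' i (p i) h * (\<Prod>j\<in>UNIV - {i}. T \<theta>0 $ j $ p j)))
      = (\<Sum>p\<in>?P. if p = id then (\<Sum>i\<in>UNIV. T' i i h) else 0)"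
    proof (rule sum.cong[OF refl])
      fix p assume "p \<in> ?P"
      then show "of_int (sign p) * (\<Sum>i\<in>UNIV. T' i (p i) h * (\<Prod>j\<in>UNIV - {i}. T \<theta>0 $ j $ p j))
         = (if p = id then (\<Sum>i\<in>UNIV. T' i i h) else 0)"
        by (cases "p = id") (simp_all add: zero, simp add: I mat_def)
    qed
    also have "\<dots> = (\<Sum>i\<in>UNIV. T' i i h)"
      by (subst sum.delta) (auto simp: finite_permutations permutes_id)
    finally show ?thesis .
  qed
  ultimately show ?thesis by simp
qed

text \<open>The sum is the trace of \<open>matrix_inv A ** A\<close>. Being constant, it has
  derivative zero, which is what the score identity uses.\<close>

lemma sum_inv_entry_mult:
  fixes A :: "real ^ 'r ^ 'r"
  assumes "det A \<noteq> 0"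
  shows "(\<Sum>k\<in>UNIV. \<Sum>l\<in>UNIV. inv_entry A k l * A $ l $ k) = real CARD('r)"
proof -
  have "matrix_inv A ** A = mat 1" using assms by (simp add: matrix_inv_mult invertible_det_nz)
  then have "(matrix_inv A ** A) $ k $ k = 1" for k by (simp add: mat_def)
  then have "(\<Sum>l\<in>UNIV. inv_entry A k l * A $ l $ k) = 1" for k
    by (simp add: matrix_matrix_mult_def matrix_inv_entry[OF assms])
  then show ?thesis by simp
qed

text \<open>Multiplication by the fixed inverse \<open>B\<close> of \<open>A \<theta>0\<close> moves
  the expansion point to the identity matrix, where the derivative of the determinant is the trace;
  the constant factor \<open>det (A \<theta>0)\<close> cancels under the logarithm.\<close>

lemma partial_ln_det:
  fixes A :: "real ^ 'm \<Rightarrow> real ^ 'r ^ 'r"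
  assumes A: "\<And>i j. (\<lambda>\<theta>. A \<theta> $ i $ j) differentiable (at \<theta>0)" and pos: "0 < det (A \<theta>0)"
  shows "partial q (\<lambda>\<theta>. ln (det (A \<theta>))) \<theta>0 =
    (\<Sum>k\<in>UNIV. \<Sum>l\<in>UNIV. inv_entry (A \<theta>0) k l * partial q (\<lambda>\<theta>. A \<theta> $ l $ k) \<theta>0)"
proof -
  define B where "B = matrix_inv (A \<theta>0)"
  have B: "B $ k $ l = inv_entry (A \<theta>0) k l" for k l unfolding B_def using pos by (simp add: matrix_inv_entry)
  have BA: "B ** A \<theta>0 = mat 1" unfolding B_def using pos by (simp add: matrix_inv_mult invertible_det_nz)
  have dB: "det B * det (A \<theta>0) = 1" using BA by (metis det_I det_mul)
  define A' where "A' i j = frechet_derivative (\<lambda>\<theta>. A \<theta> $ i $ j) (at \<theta>0)" for i j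
  have A': "((\<lambda>\<theta>. A \<theta> $ i $ j) has_derivative A' i j) (at \<theta>0)" for i j
    using A by (simp add: A'_def frechet_derivative_works)
  have "((\<lambda>\<theta>. (B ** A \<theta>) $ i $ j) has_derivative (\<lambda>h. \<Sum>l\<in>UNIV. B $ i $ l * A' l j h)) (at \<theta>0)" for i j
    by (simp add: matrix_matrix_mult_def) (intro has_derivative_sum has_derivative_mult_right A')
  from has_derivative_det_at_identity[OF this BA]
  have d: "((\<lambda>\<theta>. det (B ** A \<theta>)) has_derivative (\<lambda>h. \<Sum>k\<in>UNIV. \<Sum>l\<in>UNIV. B $ k $ l * A' l k h)) (at \<theta>0)" .
  have eq: "det (A \<theta>) = det (B ** A \<theta>) * det (A \<theta>0)" for \<theta>
    using dB by (simp add: det_mul mult.assoc mult.commute)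
  have "((\<lambda>\<theta>. det (A \<theta>)) has_derivative (\<lambda>h. (\<Sum>k\<in>UNIV. \<Sum>l\<in>UNIV. B $ k $ l * A' l k h) * det (A \<theta>0))) (at \<theta>0)"
    by (subst eq[abs_def]) (intro has_derivative_mult_left d)
  from has_derivative_compose[OF this DERIV_ln[OF pos, unfolded has_field_derivative_def]]
  have "partial q (\<lambda>\<theta>. ln (det (A \<theta>))) \<theta>0 = (\<Sum>k\<in>UNIV. \<Sum>l\<in>UNIV. B $ k $ l * A' l k (axis q 1))"
    using pos by (subst partial_eq) (auto simp: field_simps)
  then show ?thesis unfolding partial_eq[OF A'] B .
qed

text \<open>Written with the innovation \<open>e\<close> at the true parameter and \<open>u\<close>, the shift of the conditional
  mean, \<open>\<alpha>\<close> is a quadratic form in the vector \<open>(1, e)\<close>; the index \<open>None\<close> stands for the leading 1.\<close>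

definition ext :: "real ^ 'r \<Rightarrow> 'r option \<Rightarrow> real" where
  "ext e a = (case a of None \<Rightarrow> 1 | Some k \<Rightarrow> e $ k)"

definition qcoef :: "real ^ 'r \<Rightarrow> real ^ 'r ^ 'r \<Rightarrow> 'r option \<Rightarrow> 'r option \<Rightarrow> real" where
  "qcoef u A a b = (case a of
     None \<Rightarrow> (case b of
         None \<Rightarrow> ln (det A) + (\<Sum>k\<in>UNIV. u $ k * (\<Sum>l\<in>UNIV. inv_entry A k l * u $ l))
       | Some l \<Rightarrow> - (\<Sum>k\<in>UNIV. u $ k * inv_entry A k l))
   | Some k \<Rightarrow> (case b of
         None \<Rightarrow> - (\<Sum>l\<in>UNIV. inv_entry A k l * u $ l)
       | Some l \<Rightarrow> inv_entry A k l))"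

lemma sum_option: "(\<Sum>a\<in>(UNIV :: 'r::finite option set). f a) = f None + (\<Sum>k\<in>UNIV. f (Some k))"
  by (simp add: UNIV_option_conv sum.reindex)

lemma quadratic_form_ext:
  fixes A :: "real ^ 'r ^ 'r"
  assumes "det A \<noteq> 0"
  shows "ln (det A) + (e - u) \<bullet> (matrix_inv A *v (e - u))
    = (\<Sum>a\<in>UNIV. \<Sum>b\<in>UNIV. qcoef u A a b * (ext e a * ext e b))"
proof -
  let ?s = "inv_entry A"
  have "(e - u) \<bullet> (matrix_inv A *v (e - u)) = (\<Sum>k\<in>UNIV. \<Sum>l\<in>UNIV. (e $ k - u $ k) * (?s k l * (e $ l - u $ l)))"
    by (simp add: inner_vec_def matrix_vector_mult_def matrix_inv_entry[OF assms] sum_distrib_left)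
  also have "\<dots> = (\<Sum>k\<in>UNIV. \<Sum>l\<in>UNIV. u $ k * (?s k l * u $ l)) - (\<Sum>k\<in>UNIV. \<Sum>l\<in>UNIV. u $ k * ?s k l * e $ l)
      - (\<Sum>k\<in>UNIV. \<Sum>l\<in>UNIV. ?s k l * u $ l * e $ k) + (\<Sum>k\<in>UNIV. \<Sum>l\<in>UNIV. ?s k l * (e $ k * e $ l))"
    by (simp add: sum.distrib sum_subtractf algebra_simps)
  also have "(\<Sum>k\<in>UNIV. \<Sum>l\<in>UNIV. u $ k * ?s k l * e $ l) = (\<Sum>l\<in>UNIV. (\<Sum>k\<in>UNIV. u $ k * ?s k l) * e $ l)"
    by (subst sum.swap) (simp add: sum_distrib_right)
  finally have eq: "(e - u) \<bullet> (matrix_inv A *v (e - u)) = (\<Sum>k\<in>UNIV. u $ k * (\<Sum>l\<in>UNIV. ?s k l * u $ l))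
      - (\<Sum>l\<in>UNIV. (\<Sum>k\<in>UNIV. u $ k * ?s k l) * e $ l)
      - (\<Sum>k\<in>UNIV. (\<Sum>l\<in>UNIV. ?s k l * u $ l) * e $ k) + (\<Sum>k\<in>UNIV. \<Sum>l\<in>UNIV. ?s k l * (e $ k * e $ l))"
    by (simp add: sum_distrib_left sum_distrib_right)
  show ?thesis
    unfolding eq by (simp add: sum_option qcoef_def ext_def sum.distrib sum_negf)
qed

lemma D2_on_qcoef:
  fixes A :: "real ^ 'm \<Rightarrow> real ^ 'r ^ 'r" and u :: "real ^ 'm \<Rightarrow> real ^ 'r"
  assumes U: "open U" and A: "\<And>i j. D2_on U (\<lambda>\<theta>. A \<theta> $ i $ j)" and u: "\<And>k. D2_on U (\<lambda>\<theta>. u \<theta> $ k)"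
    and pos: "\<And>\<theta>. \<theta> \<in> U \<Longrightarrow> 0 < det (A \<theta>)"
  shows "D2_on U (\<lambda>\<theta>. qcoef (u \<theta>) (A \<theta>) a b)"
proof -
  have i: "D2_on U (\<lambda>\<theta>. inv_entry (A \<theta>) k l)" for k l
    by (rule D2_on_inv_entry[OF U A]) (use pos in force)
  show ?thesis
    by (cases a; cases b; simp only: qcoef_def option.case)
       (intro D2_on_add D2_on_ln D2_on_det D2_on_uminus D2_on_sum D2_on_mult U A u i pos finite; assumption)+
qed

text \<open>At the true parameter \<open>u\<close> vanishes, and the weights \<open>G\<close> are the conditional second moments of
  \<open>(1, e)\<close>: this is the score identity.\<close>

lemma score_identity:
  fixes A :: "real ^ 'm \<Rightarrow> real ^ 'r ^ 'r" and u :: "real ^ 'm \<Rightarrow> real ^ 'r"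
  assumes U: "open U" "\<theta>0 \<in> U" and A: "\<And>i j. D2_on U (\<lambda>\<theta>. A \<theta> $ i $ j)" and u: "\<And>k. D2_on U (\<lambda>\<theta>. u \<theta> $ k)"
    and pos: "\<And>\<theta>. \<theta> \<in> U \<Longrightarrow> 0 < det (A \<theta>)"
    and u0: "u \<theta>0 = 0" and sym: "\<And>k l. A \<theta>0 $ k $ l = A \<theta>0 $ l $ k"
    and G: "G None None = 1" "\<And>k. G None (Some k) = 0" "\<And>k. G (Some k) None = 0"
      "\<And>k l. G (Some k) (Some l) = A \<theta>0 $ k $ l"
  shows "(\<Sum>a\<in>UNIV. \<Sum>b\<in>UNIV. partial q (\<lambda>\<theta>. qcoef (u \<theta>) (A \<theta>) a b) \<theta>0 * G a b) = 0"
proof -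
  have i: "D2_on U (\<lambda>\<theta>. inv_entry (A \<theta>) k l)" for k l
    by (rule D2_on_inv_entry[OF U(1) A]) (use pos in force)
  note d = D2_onD(1)[OF _ U(2)]
  have iu: "D2_on U (\<lambda>\<theta>. \<Sum>l\<in>UNIV. inv_entry (A \<theta>) k l * u \<theta> $ l)" for k
    by (intro D2_on_sum D2_on_mult U i u finite)
  have NN: "partial q (\<lambda>\<theta>. qcoef (u \<theta>) (A \<theta>) None None) \<theta>0
     = (\<Sum>k\<in>UNIV. \<Sum>l\<in>UNIV. inv_entry (A \<theta>0) k l * partial q (\<lambda>\<theta>. A \<theta> $ l $ k) \<theta>0)"
  proof -
    have "partial q (\<lambda>\<theta>. qcoef (u \<theta>) (A \<theta>) None None) \<theta>0
      = partial q (\<lambda>\<theta>. ln (det (A \<theta>))) \<theta>0 + partial q (\<lambda>\<theta>. \<Sum>k\<in>UNIV. u \<theta> $ k * (\<Sum>l\<in>UNIV. inv_entry (A \<theta>) k l * u \<theta> $ l)) \<theta>0"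
      unfolding qcoef_def option.case
      by (intro partial_add d D2_on_ln D2_on_det D2_on_sum D2_on_mult U A u i iu pos finite)
    \<comment> \<open>In each product both factors vanish at \<open>\<theta>0\<close>, one being an
      entry of \<open>u\<close> and the other linear in \<open>u\<close>, so the first derivative
      vanishes there too.\<close>
    also have "partial q (\<lambda>\<theta>. \<Sum>k\<in>UNIV. u \<theta> $ k * (\<Sum>l\<in>UNIV. inv_entry (A \<theta>) k l * u \<theta> $ l)) \<theta>0 = 0"
      by (subst partial_sum) (auto intro!: d D2_on_mult U u iu simp: partial_mult[OF d[OF u] d[OF iu]] u0)
    also have "partial q (\<lambda>\<theta>. ln (det (A \<theta>))) \<theta>0
      = (\<Sum>k\<in>UNIV. \<Sum>l\<in>UNIV. inv_entry (A \<theta>0) k l * partial q (\<lambda>\<theta>. A \<theta> $ l $ k) \<theta>0)"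
      by (rule partial_ln_det) (use d[OF A] pos[OF U(2)] in auto)
    finally show ?thesis by simp
  qed
  \<comment> \<open>Differentiating the constant trace balances the log-determinant term against the
    derivatives of the inverse weighted by the second moments.\<close>
  have "partial q (\<lambda>\<theta>. \<Sum>k\<in>UNIV. \<Sum>l\<in>UNIV. inv_entry (A \<theta>) k l * A \<theta> $ l $ k) \<theta>0 = partial q (\<lambda>_. real CARD('r)) \<theta>0"
    by (rule partial_cong[OF U]) (use sum_inv_entry_mult pos in force)
  moreover have "partial q (\<lambda>\<theta>. \<Sum>k\<in>UNIV. \<Sum>l\<in>UNIV. inv_entry (A \<theta>) k l * A \<theta> $ l $ k) \<theta>0
     = (\<Sum>k\<in>UNIV. \<Sum>l\<in>UNIV. partial q (\<lambda>\<theta>. inv_entry (A \<theta>) k l * A \<theta> $ l $ k) \<theta>0)"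
    by (subst partial_sum, simp, intro d D2_on_sum D2_on_mult U i A finite)
       (intro sum.cong refl partial_sum d D2_on_mult U i A finite)
  moreover have "partial q (\<lambda>\<theta>. inv_entry (A \<theta>) k l * A \<theta> $ l $ k) \<theta>0
     = inv_entry (A \<theta>0) k l * partial q (\<lambda>\<theta>. A \<theta> $ l $ k) \<theta>0 + partial q (\<lambda>\<theta>. inv_entry (A \<theta>) k l) \<theta>0 * A \<theta>0 $ l $ k" for k l
    by (rule partial_mult[OF d[OF i] d[OF A]])
  ultimately have "(\<Sum>k\<in>UNIV. \<Sum>l\<in>UNIV. inv_entry (A \<theta>0) k l * partial q (\<lambda>\<theta>. A \<theta> $ l $ k) \<theta>0)
     + (\<Sum>k\<in>UNIV. \<Sum>l\<in>UNIV. partial q (\<lambda>\<theta>. inv_entry (A \<theta>) k l) \<theta>0 * A \<theta>0 $ k $ l) = 0"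
    by (simp add: sum.distrib sym)
  then show ?thesis
    using NN by (simp add: sum_option G) (simp add: qcoef_def)
qed

text \<open>The weights \<open>w\<close> do not depend on the parameter: on a fixed path they are
  the products of entries of \<open>(1, e)\<close>, so all derivatives fall on the
  coefficients.\<close>

lemma partial_sum_const:
  assumes U: "open U" "\<theta> \<in> U" and f: "\<And>a b. D2_on U (f a b)"
    and g: "\<And>\<theta>. \<theta> \<in> U \<Longrightarrow> g \<theta> = (\<Sum>a\<in>(UNIV :: 'c::finite set). \<Sum>b\<in>(UNIV :: 'd::finite set). f a b \<theta> * w a b)"
  shows "D2_on U g" "partial i g \<theta> = (\<Sum>a\<in>UNIV. \<Sum>b\<in>UNIV. partial i (f a b) \<theta> * w a b)"
    "partial j (partial i g) \<theta> = (\<Sum>a\<in>UNIV. \<Sum>b\<in>UNIV. partial j (partial i (f a b)) \<theta> * w a b)"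
proof -
  let ?g = "\<lambda>\<theta>. \<Sum>a\<in>(UNIV :: 'c set). \<Sum>b\<in>(UNIV :: 'd set). f a b \<theta> * w a b"
  have "D2_on U ?g" by (intro D2_on_sum D2_on_mult D2_on_const U f finite)
  then show "D2_on U g" using D2_on_cong[OF U(1), of ?g g] g by simp
  have 1: "partial i g \<theta> = (\<Sum>a\<in>UNIV. \<Sum>b\<in>UNIV. partial i (f a b) \<theta> * w a b)" if "\<theta> \<in> U" for \<theta>
  proof -
    have fd: "f a b differentiable (at \<theta>)" for a b using f that by (rule D2_onD)
    have "partial i g \<theta> = partial i ?g \<theta>" by (rule partial_cong[OF U(1) that g])
    also have "\<dots> = (\<Sum>a\<in>UNIV. \<Sum>b\<in>UNIV. partial i (\<lambda>\<theta>. f a b \<theta> * w a b) \<theta>)"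
      by (subst partial_sum, simp, intro differentiable_sum ballI differentiable_mult differentiable_const fd finite)
         (intro sum.cong refl partial_sum differentiable_mult differentiable_const fd finite)
    finally show ?thesis by (simp add: partial_mult_const[OF fd])
  qed
  show "partial i g \<theta> = (\<Sum>a\<in>UNIV. \<Sum>b\<in>UNIV. partial i (f a b) \<theta> * w a b)" by (rule 1[OF U(2)])
  have fd: "partial i (f a b) differentiable (at \<theta>)" for a b using f U(2) by (rule D2_onD)
  have "partial j (partial i g) \<theta> = partial j (\<lambda>\<theta>. \<Sum>a\<in>UNIV. \<Sum>b\<in>UNIV. partial i (f a b) \<theta> * w a b) \<theta>"
    by (rule partial_cong[OF U 1])
  also have "\<dots> = (\<Sum>a\<in>UNIV. \<Sum>b\<in>UNIV. partial j (\<lambda>\<theta>. partial i (f a b) \<theta> * w a b) \<theta>)"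
    by (subst partial_sum, simp, intro differentiable_sum ballI differentiable_mult differentiable_const fd finite)
       (intro sum.cong refl partial_sum differentiable_mult differentiable_const fd finite)
  finally show "partial j (partial i g) \<theta> = (\<Sum>a\<in>UNIV. \<Sum>b\<in>UNIV. partial j (partial i (f a b)) \<theta> * w a b)"
    by (simp add: partial_mult_const[OF fd])
qed

text \<open>Limits of difference quotients along a fixed null sequence of steps: a measurable version of
  the partial derivative. The scale \<open>r\<close> keeps two successive steps inside a ball of radius \<open>r\<close>.\<close>

definition step :: "real \<Rightarrow> nat \<Rightarrow> real" where
  "step r k = r / (2 * real (k + 2))"

definition seq_partial :: "real \<Rightarrow> 'm::finite \<Rightarrow> (real ^ 'm \<Rightarrow> real) \<Rightarrow> real ^ 'm \<Rightarrow> real" where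
  "seq_partial r i f \<theta> = lim (\<lambda>k. (f (\<theta> + step r k *\<^sub>R axis i 1) - f \<theta>) / step r k)"

lemma step_pos: "0 < r \<Longrightarrow> 0 < step r k" and step_less: "0 < r \<Longrightarrow> step r k < r / 2"
  by (auto simp: step_def field_simps intro: add_pos_nonneg)

lemma step_tendsto: "step r \<longlonglongrightarrow> 0"
proof -
  have "(\<lambda>k. r / 2 * inverse (real (Suc (Suc k)))) \<longlonglongrightarrow> r / 2 * 0"
    by (intro tendsto_mult tendsto_const LIMSEQ_Suc[OF LIMSEQ_inverse_real_of_nat])
  then show ?thesis by (simp add: step_def[abs_def] field_simps)
qed

lemma seq_partial_eq:
  assumes "f differentiable (at \<theta>)" "0 < r"
  shows "seq_partial r i f \<theta> = partial i f \<theta>"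
proof -
  have "((\<lambda>h. f (\<theta> + h *\<^sub>R axis i 1)) has_real_derivative partial i f \<theta>) (at 0)"
    using has_derivative_along_axis[of f "frechet_derivative f (at \<theta>)" \<theta> i] assms(1)
    by (simp add: partial_eq_frechet frechet_derivative_works)
  then have "((\<lambda>h. (f (\<theta> + h *\<^sub>R axis i 1) - f \<theta>) / h) \<longlongrightarrow> partial i f \<theta>) (at 0)"
    by (simp add: DERIV_def)
  moreover have "filterlim (step r) (at 0) sequentially"
    using step_tendsto step_pos[OF assms(2)] by (auto simp: filterlim_at less_imp_neq[symmetric])
  ultimately have "(\<lambda>k. (f (\<theta> + step r k *\<^sub>R axis i 1) - f \<theta>) / step r k) \<longlonglongrightarrow> partial i f \<theta>"
    by (rule filterlim_compose)
  then show ?thesis unfolding seq_partial_def by (rule limI)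
qed

text \<open>The inner limit is needed at the shifted points as well; steps below
  \<open>r / 2\<close> keep them in the ball, where it equals the partial derivative.\<close>

lemma seq_partial_seq_partial_eq:
  assumes f: "D2_on (ball \<theta> r) f" and r: "0 < r"
  shows "seq_partial r i (seq_partial r j f) \<theta> = partial i (partial j f) \<theta>"
proof -
  have eq: "seq_partial r j f \<eta> = partial j f \<eta>" if "\<eta> \<in> ball \<theta> r" for \<eta>
    by (rule seq_partial_eq[OF D2_onD(1)[OF f that] r])
  have "\<theta> + step r k *\<^sub>R axis i 1 \<in> ball \<theta> r" for k
    using step_pos[OF r, of k] step_less[OF r, of k] r by (simp add: dist_norm)
  then have "seq_partial r i (seq_partial r j f) \<theta> = seq_partial r i (partial j f) \<theta>"
    unfolding seq_partial_def[of r i] using eq r by simp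
  also have "\<dots> = partial i (partial j f) \<theta>"
    using f r by (intro seq_partial_eq D2_onD(2)) auto
  finally show ?thesis .
qed

text \<open>\<open>lim\<close> of a sequence of measurable functions is measurable regardless of
  convergence, so the exceptional paths need not be removed.\<close>

lemma borel_measurable_seq_partial:
  assumes "f \<theta> \<in> borel_measurable G" "\<And>k. f (\<theta> + step r k *\<^sub>R axis i 1) \<in> borel_measurable G"
  shows "(\<lambda>\<omega>. seq_partial r i (\<lambda>\<theta>. f \<theta> \<omega>) \<theta>) \<in> borel_measurable G"
  unfolding seq_partial_def
proof (rule borel_measurable_lim_metric)
  fix k
  show "(\<lambda>\<omega>. (f (\<theta> + step r k *\<^sub>R axis i 1) \<omega> - f \<theta> \<omega>) / step r k) \<in> borel_measurable G"
    using assms by measurable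
qed

text \<open>Measurability is available separately for each parameter in the ball. Only countably
  many parameters occur here, and two successive steps, each below \<open>r / 2\<close>, remain
  inside the ball.\<close>

lemma borel_measurable_seq_partial2:
  fixes \<theta>0 :: "real ^ 'm"
  assumes r: "0 < r" and f: "\<And>\<theta>. \<theta> \<in> ball \<theta>0 r \<Longrightarrow> f \<theta> \<in> borel_measurable G"
  shows "(\<lambda>\<omega>. seq_partial r i (\<lambda>\<theta>. f \<theta> \<omega>) \<theta>0) \<in> borel_measurable G" (is ?A)
    and "(\<lambda>\<omega>. seq_partial r i (seq_partial r j (\<lambda>\<theta>. f \<theta> \<omega>)) \<theta>0) \<in> borel_measurable G" (is ?B)
proof -
  have in1: "\<theta>0 + step r k *\<^sub>R axis i 1 \<in> ball \<theta>0 r" for k i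
    using step_pos[OF r, of k] step_less[OF r, of k] r by (simp add: dist_norm)
  have in2: "\<theta>0 + step r k *\<^sub>R axis i 1 + step r l *\<^sub>R axis j 1 \<in> ball \<theta>0 r" for k l i j
  proof -
    have "norm (step r k *\<^sub>R axis i 1 + step r l *\<^sub>R axis j (1::real) :: real ^ 'm) \<le> step r k + step r l"
      using step_pos[OF r] by (intro norm_triangle_le) (simp add: less_imp_le)
    also have "\<dots> < r" using step_less[OF r, of k] step_less[OF r, of l] by linarith
    finally show ?thesis unfolding mem_ball by (metis add.assoc add.right_neutral dist_add_cancel dist_0_norm)
  qed
  show ?A using r by (intro borel_measurable_seq_partial f in1) simp
  have "(\<lambda>\<omega>. seq_partial r j (\<lambda>\<theta>. f \<theta> \<omega>) \<theta>) \<in> borel_measurable G"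
    if "\<theta> = \<theta>0 \<or> (\<exists>k. \<theta> = \<theta>0 + step r k *\<^sub>R axis i 1)" for \<theta>
  proof (rule borel_measurable_seq_partial)
    show "f \<theta> \<in> borel_measurable G" using that r in1 by (intro f) auto
    show "f (\<theta> + step r k *\<^sub>R axis j 1) \<in> borel_measurable G" for k using that in1 in2 by (intro f) auto
  qed
  note m = this
  show ?B
  proof (rule borel_measurable_seq_partial)
    show "(\<lambda>\<omega>. seq_partial r j (\<lambda>\<theta>. f \<theta> \<omega>) \<theta>0) \<in> borel_measurable G" by (rule m) simp
    show "(\<lambda>\<omega>. seq_partial r j (\<lambda>\<theta>. f \<theta> \<omega>) (\<theta>0 + step r k *\<^sub>R axis i 1)) \<in> borel_measurable G" for k
      by (rule m) blast
  qed
qed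

lemma vec_eq_sum_axis: "v = (\<Sum>j\<in>UNIV. (v $ j) *\<^sub>R axis j (1::real))"
  by (simp add: vec_eq_iff axis_def if_distrib cong: if_cong)

text \<open>The scalar mean value theorem along the segment, written in coordinates. Each component
  of the score will receive its own intermediate point.\<close>

lemma mvt_partial:
  fixes g :: "real ^ 'm \<Rightarrow> real"
  assumes "\<And>\<xi>. \<xi> \<in> closed_segment x y \<Longrightarrow> g differentiable (at \<xi>)"
  obtains \<xi> where "\<xi> \<in> closed_segment x y" "g y - g x = (\<Sum>j\<in>UNIV. (y - x) $ j * partial j g \<xi>)"
proof -
  let ?p = "\<lambda>s. x + s *\<^sub>R (y - x)"
  have seg: "?p s \<in> closed_segment x y" if "s \<in> {0..1}" for s
    using that by (auto simp: in_segment algebra_simps intro!: exI[of _ s])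
  have "\<exists>s\<in>{0<..<1}. (g \<circ> ?p) 1 - (g \<circ> ?p) 0 = frechet_derivative g (at (?p s)) ((1 - 0) *\<^sub>R (y - x))"
  proof (rule mvt_simple[where f' = "\<lambda>s h. frechet_derivative g (at (?p s)) (h *\<^sub>R (y - x))"])
    fix s :: real assume "0 \<le> s" "s \<le> 1"
    then have "g differentiable (at (?p s))" using assms seg by simp
    then have "(g has_derivative frechet_derivative g (at (?p s))) (at (?p s))" by (simp add: frechet_derivative_works)
    then have "((\<lambda>s. g (?p s)) has_derivative (\<lambda>h. frechet_derivative g (at (?p s)) (h *\<^sub>R (y - x)))) (at s within {0..1})"
      by (rule has_derivative_compose[rotated]) (auto intro!: derivative_eq_intros)
    then show "((g \<circ> ?p) has_derivative (\<lambda>h. frechet_derivative g (at (?p s)) (h *\<^sub>R (y - x)))) (at s within {0..1})"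
      by (simp add: o_def)
  qed simp
  then obtain s where s: "s \<in> {0<..<1}" "g y - g x = frechet_derivative g (at (?p s)) (y - x)" by auto
  have gd: "g differentiable (at (?p s))" using assms seg s(1) by simp
  have lin: "linear (frechet_derivative g (at (?p s)))" by (rule linear_frechet_derivative[OF gd])
  have "frechet_derivative g (at (?p s)) (y - x) = frechet_derivative g (at (?p s)) (\<Sum>j\<in>UNIV. ((y - x) $ j) *\<^sub>R axis j 1)"
    by (subst vec_eq_sum_axis[of "y - x"]) simp
  also have "\<dots> = (\<Sum>j\<in>UNIV. (y - x) $ j * partial j g (?p s))"
    by (simp only: linear_sum[OF lin] linear_scale[OF lin] partial_eq_frechet[OF gd] real_scaleR_def)
  finally show ?thesis using that[of "?p s"] seg s by simp
qed

section \<open>Conditional expectations with localized coefficients\<close>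

text \<open>Since \<open>f\<close> may fail to be integrable, the indicator is pulled out of the
  nonnegative conditional expectations of the positive and the negative part, where infinite values
  do no harm.\<close>

lemma (in sigma_finite_subalgebra) real_cond_exp_indicator:
  assumes B[measurable]: "B \<in> sets F" and f[measurable]: "f \<in> borel_measurable M"
  shows "AE \<omega> in M. real_cond_exp M F (\<lambda>\<omega>. indicator B \<omega> * f \<omega>) \<omega> = indicator B \<omega> * real_cond_exp M F f \<omega>"
proof -
  have e: "ennreal (indicator B \<omega> * g \<omega>) = indicator B \<omega> * ennreal (g \<omega>)" for g \<omega>
    by (simp add: indicator_def)
  have "AE \<omega> in M. indicator B \<omega> * nn_cond_exp M F (\<lambda>\<omega>. ennreal (f \<omega>)) \<omega>
      = nn_cond_exp M F (\<lambda>\<omega>. indicator B \<omega> * ennreal (f \<omega>)) \<omega>"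
    by (rule nn_cond_exp_prod) auto
  moreover have "AE \<omega> in M. indicator B \<omega> * nn_cond_exp M F (\<lambda>\<omega>. ennreal (- f \<omega>)) \<omega>
      = nn_cond_exp M F (\<lambda>\<omega>. indicator B \<omega> * ennreal (- f \<omega>)) \<omega>"
    by (rule nn_cond_exp_prod) auto
  ultimately show ?thesis
  proof eventually_elim
    case (elim \<omega>)
    have m: "(\<lambda>\<omega>. ennreal (- (indicator B \<omega> * f \<omega>))) = (\<lambda>\<omega>. indicator B \<omega> * ennreal (- f \<omega>))"
      using e[of _ "\<lambda>\<omega>. - f \<omega>"] by simp
    show ?case
      unfolding real_cond_exp_def m e elim[symmetric] by (simp add: indicator_def)
  qed
qed

text \<open>Conditional expectations of linear combinations whose coefficients are measurable with respect
  to the conditioning \<open>\<sigma>\<close>-algebra. The combination itself need not be integrable: everything is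
  localized to the events where the coefficients are bounded.\<close>

lemma (in sigma_finite_subalgebra)
  fixes d y :: "'j::finite \<Rightarrow> 'a \<Rightarrow> real"
  assumes d: "\<And>j. d j \<in> borel_measurable F" and y: "\<And>j. integrable M (y j)"
    and f[measurable]: "f \<in> borel_measurable M" and eq: "AE \<omega> in M. f \<omega> = (\<Sum>j\<in>UNIV. d j \<omega> * y j \<omega>)"
  shows real_cond_exp_linear_comb:
      "AE \<omega> in M. real_cond_exp M F f \<omega> = (\<Sum>j\<in>UNIV. d j \<omega> * real_cond_exp M F (y j) \<omega>)" (is ?A)
    and real_cond_exp_centered:
      "integrable M (\<lambda>\<omega>. f \<omega> - real_cond_exp M F f \<omega>) \<Longrightarrow>
         AE \<omega> in M. real_cond_exp M F (\<lambda>\<omega>. f \<omega> - real_cond_exp M F f \<omega>) \<omega> = 0" (is "?i \<Longrightarrow> ?B")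
proof -
  \<comment> \<open>Events of the conditioning algebra on which all coefficients are bounded by
    \<open>K\<close>; there are finitely many coefficients, so these events exhaust the
    space.\<close>
  define B where "B K = {\<omega> \<in> space F. \<forall>j. \<bar>d j \<omega>\<bar> \<le> real K}" for K
  have sp: "space F = space M" using subalg by (simp add: subalgebra_def)
  have BF: "B K \<in> sets F" for K
  proof -
    have "B K = (\<Inter>j\<in>UNIV. {\<omega> \<in> space F. \<bar>d j \<omega>\<bar> \<le> real K})" by (auto simp: B_def)
    also have "\<dots> \<in> sets F" using d by (intro sets.finite_INT) auto
    finally show ?thesis .
  qed
  have [measurable]: "B K \<in> sets M" for K using BF subalg by (auto simp: subalgebra_def)
  have [measurable]: "y j \<in> borel_measurable M" "d j \<in> borel_measurable M" for j
    using y d measurable_from_subalg[OF subalg] by auto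
  have ex: "\<exists>K. \<omega> \<in> B K" if "\<omega> \<in> space M" for \<omega>
  proof -
    obtain K :: nat where "(\<Sum>j\<in>UNIV. \<bar>d j \<omega>\<bar>) \<le> real K" using real_arch_simple by blast
    moreover have "\<bar>d j \<omega>\<bar> \<le> (\<Sum>j\<in>UNIV. \<bar>d j \<omega>\<bar>)" for j by (rule member_le_sum) auto
    ultimately show ?thesis using that by (auto simp: B_def sp intro: order_trans)
  qed
  have int: "integrable M (\<lambda>\<omega>. (indicator (B K) \<omega> * d j \<omega>) * y j \<omega>)" for K j
  proof (rule Bochner_Integration.integrable_bound[where f = "\<lambda>\<omega>. real K * \<bar>y j \<omega>\<bar>"])
    show "integrable M (\<lambda>\<omega>. real K * \<bar>y j \<omega>\<bar>)" using y by auto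
    show "AE \<omega> in M. norm (indicator (B K) \<omega> * d j \<omega> * y j \<omega>) \<le> norm (real K * \<bar>y j \<omega>\<bar>)"
      by (intro AE_I2) (auto simp: B_def indicator_def abs_mult intro!: mult_right_mono)
  qed measurable
  have intf: "integrable M (\<lambda>\<omega>. indicator (B K) \<omega> * f \<omega>)" for K
  proof -
    have "integrable M (\<lambda>\<omega>. \<Sum>j\<in>UNIV. (indicator (B K) \<omega> * d j \<omega>) * y j \<omega>)" by (intro Bochner_Integration.integrable_sum int)
    moreover have "AE \<omega> in M. (\<Sum>j\<in>UNIV. (indicator (B K) \<omega> * d j \<omega>) * y j \<omega>) = indicator (B K) \<omega> * f \<omega>"
      using eq by eventually_elim (simp add: sum_distrib_left mult.assoc)
    ultimately show ?thesis by (subst integrable_cong_AE[symmetric]) auto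
  qed
  have loc: "AE \<omega> in M. indicator (B K) \<omega> * real_cond_exp M F f \<omega>
       = indicator (B K) \<omega> * (\<Sum>j\<in>UNIV. d j \<omega> * real_cond_exp M F (y j) \<omega>)" for K
  proof -
    have 1: "AE \<omega> in M. real_cond_exp M F (\<lambda>\<omega>. indicator (B K) \<omega> * f \<omega>) \<omega>
       = real_cond_exp M F (\<lambda>\<omega>. \<Sum>j\<in>UNIV. (indicator (B K) \<omega> * d j \<omega>) * y j \<omega>) \<omega>"
    proof (rule real_cond_exp_cong)
      show "AE \<omega> in M. indicator (B K) \<omega> * f \<omega> = (\<Sum>j\<in>UNIV. (indicator (B K) \<omega> * d j \<omega>) * y j \<omega>)"
        using eq by eventually_elim (simp add: sum_distrib_left mult.assoc)
    qed measurable
    have 2: "AE \<omega> in M. real_cond_exp M F (\<lambda>\<omega>. \<Sum>j\<in>UNIV. (indicator (B K) \<omega> * d j \<omega>) * y j \<omega>) \<omega>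
       = (\<Sum>j\<in>UNIV. real_cond_exp M F (\<lambda>\<omega>. (indicator (B K) \<omega> * d j \<omega>) * y j \<omega>) \<omega>)"
      by (rule real_cond_exp_sum[OF int])
    have 3: "AE \<omega> in M. \<forall>j. real_cond_exp M F (\<lambda>\<omega>. (indicator (B K) \<omega> * d j \<omega>) * y j \<omega>) \<omega>
       = (indicator (B K) \<omega> * d j \<omega>) * real_cond_exp M F (y j) \<omega>"
      unfolding AE_all_countable
    proof
      fix j
      have [measurable]: "d j \<in> borel_measurable F" "B K \<in> sets F" using d BF by auto
      show "AE \<omega> in M. real_cond_exp M F (\<lambda>\<omega>. (indicator (B K) \<omega> * d j \<omega>) * y j \<omega>) \<omega>
       = (indicator (B K) \<omega> * d j \<omega>) * real_cond_exp M F (y j) \<omega>"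
        by (rule real_cond_exp_mult[OF _ _ int]) measurable
    qed
    from real_cond_exp_indicator[OF BF f, of K] 1 2 3 show ?thesis
      by eventually_elim (simp add: sum_distrib_left mult.assoc)
  qed
  have all: "AE \<omega> in M. g \<omega> = g' \<omega>"
    if "\<And>K. AE \<omega> in M. indicator (B K) \<omega> * g \<omega> = (indicator (B K) \<omega> :: real) * g' \<omega>" for g g' :: "'a \<Rightarrow> real"
  proof -
    have "AE \<omega> in M. \<forall>K. indicator (B K) \<omega> * g \<omega> = (indicator (B K) \<omega> :: real) * g' \<omega>"
      unfolding AE_all_countable using that by blast
    with AE_space show ?thesis
    proof eventually_elim
      case (elim \<omega>)
      obtain K where "\<omega> \<in> B K" using ex[OF elim(1)] by auto
      then show ?case using elim(2)[rule_format, of K] by simp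
    qed
  qed
  show ?A by (rule all[OF loc])
  assume i: ?i
  have [measurable]: "real_cond_exp M F f \<in> borel_measurable M" by measurable
  \<comment> \<open>On \<open>B K\<close> both \<open>f\<close> and its conditional expectation are
    integrable, so the difference can be split there; globally only the difference is assumed
    integrable.\<close>
  have "AE \<omega> in M. indicator (B K) \<omega> * real_cond_exp M F (\<lambda>\<omega>. f \<omega> - real_cond_exp M F f \<omega>) \<omega> = indicator (B K) \<omega> * (0::real)" for K
  proof -
    have indr: "AE \<omega> in M. real_cond_exp M F (\<lambda>\<omega>. indicator (B K) \<omega> * f \<omega>) \<omega> = indicator (B K) \<omega> * real_cond_exp M F f \<omega>"
      by (rule real_cond_exp_indicator[OF BF f])
    have ir: "integrable M (\<lambda>\<omega>. indicator (B K) \<omega> * real_cond_exp M F f \<omega>)"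
      using real_cond_exp_int(1)[OF intf[of K]] indr by (subst integrable_cong_AE[symmetric]) auto
    have [measurable]: "B K \<in> sets F" by (rule BF)
    have "AE \<omega> in M. real_cond_exp M F (\<lambda>\<omega>. indicator (B K) \<omega> * real_cond_exp M F f \<omega>) \<omega> = indicator (B K) \<omega> * real_cond_exp M F f \<omega>"
      by (rule real_cond_exp_F_meas[OF ir]) measurable
    moreover have "AE \<omega> in M. real_cond_exp M F (\<lambda>\<omega>. indicator (B K) \<omega> * f \<omega> - indicator (B K) \<omega> * real_cond_exp M F f \<omega>) \<omega>
      = real_cond_exp M F (\<lambda>\<omega>. indicator (B K) \<omega> * f \<omega>) \<omega> - real_cond_exp M F (\<lambda>\<omega>. indicator (B K) \<omega> * real_cond_exp M F f \<omega>) \<omega>"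
      by (rule real_cond_exp_diff[OF intf ir])
    moreover have "AE \<omega> in M. real_cond_exp M F (\<lambda>\<omega>. indicator (B K) \<omega> * (f \<omega> - real_cond_exp M F f \<omega>)) \<omega>
      = indicator (B K) \<omega> * real_cond_exp M F (\<lambda>\<omega>. f \<omega> - real_cond_exp M F f \<omega>) \<omega>"
      by (rule real_cond_exp_indicator[OF BF]) measurable
    ultimately show ?thesis using indr by eventually_elim (simp add: right_diff_distrib)
  qed
  from all[OF this] show ?B .
qed

lemma integrable_mult_of_squares:
  fixes f g :: "'a \<Rightarrow> real"
  assumes "f \<in> borel_measurable M" "g \<in> borel_measurable M"
    "integrable M (\<lambda>\<omega>. (f \<omega>)\<^sup>2)" "integrable M (\<lambda>\<omega>. (g \<omega>)\<^sup>2)"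
  shows "integrable M (\<lambda>\<omega>. f \<omega> * g \<omega>)"
proof (rule Bochner_Integration.integrable_bound[where f = "\<lambda>\<omega>. (f \<omega>)\<^sup>2 + (g \<omega>)\<^sup>2"])
  have "\<bar>a * b\<bar> \<le> a\<^sup>2 + b\<^sup>2" for a b :: real
  proof -
    have "2 * \<bar>a\<bar> * \<bar>b\<bar> \<le> a\<^sup>2 + b\<^sup>2" using sum_squares_bound[of "\<bar>a\<bar>" "\<bar>b\<bar>"] by simp
    moreover have "0 \<le> \<bar>a\<bar> * \<bar>b\<bar>" by simp
    ultimately show ?thesis unfolding abs_mult by linarith
  qed
  then show "AE \<omega> in M. norm (f \<omega> * g \<omega>) \<le> norm ((f \<omega>)\<^sup>2 + (g \<omega>)\<^sup>2)" by (intro AE_I2) simp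
qed (use assms in auto)

section \<open>Second moments of martingale sums\<close>

context filtered_prob_space begin

text \<open>The partial sum up to \<open>n\<close> is \<open>F n\<close>-measurable, so its product
  with the next difference integrates to zero; that product is integrable because both factors are
  square integrable.\<close>

lemma mds_second_moment:
  fixes X :: "nat \<Rightarrow> 'a \<Rightarrow> real"
  assumes X: "\<And>t. 1 \<le> t \<Longrightarrow> X t \<in> borel_measurable (F t)"
    and X2: "\<And>t. 1 \<le> t \<Longrightarrow> integrable M (\<lambda>\<omega>. (X t \<omega>)\<^sup>2)" "\<And>t. 1 \<le> t \<Longrightarrow> (\<integral>\<omega>. (X t \<omega>)\<^sup>2 \<partial>M) \<le> C"
    and cond0: "\<And>t. 1 \<le> t \<Longrightarrow> AE \<omega> in M. real_cond_exp M (F (t - 1)) (X t) \<omega> = 0"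
  shows "integrable M (\<lambda>\<omega>. (\<Sum>t=1..n. X t \<omega>)\<^sup>2) \<and> (\<integral>\<omega>. (\<Sum>t=1..n. X t \<omega>)\<^sup>2 \<partial>M) \<le> real n * C"
proof (induction n)
  case (Suc n)
  interpret S: sigma_finite_subalgebra M "F n" by (rule sigma_finite_sub)
  let ?S = "\<lambda>\<omega>. \<Sum>t=1..n. X t \<omega>"
  have SF[measurable]: "?S \<in> borel_measurable (F n)"
    by (intro borel_measurable_sum measurable_F_mono[OF _ X]) auto
  have SM[measurable]: "?S \<in> borel_measurable M" by (rule measurable_F[OF SF])
  have XM[measurable]: "X (Suc n) \<in> borel_measurable M" by (rule measurable_F[OF X]) simp
  have i: "integrable M (\<lambda>\<omega>. ?S \<omega> * X (Suc n) \<omega>)"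
    using Suc X2(1)[of "Suc n"] by (intro integrable_mult_of_squares SM XM) auto
  have "(\<integral>\<omega>. ?S \<omega> * X (Suc n) \<omega> \<partial>M) = (\<integral>\<omega>. ?S \<omega> * real_cond_exp M (F n) (X (Suc n)) \<omega> \<partial>M)"
    by (rule S.real_cond_exp_intg(2)[symmetric, OF i]) measurable
  also have "\<dots> = 0" using cond0[of "Suc n"] by (intro integral_eq_zero_AE) auto
  finally have z: "(\<integral>\<omega>. ?S \<omega> * X (Suc n) \<omega> \<partial>M) = 0" .
  have eq: "(\<Sum>t=1..Suc n. X t \<omega>)\<^sup>2 = (?S \<omega>)\<^sup>2 + 2 * (?S \<omega> * X (Suc n) \<omega>) + (X (Suc n) \<omega>)\<^sup>2" for \<omega>
    by (simp add: power2_eq_square algebra_simps)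
  have "(\<integral>\<omega>. (\<Sum>t=1..Suc n. X t \<omega>)\<^sup>2 \<partial>M) = (\<integral>\<omega>. (?S \<omega>)\<^sup>2 \<partial>M) + (\<integral>\<omega>. (X (Suc n) \<omega>)\<^sup>2 \<partial>M)"
    unfolding eq using Suc i X2(1)[of "Suc n"] z by simp
  moreover have "integrable M (\<lambda>\<omega>. (\<Sum>t=1..Suc n. X t \<omega>)\<^sup>2)"
    unfolding eq using Suc i X2(1)[of "Suc n"] by auto
  ultimately show ?case using Suc X2(2)[of "Suc n"] by (simp add: algebra_simps)
qed simp

text \<open>The inequality \<open>\<bar>z\<bar> \<le> 1 + z\<^sup>2\<close> at
  \<open>z = S / sqrt n\<close>, with \<open>S\<close> the sum, turns the second moment bound into
  an \<open>L1\<close> rate; this is the origin of the constant \<open>1 + C\<close>.\<close>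

lemma expectation_abs_mean_le:
  fixes X :: "nat \<Rightarrow> 'a \<Rightarrow> real"
  assumes X: "\<And>t. 1 \<le> t \<Longrightarrow> X t \<in> borel_measurable (F t)"
    and X2: "\<And>t. 1 \<le> t \<Longrightarrow> integrable M (\<lambda>\<omega>. (X t \<omega>)\<^sup>2)" "\<And>t. 1 \<le> t \<Longrightarrow> (\<integral>\<omega>. (X t \<omega>)\<^sup>2 \<partial>M) \<le> C"
    and cond0: "\<And>t. 1 \<le> t \<Longrightarrow> AE \<omega> in M. real_cond_exp M (F (t - 1)) (X t) \<omega> = 0"
    and n: "1 \<le> n"
  shows "integrable M (\<lambda>\<omega>. \<bar>\<Sum>t=1..n. X t \<omega>\<bar> / real n)"
    "(\<integral>\<omega>. \<bar>\<Sum>t=1..n. X t \<omega>\<bar> / real n \<partial>M) \<le> (1 + C) / sqrt (real n)"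
proof -
  let ?S = "\<lambda>\<omega>. \<Sum>t=1..n. X t \<omega>"
  have SM[measurable]: "?S \<in> borel_measurable M"
    by (intro borel_measurable_sum measurable_F[OF X]) auto
  note S2 = mds_second_moment[of X C n, OF X X2 cond0]
  have sn: "sqrt (real n) > 0" using n by simp
  have bd: "\<bar>?S \<omega>\<bar> / real n \<le> (1 + (?S \<omega>)\<^sup>2 / real n) / sqrt (real n)" for \<omega>
  proof -
    have "\<bar>?S \<omega> / sqrt (real n)\<bar> \<le> 1 + (?S \<omega> / sqrt (real n))\<^sup>2" by (rule abs_le_one_plus_square)
    then have "\<bar>?S \<omega>\<bar> / sqrt (real n) / sqrt (real n) \<le> (1 + (?S \<omega>)\<^sup>2 / real n) / sqrt (real n)"
      using sn by (intro divide_right_mono) (auto simp: power_divide)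
    then show ?thesis by simp
  qed
  have i: "integrable M (\<lambda>\<omega>. (1 + (?S \<omega>)\<^sup>2 / real n) / sqrt (real n))" using S2 by auto
  show i2: "integrable M (\<lambda>\<omega>. \<bar>?S \<omega>\<bar> / real n)"
  proof (rule Bochner_Integration.integrable_bound[OF i])
    show "(\<lambda>\<omega>. \<bar>?S \<omega>\<bar> / real n) \<in> borel_measurable M" using SM by measurable
    show "AE \<omega> in M. norm (\<bar>?S \<omega>\<bar> / real n) \<le> norm ((1 + (?S \<omega>)\<^sup>2 / real n) / sqrt (real n))"
      using order_trans[OF bd abs_ge_self] by (intro AE_I2) simp
  qed
  have "(\<integral>\<omega>. \<bar>?S \<omega>\<bar> / real n \<partial>M) \<le> (\<integral>\<omega>. (1 + (?S \<omega>)\<^sup>2 / real n) / sqrt (real n) \<partial>M)"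
    by (rule integral_mono[OF i2 i bd])
  also have "\<dots> = (1 + (\<integral>\<omega>. (?S \<omega>)\<^sup>2 \<partial>M) / real n) / sqrt (real n)"
    using S2 by (simp add: prob_space)
  also have "\<dots> \<le> (1 + C) / sqrt (real n)"
    using S2 n by (intro divide_right_mono add_left_mono) (auto simp: divide_le_eq mult.commute)
  finally show "(\<integral>\<omega>. \<bar>?S \<omega>\<bar> / real n \<partial>M) \<le> (1 + C) / sqrt (real n)" .
qed

end

section \<open>Asymptotic normality from an expansion of the score\<close>

text \<open>\<open>matrix_inv V\<close> is symmetric and injective, so the sandwich is a congruence
  of \<open>W\<close> and stays definite.\<close>

lemma pos_def_sandwich:
  fixes V W :: "real ^ 'm ^ 'm"
  assumes V: "pos_def V" and W: "pos_def W"
  shows "invertible V" "transpose (matrix_inv V) = matrix_inv V" "pos_def (matrix_inv V ** W ** matrix_inv V)"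
proof -
  let ?B = "matrix_inv V"
  have sV: "transpose V = V" and pV: "\<And>v. v \<noteq> 0 \<Longrightarrow> v \<bullet> (V *v v) > 0"
    and sW: "transpose W = W" and pW: "\<And>v. v \<noteq> 0 \<Longrightarrow> v \<bullet> (W *v v) > 0"
    using V W by (auto simp: pos_def_def)
  have "V *v v = 0 \<Longrightarrow> v = 0" for v using pV[of v] by (metis inner_zero_right less_irrefl)
  then show inv: "invertible V"
    using matrix_left_invertible_ker invertible_left_inverse by blast
  note B = matrix_inv_mult[OF inv]
  have "transpose ?B ** V = mat 1" by (metis B(1) matrix_transpose_mul sV transpose_mat)
  then have "transpose ?B ** (V ** ?B) = ?B" by (simp add: matrix_mul_assoc)
  then show tB: "transpose ?B = ?B" by (simp add: B)
  show "pos_def (?B ** W ** ?B)"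
    unfolding pos_def_def
  proof (intro conjI allI impI)
    show "transpose (?B ** W ** ?B) = ?B ** W ** ?B"
      by (simp add: matrix_transpose_mul tB sW matrix_mul_assoc)
    fix v :: "real ^ 'm" assume "v \<noteq> 0"
    have "V *v (?B *v v) = v" by (simp add: matrix_vector_mul_assoc B)
    then have "?B *v v \<noteq> 0" using \<open>v \<noteq> 0\<close> by auto
    then have "0 < (?B *v v) \<bullet> (W *v (?B *v v))" by (rule pW)
    also have "\<dots> = v \<bullet> (?B *v (W *v (?B *v v)))"
      by (metis dot_lmul_matrix tB transpose_matrix_vector)
    finally show "0 < v \<bullet> ((?B ** W ** ?B) *v v)" by (simp add: matrix_vector_mul_assoc matrix_mul_assoc)
  qed
qed

text \<open>The inner product is at most the sum of the \<open>\<bar>a $ i\<bar>\<close> times the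
  largest \<open>\<bar>d $ k\<bar>\<close>, whose fourth power is one of the summands on the right.
  Coordinatewise fourth moments thus bound those of every linear combination.\<close>

lemma inner_power4_le:
  fixes a d :: "real ^ 'm"
  shows "(a \<bullet> d) ^ 4 \<le> (\<Sum>i\<in>UNIV. \<bar>a $ i\<bar>) ^ 4 * (\<Sum>i\<in>UNIV. (d $ i) ^ 4)"
proof -
  obtain k where k: "\<And>i. \<bar>d $ i\<bar> \<le> \<bar>d $ k\<bar>"
  proof -
    have "Max (range (\<lambda>i. \<bar>d $ i\<bar>)) \<in> range (\<lambda>i. \<bar>d $ i\<bar>)" by (rule Max_in) auto
    then obtain k where "Max (range (\<lambda>i. \<bar>d $ i\<bar>)) = \<bar>d $ k\<bar>" by (rule imageE)
    then show ?thesis using that[of k] Max_ge[of "range (\<lambda>i. \<bar>d $ i\<bar>)"] by auto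
  qed
  have "\<bar>a \<bullet> d\<bar> \<le> (\<Sum>i\<in>UNIV. \<bar>a $ i\<bar> * \<bar>d $ i\<bar>)"
    unfolding inner_vec_def by (rule order_trans[OF sum_abs]) (simp add: abs_mult)
  also have "\<dots> \<le> (\<Sum>i\<in>UNIV. \<bar>a $ i\<bar>) * \<bar>d $ k\<bar>"
    unfolding sum_distrib_right by (intro sum_mono mult_left_mono k) auto
  finally have "\<bar>a \<bullet> d\<bar> ^ 4 \<le> ((\<Sum>i\<in>UNIV. \<bar>a $ i\<bar>) * \<bar>d $ k\<bar>) ^ 4" by (intro power_mono) auto
  then have "(a \<bullet> d) ^ 4 \<le> (\<Sum>i\<in>UNIV. \<bar>a $ i\<bar>) ^ 4 * (d $ k) ^ 4" by (simp add: power_mult_distrib)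
  also have "\<dots> \<le> (\<Sum>i\<in>UNIV. \<bar>a $ i\<bar>) ^ 4 * (\<Sum>i\<in>UNIV. (d $ i) ^ 4)"
    by (intro mult_left_mono member_le_sum) (auto intro: zero_le_power sum_nonneg)
  finally show ?thesis .
qed

lemma sum_UNIV_pair:
  "(\<Sum>i\<in>UNIV. \<Sum>j\<in>UNIV. f i j) = (\<Sum>p\<in>UNIV. f (fst p) (snd p))"
  by (simp add: sum.cartesian_product split_def)

lemma cmod_iexp_diff_le: "cmod (iexp x - iexp y) \<le> \<bar>x - y\<bar>"
proof -
  have "iexp x - iexp y = iexp y * (iexp (x - y) - 1)"
    by (simp add: right_diff_distrib exp_diff field_simps)
  then have "cmod (iexp x - iexp y) = cmod (iexp (x - y) - 1)"
    by (simp only: norm_mult norm_exp_i_times mult_1_left)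
  also have "\<dots> \<le> \<bar>x - y\<bar>" using iexp_approx1[of "x - y" 0] by simp
  finally show ?thesis .
qed

text \<open>Relative form of the remainder on one sample path. The averages of \<open>l\<close>, the
  centered Hessians, stay explicit because they are controlled in probability, whereas
  \<open>b\<close> gathers the terms that vanish on the path itself. The factor
  \<open>norm (u n)\<close> on the right makes absorption possible.\<close>

definition small_remainder ::
  "real ^ 'm ^ 'm \<Rightarrow> (nat \<Rightarrow> real ^ 'm) \<Rightarrow> (nat \<Rightarrow> 'm \<Rightarrow> 'm \<Rightarrow> real) \<Rightarrow> (nat \<Rightarrow> real ^ 'm) \<Rightarrow> bool" where
  "small_remainder V d l u \<longleftrightarrow> (\<exists>b. b \<longlonglongrightarrow> 0 \<and> (\<forall>\<^sub>F n in sequentially.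
     norm (V *v u n + (1 / (2 * real n)) *\<^sub>R (\<Sum>t=1..n. d t))
     \<le> ((\<Sum>i\<in>UNIV. \<Sum>j\<in>UNIV. \<bar>\<Sum>t=1..n. l t i j\<bar> / real n) + b n) * norm (u n)))"

section \<open>Limit laws of the score and of the estimation error\<close>

context filtered_prob_space begin

text \<open>Reduction to one dimension along the direction \<open>a\<close>. The factor 2 in the
  normalization matches the factor 4 in front of \<open>W\<close>, so the limiting conditional
  variance is the quadratic form of \<open>W\<close> at \<open>a\<close>.\<close>

lemma score_char:
  fixes D :: "nat \<Rightarrow> 'a \<Rightarrow> real ^ 'm"
  assumes D: "\<And>t. 1 \<le> t \<Longrightarrow> D t \<in> borel_measurable (F t)"
    and D4: "\<And>t i. 1 \<le> t \<Longrightarrow> integrable M (\<lambda>\<omega>. (D t \<omega> $ i) ^ 4)"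
      "\<And>t i. 1 \<le> t \<Longrightarrow> (\<integral>\<omega>. (D t \<omega> $ i) ^ 4 \<partial>M) \<le> C"
    and D0: "\<And>t i. 1 \<le> t \<Longrightarrow> AE \<omega> in M. real_cond_exp M (F (t - 1)) (\<lambda>\<omega>. D t \<omega> $ i) \<omega> = 0"
    and Dlim: "\<And>i j. AE \<omega> in M. (\<lambda>n. (\<Sum>t=1..n. real_cond_exp M (F (t - 1)) (\<lambda>\<omega>. D t \<omega> $ i * D t \<omega> $ j) \<omega>) / real n)
       \<longlonglongrightarrow> 4 * W $ i $ j"
  shows "(\<lambda>n. \<integral>\<omega>. iexp (a \<bullet> ((1 / (2 * sqrt (real n))) *\<^sub>R (\<Sum>t=1..n. D t \<omega>))) \<partial>M) \<longlonglongrightarrow> exp (- (a \<bullet> (W *v a)) / 2)"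
proof -
  define X where "X = (\<lambda>t \<omega>. (a /\<^sub>R 2) \<bullet> D t \<omega>)"
  have DM[measurable]: "D t \<in> borel_measurable M" if "1 \<le> t" for t using measurable_F[OF D[OF that]] .
  have XF: "X t \<in> borel_measurable (F t)" if "1 \<le> t" for t using D[OF that] unfolding X_def by measurable
  have XM[measurable]: "X t \<in> borel_measurable M" if "1 \<le> t" for t using measurable_F[OF XF[OF that]] .
  define c where "c = (\<Sum>i\<in>UNIV. \<bar>(a /\<^sub>R 2) $ i\<bar>) ^ 4"
  have c0: "0 \<le> c" by (simp add: c_def)
  have DiM: "(\<lambda>\<omega>. D t \<omega> $ i) \<in> borel_measurable M" if "1 \<le> t" for t i
    using DM[OF that] by measurable
  have Dint: "integrable M (\<lambda>\<omega>. D t \<omega> $ i)" and D2: "integrable M (\<lambda>\<omega>. (D t \<omega> $ i)\<^sup>2)"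
    if "1 \<le> t" for t i
    by (rule integrable_of_fourth_power[OF DiM[OF that] D4(1)[OF that]])+
  have DD: "integrable M (\<lambda>\<omega>. D t \<omega> $ i * D t \<omega> $ j)" if "1 \<le> t" for t i j
    by (rule integrable_mult_of_squares) (use D2[OF that] DM[OF that] in auto)
  have i4: "integrable M (\<lambda>\<omega>. c * (\<Sum>i\<in>UNIV. (D t \<omega> $ i) ^ 4))" if "1 \<le> t" for t
    using D4(1)[OF that] by auto
  have X4le: "X t \<omega> ^ 4 \<le> c * (\<Sum>i\<in>UNIV. (D t \<omega> $ i) ^ 4)" for t \<omega>
    unfolding X_def c_def by (rule inner_power4_le)
  have X4: "integrable M (\<lambda>\<omega>. X t \<omega> ^ 4)" if "1 \<le> t" for t
  proof (rule Bochner_Integration.integrable_bound[OF i4[OF that]])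
    show "AE \<omega> in M. norm (X t \<omega> ^ 4) \<le> norm (c * (\<Sum>i\<in>UNIV. (D t \<omega> $ i) ^ 4))"
      using order_trans[OF X4le abs_ge_self] by (intro AE_I2) simp
  qed (use XM[OF that] in measurable)
  have X4C: "(\<integral>\<omega>. X t \<omega> ^ 4 \<partial>M) \<le> c * (real CARD('m) * C)" if "1 \<le> t" for t
  proof -
    have "(\<integral>\<omega>. X t \<omega> ^ 4 \<partial>M) \<le> (\<integral>\<omega>. c * (\<Sum>i\<in>UNIV. (D t \<omega> $ i) ^ 4) \<partial>M)"
      by (rule integral_mono[OF X4[OF that] i4[OF that] X4le])
    also have "\<dots> = c * (\<Sum>i\<in>UNIV. (\<integral>\<omega>. (D t \<omega> $ i) ^ 4 \<partial>M))" using D4(1)[OF that] by simp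
    also have "\<dots> \<le> c * (\<Sum>i\<in>(UNIV::'m set). C)" by (intro mult_left_mono sum_mono D4(2) that c0)
    finally show ?thesis by simp
  qed
  have X0: "AE \<omega> in M. real_cond_exp M (F (t - 1)) (X t) \<omega> = 0" if "1 \<le> t" for t
  proof -
    interpret S: sigma_finite_subalgebra M "F (t - 1)" by (rule sigma_finite_sub)
    have "AE \<omega> in M. real_cond_exp M (F (t - 1)) (X t) \<omega> = (\<Sum>i\<in>UNIV. (a /\<^sub>R 2) $ i * real_cond_exp M (F (t - 1)) (\<lambda>\<omega>. D t \<omega> $ i) \<omega>)"
      by (rule S.real_cond_exp_linear_comb) (use Dint[OF that] XM[OF that] in \<open>auto simp: X_def inner_vec_def\<close>)
    moreover have "AE \<omega> in M. \<forall>i. real_cond_exp M (F (t - 1)) (\<lambda>\<omega>. D t \<omega> $ i) \<omega> = 0"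
      unfolding AE_all_countable using D0[OF that] by blast
    ultimately show ?thesis by eventually_elim simp
  qed
  \<comment> \<open>The square is expanded as a single sum over pairs of indices, the form required
    by \<open>real_cond_exp_linear_comb\<close>.\<close>
  have XX: "AE \<omega> in M. real_cond_exp M (F (t - 1)) (\<lambda>\<omega>. (X t \<omega>)\<^sup>2) \<omega>
     = (\<Sum>p\<in>UNIV. (a $ fst p * a $ snd p / 4) * real_cond_exp M (F (t - 1)) (\<lambda>\<omega>. D t \<omega> $ fst p * D t \<omega> $ snd p) \<omega>)" if "1 \<le> t" for t
  proof -
    interpret S: sigma_finite_subalgebra M "F (t - 1)" by (rule sigma_finite_sub)
    have eq: "(X t \<omega>)\<^sup>2 = (\<Sum>p\<in>UNIV. (a $ fst p * a $ snd p / 4) * (D t \<omega> $ fst p * D t \<omega> $ snd p))" for \<omega>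
    proof -
      have "(X t \<omega>)\<^sup>2 = (\<Sum>i\<in>UNIV. \<Sum>j\<in>UNIV. (a $ i / 2 * D t \<omega> $ i) * (a $ j / 2 * D t \<omega> $ j))"
        by (simp add: X_def inner_vec_def power2_eq_square sum_product)
      also have "\<dots> = (\<Sum>p\<in>UNIV. (a $ fst p * a $ snd p / 4) * (D t \<omega> $ fst p * D t \<omega> $ snd p))"
        unfolding sum_UNIV_pair by (rule sum.cong) auto
      finally show ?thesis .
    qed
    show ?thesis
      by (rule S.real_cond_exp_linear_comb) (use DD[OF that] XM[OF that] eq in auto)
  qed
  have lim: "AE \<omega> in M. (\<lambda>n. (\<Sum>t=1..n. real_cond_exp M (F (t - 1)) (\<lambda>\<omega>. (X t \<omega>)\<^sup>2) \<omega>) / real n) \<longlonglongrightarrow> a \<bullet> (W *v a)"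
  proof -
    have "AE \<omega> in M. \<forall>t\<in>{1..}. real_cond_exp M (F (t - 1)) (\<lambda>\<omega>. (X t \<omega>)\<^sup>2) \<omega>
     = (\<Sum>p\<in>UNIV. (a $ fst p * a $ snd p / 4) * real_cond_exp M (F (t - 1)) (\<lambda>\<omega>. D t \<omega> $ fst p * D t \<omega> $ snd p) \<omega>)"
      using XX by (subst AE_ball_countable) auto
    moreover have "AE \<omega> in M. \<forall>i. \<forall>j. (\<lambda>n. (\<Sum>t=1..n. real_cond_exp M (F (t - 1)) (\<lambda>\<omega>. D t \<omega> $ i * D t \<omega> $ j) \<omega>) / real n) \<longlonglongrightarrow> 4 * W $ i $ j"
      unfolding AE_all_countable using Dlim by blast
    ultimately show ?thesis
    proof eventually_elim
      case (elim \<omega>)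
      let ?r = "\<lambda>t p. real_cond_exp M (F (t - 1)) (\<lambda>\<omega>. D t \<omega> $ fst p * D t \<omega> $ snd p) \<omega>"
      have eq: "(\<Sum>t=1..n. real_cond_exp M (F (t - 1)) (\<lambda>\<omega>. (X t \<omega>)\<^sup>2) \<omega>) / real n
         = (\<Sum>p\<in>UNIV. (a $ fst p * a $ snd p / 4) * ((\<Sum>t=1..n. ?r t p) / real n))" for n
      proof -
        have "(\<Sum>t=1..n. real_cond_exp M (F (t - 1)) (\<lambda>\<omega>. (X t \<omega>)\<^sup>2) \<omega>)
           = (\<Sum>t=1..n. \<Sum>p\<in>UNIV. (a $ fst p * a $ snd p / 4) * ?r t p)"
          using elim(1) by (intro sum.cong) auto
        also have "\<dots> = (\<Sum>p\<in>UNIV. (a $ fst p * a $ snd p / 4) * (\<Sum>t=1..n. ?r t p))"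
          unfolding sum_distrib_left by (rule sum.swap)
        finally show ?thesis by (simp only: sum_divide_distrib[where A = UNIV] times_divide_eq_right)
      qed
      have "(\<lambda>n. \<Sum>p\<in>UNIV. (a $ fst p * a $ snd p / 4) * ((\<Sum>t=1..n. ?r t p) / real n))
        \<longlonglongrightarrow> (\<Sum>p\<in>UNIV. (a $ fst p * a $ snd p / 4) * (4 * W $ fst p $ snd p))"
        using elim(2) by (intro tendsto_sum tendsto_mult tendsto_const) auto
      also have "(\<Sum>p\<in>UNIV. (a $ fst p * a $ snd p / 4) * (4 * W $ fst p $ snd p)) = (\<Sum>p\<in>UNIV. a $ fst p * (W $ fst p $ snd p * a $ snd p))"
        by (rule sum.cong) auto
      also have "\<dots> = (\<Sum>i\<in>UNIV. \<Sum>j\<in>UNIV. a $ i * (W $ i $ j * a $ j))"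
        unfolding sum_UNIV_pair ..
      also have "\<dots> = a \<bullet> (W *v a)"
        by (simp add: inner_vec_def matrix_vector_mult_def sum_distrib_left)
      finally show ?case unfolding eq .
    qed
  qed
  have "(\<lambda>n. \<integral>\<omega>. iexp ((\<Sum>t=1..n. X t \<omega>) / sqrt (real n)) \<partial>M) \<longlonglongrightarrow> exp (- (a \<bullet> (W *v a)) / 2)"
    by (rule martingale_clt_char[OF XF X4 X4C X0 lim])
  moreover have "(\<Sum>t=1..n. X t \<omega>) / sqrt (real n) = a \<bullet> ((1 / (2 * sqrt (real n))) *\<^sub>R (\<Sum>t=1..n. D t \<omega>))" for n \<omega>
  proof -
    have eq: "(\<Sum>t=1..n. X t \<omega>) = (a /\<^sub>R 2) \<bullet> (\<Sum>t=1..n. D t \<omega>)"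
      unfolding X_def by (rule inner_sum_right[symmetric])
    show ?thesis unfolding eq by (simp add: field_simps)
  qed
  ultimately show ?thesis by (simp only:)
qed

text \<open>With \<open>U\<close> the normalized error and \<open>Z\<close> the normalized score,
  \<open>V *v U + Z\<close> is small relative to \<open>U\<close> off events of small probability.
  There \<open>U\<close> is bounded by a multiple of \<open>Z\<close> and close to
  \<open>- (matrix_inv V *v Z)\<close>, so the characteristic functions of both have the same
  limit.\<close>

theorem estimator_clt:
  fixes D :: "nat \<Rightarrow> 'a \<Rightarrow> real ^ 'm" and L :: "nat \<Rightarrow> 'm \<Rightarrow> 'm \<Rightarrow> 'a \<Rightarrow> real" and u :: "nat \<Rightarrow> 'a \<Rightarrow> real ^ 'm"
  assumes D: "\<And>t. 1 \<le> t \<Longrightarrow> D t \<in> borel_measurable (F t)"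
    and D4: "\<And>t i. 1 \<le> t \<Longrightarrow> integrable M (\<lambda>\<omega>. (D t \<omega> $ i) ^ 4)"
      "\<And>t i. 1 \<le> t \<Longrightarrow> (\<integral>\<omega>. (D t \<omega> $ i) ^ 4 \<partial>M) \<le> C1"
    and D0: "\<And>t i. 1 \<le> t \<Longrightarrow> AE \<omega> in M. real_cond_exp M (F (t - 1)) (\<lambda>\<omega>. D t \<omega> $ i) \<omega> = 0"
    and Dlim: "\<And>i j. AE \<omega> in M. (\<lambda>n. (\<Sum>t=1..n. real_cond_exp M (F (t - 1)) (\<lambda>\<omega>. D t \<omega> $ i * D t \<omega> $ j) \<omega>) / real n)
       \<longlonglongrightarrow> 4 * W $ i $ j"
    and L: "\<And>t i j. 1 \<le> t \<Longrightarrow> L t i j \<in> borel_measurable (F t)"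
    and L2: "\<And>t i j. 1 \<le> t \<Longrightarrow> integrable M (\<lambda>\<omega>. (L t i j \<omega>)\<^sup>2)"
      "\<And>t i j. 1 \<le> t \<Longrightarrow> (\<integral>\<omega>. (L t i j \<omega>)\<^sup>2 \<partial>M) \<le> C2"
    and L0: "\<And>t i j. 1 \<le> t \<Longrightarrow> AE \<omega> in M. real_cond_exp M (F (t - 1)) (L t i j) \<omega> = 0"
    and u: "\<And>n. 1 \<le> n \<Longrightarrow> u n \<in> borel_measurable M"
    and V: "pos_def V" and W: "pos_def W"
    and expansion: "\<And>\<epsilon>. 0 < \<epsilon> \<Longrightarrow> \<exists>E\<in>sets M. prob E > 1 - \<epsilon> \<and> 
        (AE \<omega> in M. \<omega> \<in> E \<longrightarrow> small_remainder V (\<lambda>t. D t \<omega>) (\<lambda>t i j. L t i j \<omega>) (\<lambda>n. u n \<omega>))"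
  shows "weakly_converges (\<lambda>n. distr M borel (\<lambda>\<omega>. sqrt (real n) *\<^sub>R u n \<omega>)) (mvnormal 0 (matrix_inv V ** W ** matrix_inv V))"
proof -
  let ?B = "matrix_inv V"
  note inv = pos_def_sandwich(1)[OF V W] and tB = pos_def_sandwich(2)[OF V W] and pA = pos_def_sandwich(3)[OF V W]
  define \<Lambda> where "\<Lambda> = (\<lambda>n \<omega>. \<Sum>i\<in>UNIV. \<Sum>j\<in>UNIV. \<bar>\<Sum>t=1..n. L t i j \<omega>\<bar> / real n)"
  define U where "U = (\<lambda>n \<omega>. sqrt (real n) *\<^sub>R u n \<omega>)"
  define Z where "Z = (\<lambda>n \<omega>. (1 / (2 * sqrt (real n))) *\<^sub>R (\<Sum>t=1..n. D t \<omega>))"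
  have DM: "D t \<in> borel_measurable M" if "1 \<le> t" for t using measurable_F[OF D[OF that]] .
  have LM: "L t i j \<in> borel_measurable M" if "1 \<le> t" for t i j using measurable_F[OF L[OF that]] .
  have SM[measurable]: "(\<lambda>\<omega>. \<Sum>t=1..n. D t \<omega>) \<in> borel_measurable M" for n
    by (intro borel_measurable_sum DM) auto
  have SL[measurable]: "(\<lambda>\<omega>. \<Sum>t=1..n. L t i j \<omega>) \<in> borel_measurable M" for n i j
    by (intro borel_measurable_sum LM) auto
  have ZM[measurable]: "Z n \<in> borel_measurable M" for n unfolding Z_def by measurable
  have \<Lambda>M[measurable]: "\<Lambda> n \<in> borel_measurable M" for n unfolding \<Lambda>_def by measurable
  have UM[measurable]: "U n \<in> borel_measurable M" if "1 \<le> n" for n using u[OF that] unfolding U_def by measurable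
  have Vm: "(\<lambda>x. V *v x) \<in> borel_measurable borel" "(\<lambda>x. ?B *v x) \<in> borel_measurable borel" by measurable
  have VU[measurable]: "(\<lambda>\<omega>. V *v U n \<omega>) \<in> borel_measurable M" if "1 \<le> n" for n
    using measurable_compose[OF UM[OF that] Vm(1)] .
  have BZ[measurable]: "(\<lambda>\<omega>. ?B *v Z n \<omega>) \<in> borel_measurable M" for n
    using measurable_compose[OF ZM Vm(2)] .

  \<comment> \<open>The event that the remainder is not covered by
    \<open>\<Lambda> + \<eta>\<close>. The path-dependent null sequence of the expansion is traded
    for the constant \<open>\<eta>\<close>, so that failure at \<open>n\<close> becomes one
    measurable event.\<close>
  define bad where "bad = (\<lambda>\<eta> n. {\<omega> \<in> space M. (\<Lambda> n \<omega> + \<eta>) * norm (U n \<omega>) < norm (V *v U n \<omega> + Z n \<omega>)})"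
  have badM: "bad \<eta> n \<in> sets M" if "1 \<le> n" for \<eta> n
    unfolding bad_def using UM[OF that] VU[OF that] by measurable
  have scale: "norm (V *v U n \<omega> + Z n \<omega>) = sqrt (real n) * norm (V *v u n \<omega> + (1 / (2 * real n)) *\<^sub>R (\<Sum>t=1..n. D t \<omega>))"
    if n: "1 \<le> n" for n \<omega>
  proof -
    have s: "1 / sqrt (real n) = sqrt (real n) / real n"
      by (simp add: sqrt_divide_self_eq inverse_eq_divide)
    have "1 / (2 * sqrt (real n)) = (1 / sqrt (real n)) / 2" by simp
    also have "\<dots> = sqrt (real n) * (1 / (2 * real n))" unfolding s by simp
    finally have "1 / (2 * sqrt (real n)) = sqrt (real n) * (1 / (2 * real n))" .
    then have "V *v U n \<omega> + Z n \<omega> = sqrt (real n) *\<^sub>R (V *v u n \<omega> + (1 / (2 * real n)) *\<^sub>R (\<Sum>t=1..n. D t \<omega>))"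
      by (simp add: U_def Z_def linear_scale[OF matrix_vector_mul_linear] scaleR_right_distrib)
    then show ?thesis by simp
  qed
  \<comment> \<open>On almost every path of \<open>E\<close> the expansion excludes the bad event
    from some \<open>n\<close> on, so dominated convergence applies inside \<open>E\<close>; the
    complement costs less than \<open>\<epsilon> / 2\<close>. The index \<open>Suc n\<close> avoids
    time 0, where measurability of \<open>u\<close> is not provided.\<close>
  have bad_lim: "(\<lambda>n. prob (bad \<eta> (Suc n))) \<longlonglongrightarrow> 0" if \<eta>: "0 < \<eta>" for \<eta>
  proof (rule LIMSEQ_I)
    fix \<epsilon> :: real assume \<epsilon>: "0 < \<epsilon>"
    then obtain E where E: "E \<in> sets M" "prob E > 1 - \<epsilon> / 2"
      and ex: "AE \<omega> in M. \<omega> \<in> E \<longrightarrow> small_remainder V (\<lambda>t. D t \<omega>) (\<lambda>t i j. L t i j \<omega>) (\<lambda>n. u n \<omega>)"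
      using expansion[of "\<epsilon> / 2"] by auto
    have "(\<lambda>n. \<integral>\<omega>. indicator (bad \<eta> (Suc n) \<inter> E) \<omega> \<partial>M) \<longlonglongrightarrow> (\<integral>\<omega>. (0 :: real) \<partial>M)"
    proof (rule integral_dominated_convergence[where w = "\<lambda>_. 1"])
      show "AE \<omega> in M. (\<lambda>n. indicator (bad \<eta> (Suc n) \<inter> E) \<omega> :: real) \<longlonglongrightarrow> 0"
        using ex
      proof eventually_elim
        case (elim \<omega>)
        show ?case
        proof (cases "\<omega> \<in> E")
          case True
          with elim obtain b where b: "b \<longlonglongrightarrow> 0" and *: "\<forall>\<^sub>F n in sequentially.
             norm (V *v u n \<omega> + (1 / (2 * real n)) *\<^sub>R (\<Sum>t=1..n. D t \<omega>)) \<le> (\<Lambda> n \<omega> + b n) * norm (u n \<omega>)" unfolding small_remainder_def \<Lambda>_def by auto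
          have "\<forall>\<^sub>F n in sequentially. b n < \<eta>" using order_tendstoD(2)[OF b \<eta>] .
          with * eventually_ge_at_top[of 1] have "\<forall>\<^sub>F n in sequentially. \<omega> \<notin> bad \<eta> n"
          proof eventually_elim
            case (elim n)
            have "norm (V *v U n \<omega> + Z n \<omega>) \<le> sqrt (real n) * ((\<Lambda> n \<omega> + b n) * norm (u n \<omega>))"
              unfolding scale[OF elim(2)] by (intro mult_left_mono elim(1)) simp
            also have "\<dots> = (\<Lambda> n \<omega> + b n) * norm (U n \<omega>)" by (simp add: U_def)
            also have "\<dots> \<le> (\<Lambda> n \<omega> + \<eta>) * norm (U n \<omega>)" using elim(3) by (intro mult_right_mono) auto
            finally show ?case by (simp add: bad_def not_less)
          qed
          then have "\<forall>\<^sub>F n in sequentially. \<omega> \<notin> bad \<eta> (Suc n)" by (rule eventually_compose_filterlim[OF _ filterlim_Suc])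
          then have "\<forall>\<^sub>F n in sequentially. 0 = (indicator (bad \<eta> (Suc n) \<inter> E) \<omega> :: real)"
            by eventually_elim simp
          then show ?thesis by (rule Lim_transform_eventually[rotated]) simp
        qed simp
      qed
    qed (use badM E in \<open>auto simp: indicator_def\<close>)
    then have "(\<lambda>n. prob (bad \<eta> (Suc n) \<inter> E)) \<longlonglongrightarrow> 0" using badM E by simp
    then have "\<forall>\<^sub>F n in sequentially. prob (bad \<eta> (Suc n) \<inter> E) < \<epsilon> / 2" using \<epsilon> by (intro order_tendstoD) auto
    then have "\<forall>\<^sub>F n in sequentially. norm (prob (bad \<eta> (Suc n)) - 0) < \<epsilon>"
    proof eventually_elim
      case (elim n)
      have "prob (bad \<eta> (Suc n)) \<le> prob ((bad \<eta> (Suc n) \<inter> E) \<union> (space M - E))"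
        using badM E by (intro finite_measure_mono) (auto simp: bad_def)
      also have "\<dots> \<le> prob (bad \<eta> (Suc n) \<inter> E) + prob (space M - E)"
        using badM E by (intro measure_Un_le) auto
      also have "prob (space M - E) = 1 - prob E" using E(1) by (rule prob_compl)
      finally show ?case using elim E(2) by simp
    qed
    then show "\<exists>n0. \<forall>n\<ge>n0. norm (prob (bad \<eta> (Suc n)) - 0) < \<epsilon>" by (simp add: eventually_sequentially)
  qed
  have \<Lambda>0: "0 \<le> \<Lambda> n \<omega>" for n \<omega> unfolding \<Lambda>_def by (intro sum_nonneg) auto
  have i\<Lambda>: "integrable M (\<Lambda> n)" and E\<Lambda>: "(\<integral>\<omega>. \<Lambda> n \<omega> \<partial>M) \<le> (real CARD('m))\<^sup>2 * ((1 + C2) / sqrt (real n))" if n: "1 \<le> n" for n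
  proof -
    have ab1: "integrable M (\<lambda>\<omega>. \<bar>\<Sum>t=1..n. L t i j \<omega>\<bar> / real n)" for i j
      by (rule expectation_abs_mean_le(1)[OF L L2 L0 n])
    have ab2: "(\<integral>\<omega>. \<bar>\<Sum>t=1..n. L t i j \<omega>\<bar> / real n \<partial>M) \<le> (1 + C2) / sqrt (real n)" for i j
      by (rule expectation_abs_mean_le(2)[OF L L2 L0 n])
    show "integrable M (\<Lambda> n)" unfolding \<Lambda>_def by (intro Bochner_Integration.integrable_sum ab1)
    have "(\<integral>\<omega>. \<Lambda> n \<omega> \<partial>M) = (\<Sum>i\<in>UNIV. \<Sum>j\<in>UNIV. (\<integral>\<omega>. \<bar>\<Sum>t=1..n. L t i j \<omega>\<bar> / real n \<partial>M))"
      unfolding \<Lambda>_def by (subst Bochner_Integration.integral_sum, intro Bochner_Integration.integrable_sum ab1)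
        (intro sum.cong refl Bochner_Integration.integral_sum ab1)
    also have "\<dots> \<le> (\<Sum>i\<in>(UNIV::'m set). \<Sum>j\<in>(UNIV::'m set). (1 + C2) / sqrt (real n))" by (intro sum_mono ab2)
    finally show "(\<integral>\<omega>. \<Lambda> n \<omega> \<partial>M) \<le> (real CARD('m))\<^sup>2 * ((1 + C2) / sqrt (real n))" by (simp add: power2_eq_square)
  qed
  \<comment> \<open>Markov's inequality combined with the \<open>L1\<close> rate of the averaged
    centered Hessians.\<close>
  have \<Lambda>_lim: "(\<lambda>n. prob {\<omega> \<in> space M. \<eta> \<le> \<Lambda> (Suc n) \<omega>}) \<longlonglongrightarrow> 0" if \<eta>: "0 < \<eta>" for \<eta>
  proof (rule Lim_null_comparison[where g = "\<lambda>n. (real CARD('m))\<^sup>2 * ((1 + C2) / sqrt (real (Suc n))) / \<eta>"])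
    show "\<forall>\<^sub>F n in sequentially. norm (prob {\<omega> \<in> space M. \<eta> \<le> \<Lambda> (Suc n) \<omega>}) \<le> (real CARD('m))\<^sup>2 * ((1 + C2) / sqrt (real (Suc n))) / \<eta>"
    proof (intro always_eventually allI)
      fix n
      have "prob {\<omega> \<in> space M. \<eta> \<le> \<Lambda> (Suc n) \<omega>} \<le> (\<integral>\<omega>. \<Lambda> (Suc n) \<omega> \<partial>M) / \<eta>"
        using integral_Markov_inequality_measure[OF i\<Lambda>[of "Suc n"], of "{}" \<eta>] \<eta> \<Lambda>0 by auto
      also have "\<dots> \<le> (real CARD('m))\<^sup>2 * ((1 + C2) / sqrt (real (Suc n))) / \<eta>"
        using \<eta> by (intro divide_right_mono E\<Lambda>) auto
      finally show "norm (prob {\<omega> \<in> space M. \<eta> \<le> \<Lambda> (Suc n) \<omega>}) \<le> (real CARD('m))\<^sup>2 * ((1 + C2) / sqrt (real (Suc n))) / \<eta>" by simp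
    qed
    have "(\<lambda>n. (1 + C2) / sqrt (real n)) \<longlonglongrightarrow> 0"
      by (rule real_tendsto_divide_at_top[OF tendsto_const filterlim_compose[OF sqrt_at_top filterlim_real_sequentially]])
    from LIMSEQ_Suc[OF this] have "(\<lambda>n. (real CARD('m))\<^sup>2 * ((1 + C2) / sqrt (real (Suc n))) / \<eta>) \<longlonglongrightarrow> (real CARD('m))\<^sup>2 * 0 / \<eta>"
      by (intro tendsto_divide tendsto_mult tendsto_const) (use \<eta> in auto)
    then show "(\<lambda>n. (real CARD('m))\<^sup>2 * ((1 + C2) / sqrt (real (Suc n))) / \<eta>) \<longlonglongrightarrow> 0" by simp
  qed

  \<comment> \<open>A uniform \<open>L1\<close> bound for the normalized score, by orthogonality of
    the \<open>D t\<close>. It is the source of all tightness in this proof.\<close>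
  obtain K where K: "\<And>n. 1 \<le> n \<Longrightarrow> integrable M (\<lambda>\<omega>. norm (Z n \<omega>))" "\<And>n. 1 \<le> n \<Longrightarrow> (\<integral>\<omega>. norm (Z n \<omega>) \<partial>M) \<le> K" "0 \<le> K"
  proof -
    define K where "K = real CARD('m) * (1 + (1 + C1))"
    have D2: "integrable M (\<lambda>\<omega>. (D t \<omega> $ i)\<^sup>2)" "(\<integral>\<omega>. (D t \<omega> $ i)\<^sup>2 \<partial>M) \<le> 1 + C1" if t: "1 \<le> t" for t i
    proof -
      have [measurable]: "D t \<in> borel_measurable M" by (rule DM[OF t])
      show 1: "integrable M (\<lambda>\<omega>. (D t \<omega> $ i)\<^sup>2)"
        by (rule integrable_of_fourth_power(2)) (use D4(1)[OF t] in auto)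
      have "(\<integral>\<omega>. (D t \<omega> $ i)\<^sup>2 \<partial>M) \<le> (\<integral>\<omega>. 1 + (D t \<omega> $ i) ^ 4 \<partial>M)"
        by (rule integral_mono[OF 1]) (use D4(1)[OF t] square_le in auto)
      also have "\<dots> \<le> 1 + C1" using D4[OF t] prob_space by simp
      finally show "(\<integral>\<omega>. (D t \<omega> $ i)\<^sup>2 \<partial>M) \<le> 1 + C1" .
    qed
    have C10: "0 \<le> 1 + C1" by (rule order_trans[OF integral_nonneg_AE D2(2)[of 1 undefined]]) auto
    have Zb: "integrable M (\<lambda>\<omega>. norm (Z n \<omega>)) \<and> (\<integral>\<omega>. norm (Z n \<omega>) \<partial>M) \<le> K" if n: "1 \<le> n" for n
    proof -
      let ?S = "\<lambda>i \<omega>. \<Sum>t=1..n. D t \<omega> $ i"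
      have S2: "integrable M (\<lambda>\<omega>. (?S i \<omega>)\<^sup>2) \<and> (\<integral>\<omega>. (?S i \<omega>)\<^sup>2 \<partial>M) \<le> real n * (1 + C1)" for i
      proof (rule mds_second_moment[of "\<lambda>t \<omega>. D t \<omega> $ i" "1 + C1" n])
        show "(\<lambda>\<omega>. D t \<omega> $ i) \<in> borel_measurable (F t)" if "1 \<le> t" for t using D[OF that] by measurable
      qed (use D2 D0 in auto)
      have bd: "norm (Z n \<omega>) \<le> (\<Sum>i\<in>UNIV. 1 + (?S i \<omega>)\<^sup>2 / real n)" for \<omega>
      proof -
        have "norm (Z n \<omega>) \<le> (\<Sum>i\<in>UNIV. \<bar>Z n \<omega> $ i\<bar>)" by (rule norm_le_l1_cart)
        also have "\<dots> \<le> (\<Sum>i\<in>UNIV. 1 + (?S i \<omega>)\<^sup>2 / real n)"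
        proof (rule sum_mono)
          fix i
          have "\<bar>Z n \<omega> $ i\<bar> \<le> 1 + (Z n \<omega> $ i)\<^sup>2" by (rule abs_le_one_plus_square)
          also have "(Z n \<omega> $ i)\<^sup>2 = (?S i \<omega>)\<^sup>2 / (real n * 4)"
            by (simp add: Z_def power_divide power_mult_distrib)
          also have "\<dots> \<le> (?S i \<omega>)\<^sup>2 / real n" using n by (intro divide_left_mono) auto
          finally show "\<bar>Z n \<omega> $ i\<bar> \<le> 1 + (?S i \<omega>)\<^sup>2 / real n" by simp
        qed
        finally show ?thesis .
      qed
      have i: "integrable M (\<lambda>\<omega>. \<Sum>i\<in>UNIV. 1 + (?S i \<omega>)\<^sup>2 / real n)" using S2 by auto
      have i2: "integrable M (\<lambda>\<omega>. norm (Z n \<omega>))"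
      proof (rule Bochner_Integration.integrable_bound[OF i])
        show "AE \<omega> in M. norm (norm (Z n \<omega>)) \<le> norm (\<Sum>i\<in>UNIV. 1 + (?S i \<omega>)\<^sup>2 / real n)"
          using order_trans[OF bd abs_ge_self] by (intro AE_I2) simp
      qed measurable
      have "(\<integral>\<omega>. norm (Z n \<omega>) \<partial>M) \<le> (\<integral>\<omega>. (\<Sum>i\<in>UNIV. 1 + (?S i \<omega>)\<^sup>2 / real n) \<partial>M)"
        by (rule integral_mono[OF i2 i bd])
      also have "\<dots> = (\<Sum>i\<in>UNIV. 1 + (\<integral>\<omega>. (?S i \<omega>)\<^sup>2 \<partial>M) / real n)"
        using S2 prob_space by (subst Bochner_Integration.integral_sum) auto
      also have "\<dots> \<le> (\<Sum>i\<in>(UNIV::'m set). 1 + (1 + C1))"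
        using S2 n by (intro sum_mono add_left_mono) (auto simp: divide_le_eq mult.commute)
      also have "\<dots> = K" by (simp add: K_def)
      finally show ?thesis using i2 by simp
    qed
    show ?thesis using that[of K] Zb C10 by (auto simp: K_def)
  qed

  obtain c where c: "0 < c" "\<And>x. norm (?B *v x) \<le> c * norm x"
    using bounded_linear.pos_bounded[OF matrix_vector_mul_bounded_linear[of ?B]] by (auto simp: mult.commute)
  have slutsky: "(\<lambda>n. (\<integral>\<omega>. iexp (a \<bullet> U (Suc n) \<omega>) \<partial>M) - (\<integral>\<omega>. iexp ((- (?B *v a)) \<bullet> Z (Suc n) \<omega>) \<partial>M)) \<longlonglongrightarrow> 0" for a
  proof (rule LIMSEQ_I)
    fix \<epsilon> :: real assume \<epsilon>: "0 < \<epsilon>"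
    \<comment> \<open>The first bound gives \<open>2 * c * \<eta> \<le> 1 / 2\<close>, so the
      remainder can be absorbed into \<open>norm (U n \<omega>)\<close>; the second keeps the final
      error, \<open>norm a * (4 * \<eta> * c\<^sup>2)\<close> times the mean of
      \<open>norm (Z n \<omega>)\<close>, at most \<open>\<epsilon> / 4\<close>. The added ones keep
      the denominator positive.\<close>
    define \<eta> where "\<eta> = min (1 / (4 * c)) (\<epsilon> / (16 * c\<^sup>2 * (norm a + 1) * (K + 1)))"
    have den: "0 < 16 * c\<^sup>2 * (norm a + 1) * (K + 1)" using c K(3) by (intro mult_pos_pos) (auto intro: add_nonneg_pos)
    have \<eta>: "0 < \<eta>" using c \<epsilon> den by (simp add: \<eta>_def)
    have c4: "0 < 4 * c" using c by simp
    have \<eta>1: "\<eta> * (4 * c) \<le> 1"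
      unfolding pos_le_divide_eq[OF c4, symmetric] \<eta>_def by (rule min.cobounded1)
    have \<eta>2: "\<eta> * (16 * c\<^sup>2 * (norm a + 1) * (K + 1)) \<le> \<epsilon>"
      unfolding pos_le_divide_eq[OF den, symmetric] \<eta>_def by (rule min.cobounded2)
    have \<eta>3: "(norm a + 1) * (4 * \<eta> * c\<^sup>2) * (K + 1) \<le> \<epsilon> / 4"
    proof -
      have "(norm a + 1) * (4 * \<eta> * c\<^sup>2) * (K + 1) = \<eta> * (16 * c\<^sup>2 * (norm a + 1) * (K + 1)) / 4"
        by simp
      then show ?thesis using \<eta>2 by linarith
    qed
    have ai: "a \<bullet> (?B *v z) = (?B *v a) \<bullet> z" for z
      by (metis dot_lmul_matrix tB transpose_matrix_vector)
    define N where "N n = bad \<eta> n \<union> {\<omega> \<in> space M. \<eta> \<le> \<Lambda> n \<omega>}" for n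
    have NM: "N n \<in> sets M" if "1 \<le> n" for n unfolding N_def using badM[OF that] by measurable
    have bd: "cmod (iexp (a \<bullet> U n \<omega>) - iexp ((- (?B *v a)) \<bullet> Z n \<omega>)) \<le> 2 * indicator (N n) \<omega> + norm a * (4 * \<eta> * c\<^sup>2) * norm (Z n \<omega>)"
      if \<omega>: "\<omega> \<in> space M" for n \<omega>
    proof (cases "\<omega> \<in> N n")
      case True
      have "cmod (iexp (a \<bullet> U n \<omega>) - iexp ((- (?B *v a)) \<bullet> Z n \<omega>)) \<le> 1 + 1"
        by (rule order_trans[OF norm_triangle_ineq4]) (simp only: norm_exp_i_times order_refl)
      moreover have "0 \<le> norm a * (4 * \<eta> * c\<^sup>2) * norm (Z n \<omega>)" using \<eta> by simp
      moreover have "2 * indicator (N n) \<omega> = (2 :: real)" using True by simp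
      ultimately show ?thesis by linarith
    next
      case False
      then have "\<Lambda> n \<omega> < \<eta>" "norm (V *v U n \<omega> + Z n \<omega>) \<le> (\<Lambda> n \<omega> + \<eta>) * norm (U n \<omega>)"
        using \<omega> by (auto simp: N_def bad_def not_less not_le)
      then have r: "norm (V *v U n \<omega> + Z n \<omega>) \<le> (2 * \<eta>) * norm (U n \<omega>)"
        by (elim order_trans) (intro mult_right_mono, auto)
      have BVU: "?B *v (V *v U n \<omega>) = U n \<omega>" by (simp add: matrix_vector_mul_assoc matrix_inv_mult[OF inv])
      have eq: "U n \<omega> + ?B *v Z n \<omega> = ?B *v (V *v U n \<omega> + Z n \<omega>)"
        by (simp add: matrix_vector_right_distrib BVU)
      have le: "norm (U n \<omega> + ?B *v Z n \<omega>) \<le> c * (2 * \<eta> * norm (U n \<omega>))"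
        unfolding eq by (rule order_trans[OF c(2)]) (intro mult_left_mono r, use c in auto)
      \<comment> \<open>Absorption: the term with \<open>\<eta>\<close> is at most half of the left
        side, whence the bound of \<open>U\<close> by a multiple of \<open>Z\<close>.\<close>
      have "norm (U n \<omega>) \<le> norm (U n \<omega> + ?B *v Z n \<omega>) + norm (?B *v Z n \<omega>)"
        using norm_triangle_ineq4[of "U n \<omega> + ?B *v Z n \<omega>" "?B *v Z n \<omega>"] by simp
      also have "\<dots> \<le> c * (2 * \<eta> * norm (U n \<omega>)) + c * norm (Z n \<omega>)" by (intro add_mono le c)
      also have "c * (2 * \<eta> * norm (U n \<omega>)) = (\<eta> * (4 * c)) * (norm (U n \<omega>) / 2)" by simp
      also have "\<dots> \<le> 1 * (norm (U n \<omega>) / 2)" by (intro mult_right_mono \<eta>1) auto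
      finally have nU: "norm (U n \<omega>) \<le> 2 * c * norm (Z n \<omega>)" by simp
      have "cmod (iexp (a \<bullet> U n \<omega>) - iexp ((- (?B *v a)) \<bullet> Z n \<omega>)) \<le> \<bar>a \<bullet> U n \<omega> - (- (?B *v a)) \<bullet> Z n \<omega>\<bar>"
        by (rule cmod_iexp_diff_le)
      also have "a \<bullet> U n \<omega> - (- (?B *v a)) \<bullet> Z n \<omega> = a \<bullet> (U n \<omega> + ?B *v Z n \<omega>)"
        by (simp add: inner_add_right ai)
      also have "\<bar>\<dots>\<bar> \<le> norm a * norm (U n \<omega> + ?B *v Z n \<omega>)" by (rule Cauchy_Schwarz_ineq2)
      also have "\<dots> \<le> norm a * (c * (2 * \<eta> * (2 * c * norm (Z n \<omega>))))"
        by (intro mult_left_mono order_trans[OF le] nU) (use c \<eta> in auto)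
      also have "\<dots> = norm a * (4 * \<eta> * c\<^sup>2) * norm (Z n \<omega>)" by (simp add: power2_eq_square)
      finally show ?thesis using False by simp
    qed
    have main: "cmod ((\<integral>\<omega>. iexp (a \<bullet> U n \<omega>) \<partial>M) - (\<integral>\<omega>. iexp ((- (?B *v a)) \<bullet> Z n \<omega>) \<partial>M)) \<le> 2 * prob (N n) + \<epsilon> / 4"
      if n: "1 \<le> n" for n
    proof -
      have [measurable]: "U n \<in> borel_measurable M" "N n \<in> sets M" using UM[OF n] NM[OF n] .
      have i1: "integrable M (\<lambda>\<omega>. iexp (a \<bullet> U n \<omega>))" "integrable M (\<lambda>\<omega>. iexp ((- (?B *v a)) \<bullet> Z n \<omega>))"
        by (rule integrable_const_bound[where B = 1]; simp del: inner_minus_left of_real_minus)+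
      have i2: "integrable M (\<lambda>\<omega>. 2 * indicator (N n) \<omega> + norm a * (4 * \<eta> * c\<^sup>2) * norm (Z n \<omega>))"
        by (intro Bochner_Integration.integrable_add integrable_mult_right integrable_real_indicator K(1)[OF n]) (auto simp: less_top[symmetric])
      have "cmod ((\<integral>\<omega>. iexp (a \<bullet> U n \<omega>) \<partial>M) - (\<integral>\<omega>. iexp ((- (?B *v a)) \<bullet> Z n \<omega>) \<partial>M))
         = cmod (\<integral>\<omega>. iexp (a \<bullet> U n \<omega>) - iexp ((- (?B *v a)) \<bullet> Z n \<omega>) \<partial>M)"
        using i1 by (subst Bochner_Integration.integral_diff) auto
      also have "\<dots> \<le> (\<integral>\<omega>. cmod (iexp (a \<bullet> U n \<omega>) - iexp ((- (?B *v a)) \<bullet> Z n \<omega>)) \<partial>M)"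
        by (rule integral_norm_bound)
      also have "\<dots> \<le> (\<integral>\<omega>. 2 * indicator (N n) \<omega> + norm a * (4 * \<eta> * c\<^sup>2) * norm (Z n \<omega>) \<partial>M)"
        by (intro integral_mono i2 bd integrable_norm Bochner_Integration.integrable_diff i1)
      also have "\<dots> = 2 * prob (N n) + norm a * (4 * \<eta> * c\<^sup>2) * (\<integral>\<omega>. norm (Z n \<omega>) \<partial>M)"
        using K(1)[OF n] by (subst Bochner_Integration.integral_add) (auto simp: less_top[symmetric])
      also have "\<dots> \<le> 2 * prob (N n) + (norm a + 1) * (4 * \<eta> * c\<^sup>2) * (K + 1)"
        using K(2)[OF n] K(3) \<eta> by (intro add_left_mono mult_mono) (auto intro: integral_nonneg_AE)
      also have "(norm a + 1) * (4 * \<eta> * c\<^sup>2) * (K + 1) \<le> \<epsilon> / 4" by (rule \<eta>3)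
      finally show ?thesis by simp
    qed
    \<comment> \<open>The exceptional set costs at most
      \<open>2 * (\<epsilon> / 8 + \<epsilon> / 8)\<close> and its complement
      \<open>\<epsilon> / 4\<close>, in total less than \<open>\<epsilon>\<close>.\<close>
    have \<epsilon>8: "0 < \<epsilon> / 8" using \<epsilon> by simp
    from order_tendstoD(2)[OF bad_lim[OF \<eta>] \<epsilon>8] order_tendstoD(2)[OF \<Lambda>_lim[OF \<eta>] \<epsilon>8]
    have "\<forall>\<^sub>F n in sequentially. norm ((\<integral>\<omega>. iexp (a \<bullet> U (Suc n) \<omega>) \<partial>M) - (\<integral>\<omega>. iexp ((- (?B *v a)) \<bullet> Z (Suc n) \<omega>) \<partial>M) - 0) < \<epsilon>"
    proof eventually_elim
      case (elim n)
      have "prob (N (Suc n)) \<le> prob (bad \<eta> (Suc n)) + prob {\<omega> \<in> space M. \<eta> \<le> \<Lambda> (Suc n) \<omega>}"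
        unfolding N_def using badM[of "Suc n" \<eta>] by (intro measure_Un_le) auto
      then show ?case using elim main[of "Suc n"] \<epsilon> by simp
    qed
    then show "\<exists>n0. \<forall>n\<ge>n0. norm ((\<integral>\<omega>. iexp (a \<bullet> U (Suc n) \<omega>) \<partial>M) - (\<integral>\<omega>. iexp ((- (?B *v a)) \<bullet> Z (Suc n) \<omega>) \<partial>M) - 0) < \<epsilon>"
      by (simp add: eventually_sequentially)
  qed
  have lim: "(\<lambda>n. \<integral>\<omega>. iexp (a \<bullet> U (Suc n) \<omega>) \<partial>M) \<longlonglongrightarrow> complex_of_real (exp (- (a \<bullet> ((?B ** W ** ?B) *v a)) / 2))" for a
  proof -
    have "(\<lambda>n. \<integral>\<omega>. iexp ((- (?B *v a)) \<bullet> Z n \<omega>) \<partial>M) \<longlonglongrightarrow> exp (- ((- (?B *v a)) \<bullet> (W *v (- (?B *v a)))) / 2)"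
      unfolding Z_def by (rule score_char[OF D D4 D0 Dlim])
    also have "(- (?B *v a)) \<bullet> (W *v (- (?B *v a))) = a \<bullet> ((?B ** W ** ?B) *v a)"
    proof -
      have "(?B *v a) \<bullet> (W *v (?B *v a)) = a \<bullet> (?B *v (W *v (?B *v a)))"
        by (metis dot_lmul_matrix tB transpose_matrix_vector)
      then show ?thesis by (simp add: linear_neg[OF matrix_vector_mul_linear] matrix_vector_mul_assoc matrix_mul_assoc)
    qed
    finally have "(\<lambda>n. \<integral>\<omega>. iexp ((- (?B *v a)) \<bullet> Z (Suc n) \<omega>) \<partial>M) \<longlonglongrightarrow> complex_of_real (exp (- (a \<bullet> ((?B ** W ** ?B) *v a)) / 2))"
      by (rule LIMSEQ_Suc)
    from tendsto_add[OF slutsky[of a] this] show ?thesis by simp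
  qed
  have "weakly_converges (\<lambda>n. distr M borel (U (Suc n))) (mvnormal 0 (?B ** W ** ?B))"
  proof (rule levy_continuity_vec)
    show "prob_space (distr M borel (U (Suc n)))" for n by (rule prob_space_distr[OF UM]) simp
    show "prob_space (mvnormal 0 (?B ** W ** ?B))" by (rule prob_space_mvnormal[OF pA])
    show "(\<lambda>n. \<integral>y. iexp (a \<bullet> y) \<partial>distr M borel (U (Suc n))) \<longlonglongrightarrow> (\<integral>y. iexp (a \<bullet> y) \<partial>mvnormal 0 (?B ** W ** ?B))" for a
    proof -
      have "(\<integral>y. iexp (a \<bullet> y) \<partial>distr M borel (U (Suc n))) = (\<integral>\<omega>. iexp (a \<bullet> U (Suc n) \<omega>) \<partial>M)" for n
        by (rule integral_distr[OF UM]) auto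
      then show ?thesis using lim[of a] unfolding char_mvnormal[OF pA] by simp
    qed
  qed (simp_all add: mvnormal_def)
  then show ?thesis
    unfolding weakly_converges_def U_def by (auto intro: LIMSEQ_imp_Suc)
qed

end

section \<open>Expansion of the score\<close>

text \<open>A finite limsup bounds the suprema from some \<open>n\<close> on by a real
  \<open>K\<close>. The strict inequality in the supremum is met by
  \<open>\<Delta> = 2 * norm (\<theta> - \<theta>0)\<close>, at the price of a factor 2 in the
  constant and of half the radius. At \<open>\<theta> = \<theta>0\<close> this
  \<open>\<Delta>\<close> is not positive; there the segment is a point and \<open>f0\<close>
  decides.\<close>

lemma limsup_SUP_bound:
  fixes f :: "nat \<Rightarrow> real ^ 'm \<Rightarrow> real"
  assumes "\<exists>\<delta>>0. limsup (\<lambda>n. SUP \<Delta>\<in>{0<..<\<delta>}.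
        SUP \<theta>s\<in>{\<theta>s. \<exists>\<theta>. norm (\<theta> - \<theta>0) < \<Delta> \<and> \<theta>s \<in> closed_segment \<theta>0 \<theta>}.
          ereal (1 / (real n * \<Delta>) * \<bar>f n \<theta>s\<bar>)) < \<infinity>"
    and f0: "\<And>n. f n \<theta>0 = 0"
  obtains \<delta> K where "0 < \<delta>" "\<forall>\<^sub>F n in sequentially. \<forall>\<theta> \<xi>. norm (\<theta> - \<theta>0) < \<delta> \<longrightarrow> \<xi> \<in> closed_segment \<theta>0 \<theta> \<longrightarrow>
      \<bar>f n \<xi>\<bar> / real n \<le> K * norm (\<theta> - \<theta>0)"
proof -
  obtain \<delta> where \<delta>: "0 < \<delta>" and lim: "limsup (\<lambda>n. SUP \<Delta>\<in>{0<..<\<delta>}.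
        SUP \<theta>s\<in>{\<theta>s. \<exists>\<theta>. norm (\<theta> - \<theta>0) < \<Delta> \<and> \<theta>s \<in> closed_segment \<theta>0 \<theta>}.
          ereal (1 / (real n * \<Delta>) * \<bar>f n \<theta>s\<bar>)) < \<infinity>" (is "limsup ?s < _")
    using assms(1) by blast
  obtain K where K: "limsup ?s < ereal K" using ereal_dense2[OF lim] by blast
  have "\<forall>\<^sub>F n in sequentially. ?s n < ereal K" by (rule Limsup_lessD[OF K])
  with eventually_ge_at_top[of 1]
  have "\<forall>\<^sub>F n in sequentially. \<forall>\<theta> \<xi>. norm (\<theta> - \<theta>0) < \<delta> / 2 \<longrightarrow> \<xi> \<in> closed_segment \<theta>0 \<theta> \<longrightarrow>
      \<bar>f n \<xi>\<bar> / real n \<le> (2 * K) * norm (\<theta> - \<theta>0)"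
  proof eventually_elim
    case (elim n)
    show ?case
    proof (intro allI impI)
      fix \<theta> \<xi> assume \<theta>: "norm (\<theta> - \<theta>0) < \<delta> / 2" and \<xi>: "\<xi> \<in> closed_segment \<theta>0 \<theta>"
      show "\<bar>f n \<xi>\<bar> / real n \<le> (2 * K) * norm (\<theta> - \<theta>0)"
      proof (cases "\<theta> = \<theta>0")
        case True then show ?thesis using \<xi> f0 by simp
      next
        case False
        define \<Delta> where "\<Delta> = 2 * norm (\<theta> - \<theta>0)"
        have \<Delta>: "0 < \<Delta>" "\<Delta> < \<delta>" "norm (\<theta> - \<theta>0) < \<Delta>" using False \<theta> by (auto simp: \<Delta>_def)
        have "ereal (1 / (real n * \<Delta>) * \<bar>f n \<xi>\<bar>)
          \<le> (SUP \<theta>s\<in>{\<theta>s. \<exists>\<theta>. norm (\<theta> - \<theta>0) < \<Delta> \<and> \<theta>s \<in> closed_segment \<theta>0 \<theta>}. ereal (1 / (real n * \<Delta>) * \<bar>f n \<theta>s\<bar>))"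
          by (rule SUP_upper) (use \<Delta> \<xi> in auto)
        also have "\<dots> \<le> ?s n" by (rule SUP_upper) (use \<Delta> in auto)
        also have "\<dots> < ereal K" by (rule elim(2))
        finally have "1 / (real n * \<Delta>) * \<bar>f n \<xi>\<bar> < K" by simp
        then have "\<bar>f n \<xi>\<bar> / real n / \<Delta> < K" by simp
        then have "\<bar>f n \<xi>\<bar> / real n < K * \<Delta>" unfolding pos_divide_less_eq[OF \<Delta>(1)] .
        then show ?thesis by (simp add: \<Delta>_def)
      qed
    qed
  qed
  with \<delta> show ?thesis using that[of "\<delta> / 2" "2 * K"] by simp
qed

text \<open>The mean value theorem is applied to each component of the score between
  \<open>\<theta>0\<close> and the estimator, where the score vanishes. The Hessian average at the
  intermediate point differs from \<open>V\<close> by three terms: the averages of the conditional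
  Hessians \<open>C\<close> against their limit, the centered Hessians at \<open>\<theta>0\<close>,
  and the variation of the Hessian along the segment, which \<open>d\<close> bounds by a multiple of
  the error.\<close>

lemma score_expansion:
  fixes \<alpha> :: "nat \<Rightarrow> real ^ 'm \<Rightarrow> real" and C :: "nat \<Rightarrow> 'm \<Rightarrow> 'm \<Rightarrow> real" and V :: "real ^ 'm ^ 'm"
    and est :: "nat \<Rightarrow> real ^ 'm" and q :: "nat \<Rightarrow> real"
  assumes r: "0 < r" and \<alpha>: "\<And>t. 1 \<le> t \<Longrightarrow> D2_on (ball \<theta>0 r) (\<alpha> t)"
    and est: "est \<longlonglongrightarrow> \<theta>0"
    and stat: "\<And>n i. n0 < n \<Longrightarrow> partial i (\<lambda>\<theta>. 1 / 2 * (\<Sum>t=1..n. \<alpha> t \<theta>) + q n) (est n) = 0"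
    and d: "\<And>i j. \<exists>\<delta>>0. limsup (\<lambda>n. SUP \<Delta>\<in>{0<..<\<delta>}.
        SUP \<theta>s\<in>{\<theta>s. \<exists>\<theta>. norm (\<theta> - \<theta>0) < \<Delta> \<and> \<theta>s \<in> closed_segment \<theta>0 \<theta>}.
          ereal (1 / (real n * \<Delta>) * \<bar>\<Sum>t=1..n. partial i (partial j (\<alpha> t)) \<theta>s - partial i (partial j (\<alpha> t)) \<theta>0\<bar>)) < \<infinity>"
    and c: "\<And>i j. (\<lambda>n. 1 / (2 * real n) * (\<Sum>t=1..n. C t i j)) \<longlonglongrightarrow> V $ i $ j"
    and V: "transpose V = V"
  shows "small_remainder V (\<lambda>t. \<chi> i. partial i (\<alpha> t) \<theta>0)
    (\<lambda>t i j. partial i (partial j (\<alpha> t)) \<theta>0 - C t i j) (\<lambda>n. est n - \<theta>0)"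
proof -
  let ?h = "\<lambda>t i j \<xi>. partial i (partial j (\<alpha> t)) \<xi>"
  let ?U = "ball \<theta>0 r"
  define lip where "lip i j \<delta> K \<longleftrightarrow> (\<forall>\<^sub>F n in sequentially. \<forall>\<theta> \<xi>. norm (\<theta> - \<theta>0) < \<delta> \<longrightarrow> \<xi> \<in> closed_segment \<theta>0 \<theta> \<longrightarrow>
      \<bar>\<Sum>t=1..n. ?h t i j \<xi> - ?h t i j \<theta>0\<bar> / real n \<le> K * norm (\<theta> - \<theta>0))" for i j \<delta> K
  have "\<exists>\<delta> K. 0 < \<delta> \<and> lip i j \<delta> K" for i j
    unfolding lip_def by (rule limsup_SUP_bound[OF d[of i j]]) auto
  then obtain \<delta> K where \<delta>: "\<And>i j. 0 < \<delta> i j" and K: "\<And>i j. lip i j (\<delta> i j) (K i j)"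
    by metis
  note K = K[unfolded lip_def]
  define u where "u = (\<lambda>n. est n - \<theta>0)"
  have u0: "u \<longlonglongrightarrow> 0" using est unfolding u_def by (simp add: LIM_zero)
  have nu0: "(\<lambda>n. norm (u n)) \<longlonglongrightarrow> 0" using u0 by (rule tendsto_norm_zero)
  \<comment> \<open>Everything that tends to zero on this path: the deviation of the averages of
    \<open>C\<close> from \<open>V\<close> and the Lipschitz terms.\<close>
  define b where "b = (\<lambda>n. \<Sum>i\<in>UNIV. \<Sum>j\<in>UNIV. \<bar>V $ i $ j - 1 / (2 * real n) * (\<Sum>t=1..n. C t i j)\<bar> + K i j * norm (u n))"
  have "b \<longlonglongrightarrow> (\<Sum>i\<in>UNIV. \<Sum>j\<in>UNIV. \<bar>V $ i $ j - V $ i $ j\<bar> + K i j * 0)"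
    unfolding b_def by (intro tendsto_sum tendsto_add tendsto_rabs tendsto_diff tendsto_mult tendsto_const c nu0)
  then have b: "b \<longlonglongrightarrow> 0" by simp
  have ev\<delta>: "\<forall>\<^sub>F n in sequentially. \<forall>i j. norm (u n) < \<delta> i j"
    by (intro eventually_all_finite order_tendstoD(2)[OF nu0] \<delta>)
  have evK: "\<forall>\<^sub>F n in sequentially. \<forall>i j. \<forall>\<theta> \<xi>. norm (\<theta> - \<theta>0) < \<delta> i j \<longrightarrow> \<xi> \<in> closed_segment \<theta>0 \<theta> \<longrightarrow>
      \<bar>\<Sum>t=1..n. ?h t i j \<xi> - ?h t i j \<theta>0\<bar> / real n \<le> K i j * norm (\<theta> - \<theta>0)"
    by (intro eventually_all_finite K)
  have evr: "\<forall>\<^sub>F n in sequentially. norm (u n) < r" by (rule order_tendstoD(2)[OF nu0 r])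
  have "\<forall>\<^sub>F n in sequentially.
      norm (V *v u n + (1 / (2 * real n)) *\<^sub>R (\<Sum>t=1..n. \<chi> i. partial i (\<alpha> t) \<theta>0))
      \<le> ((\<Sum>i\<in>UNIV. \<Sum>j\<in>UNIV. \<bar>\<Sum>t=1..n. ?h t i j \<theta>0 - C t i j\<bar> / real n) + b n) * norm (u n)"
    using ev\<delta> evK evr eventually_gt_at_top[of n0] eventually_ge_at_top[of 1]
  proof eventually_elim
    case (elim n)
    have n: "0 < real n" using elim(5) by simp
    have estU: "est n \<in> ?U" using elim(3) by (simp add: u_def dist_norm norm_minus_commute)
    have comp: "\<bar>(V *v u n) $ i + 1 / (2 * real n) * (\<Sum>t=1..n. partial i (\<alpha> t) \<theta>0)\<bar>
      \<le> (\<Sum>j\<in>UNIV. \<bar>\<Sum>t=1..n. ?h t j i \<theta>0 - C t j i\<bar> / real n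
            + (\<bar>V $ j $ i - 1 / (2 * real n) * (\<Sum>t=1..n. C t j i)\<bar> + K j i * norm (u n))) * norm (u n)" for i
    proof -
      let ?G = "\<lambda>\<theta>. \<Sum>t=1..n. partial i (\<alpha> t) \<theta>"
      have Gd: "?G differentiable (at \<xi>)" if "\<xi> \<in> ?U" for \<xi>
        using that \<alpha> by (intro differentiable_sum ballI D2_onD(2)) auto
      have \<alpha>d: "\<alpha> t differentiable (at \<xi>)" if "\<xi> \<in> ?U" "t \<in> {1..n}" for \<xi> t
        using that \<alpha> by (intro D2_onD(1)) auto
      have "partial i (\<lambda>\<theta>. 1 / 2 * (\<Sum>t=1..n. \<alpha> t \<theta>) + q n) (est n) = 1 / 2 * ?G (est n)"
      proof -
        have sd: "(\<lambda>\<theta>. \<Sum>t=1..n. \<alpha> t \<theta>) differentiable (at (est n))"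
          using estU \<alpha>d by (intro differentiable_sum) auto
        have "partial i (\<lambda>\<theta>. 1 / 2 * (\<Sum>t=1..n. \<alpha> t \<theta>) + q n) (est n) = partial i (\<lambda>\<theta>. (\<Sum>t=1..n. \<alpha> t \<theta>) * (1 / 2)) (est n)"
          using sd by (subst partial_add) (auto intro!: differentiable_mult simp: mult.commute)
        also have "\<dots> = partial i (\<lambda>\<theta>. \<Sum>t=1..n. \<alpha> t \<theta>) (est n) * (1 / 2)"
          by (rule partial_mult_const[OF sd])
        also have "partial i (\<lambda>\<theta>. \<Sum>t=1..n. \<alpha> t \<theta>) (est n) = ?G (est n)"
          by (rule partial_sum) (use estU \<alpha>d in auto)
        finally show ?thesis by simp
      qed
      then have G0: "?G (est n) = 0" using stat[OF elim(4), of i] by simp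
      have seg: "closed_segment \<theta>0 (est n) \<subseteq> ?U"
        using estU r by (intro closed_segment_subset) auto
      obtain \<xi> where \<xi>: "\<xi> \<in> closed_segment \<theta>0 (est n)"
        and mv: "?G (est n) - ?G \<theta>0 = (\<Sum>j\<in>UNIV. u n $ j * partial j ?G \<xi>)"
        unfolding u_def by (rule mvt_partial[of \<theta>0 "est n" ?G]) (use Gd seg in auto)
      have pG: "partial j ?G \<xi> = (\<Sum>t=1..n. ?h t j i \<xi>)" for j
        by (rule partial_sum) (use \<xi> seg \<alpha> in \<open>auto intro: D2_onD(2)\<close>)
      \<comment> \<open>Symmetry of \<open>V\<close> matches its entries with the order
        \<open>j\<close>, \<open>i\<close> of differentiation.\<close>
      have Vu: "(V *v u n) $ i = (\<Sum>j\<in>UNIV. u n $ j * V $ j $ i)"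
        by (subst V[symmetric]) (simp add: matrix_vector_mult_def transpose_def mult.commute)
      have lin: "c * - (\<Sum>j\<in>UNIV. v j * H j) = - (\<Sum>j\<in>UNIV. v j * (c * H j))"
        for c :: real and v H :: "'m \<Rightarrow> real"
        by (simp add: sum_distrib_left mult.left_commute)
      have g: "?G \<theta>0 = - (\<Sum>j\<in>UNIV. u n $ j * (\<Sum>t=1..n. ?h t j i \<xi>))"
        using mv unfolding G0 pG by linarith
      have "1 / (2 * real n) * ?G \<theta>0 = - (\<Sum>j\<in>UNIV. u n $ j * (1 / (2 * real n) * (\<Sum>t=1..n. ?h t j i \<xi>)))"
        unfolding g by (rule lin)
      then have "(V *v u n) $ i + 1 / (2 * real n) * ?G \<theta>0
          = (\<Sum>j\<in>UNIV. u n $ j * (V $ j $ i - 1 / (2 * real n) * (\<Sum>t=1..n. ?h t j i \<xi>)))"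
        unfolding Vu by (simp only: right_diff_distrib sum_subtractf)
      also have "\<bar>\<dots>\<bar> \<le> (\<Sum>j\<in>UNIV. \<bar>u n $ j * (V $ j $ i - 1 / (2 * real n) * (\<Sum>t=1..n. ?h t j i \<xi>))\<bar>)"
        by (rule sum_abs)
      also have "\<dots> \<le> (\<Sum>j\<in>UNIV. norm (u n) * (\<bar>\<Sum>t=1..n. ?h t j i \<theta>0 - C t j i\<bar> / real n
            + (\<bar>V $ j $ i - 1 / (2 * real n) * (\<Sum>t=1..n. C t j i)\<bar> + K j i * norm (u n))))"
      proof (rule sum_mono)
        fix j
        define A where "A = (\<Sum>t=1..n. ?h t j i \<theta>0 - C t j i)"
        define R where "R = (\<Sum>t=1..n. ?h t j i \<xi> - ?h t j i \<theta>0)"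
        have eq: "V $ j $ i - 1 / (2 * real n) * (\<Sum>t=1..n. ?h t j i \<xi>)
          = (V $ j $ i - 1 / (2 * real n) * (\<Sum>t=1..n. C t j i)) - A / real n / 2 - R / real n / 2"
          unfolding A_def R_def using n by (simp add: sum_subtractf field_simps)
        have R: "\<bar>R\<bar> / real n \<le> K j i * norm (u n)"
          using elim(1,2) \<xi> unfolding R_def u_def by blast
        have R0: "0 \<le> \<bar>R\<bar> / real n" "0 \<le> \<bar>A\<bar> / real n" using n by auto
        have abs: "\<bar>A / real n / 2\<bar> = \<bar>A\<bar> / real n / 2" "\<bar>R / real n / 2\<bar> = \<bar>R\<bar> / real n / 2" using n by auto
        have "\<bar>V $ j $ i - 1 / (2 * real n) * (\<Sum>t=1..n. ?h t j i \<xi>)\<bar>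
          \<le> \<bar>V $ j $ i - 1 / (2 * real n) * (\<Sum>t=1..n. C t j i)\<bar> + \<bar>A / real n / 2\<bar> + \<bar>R / real n / 2\<bar>"
          unfolding eq by linarith
        also have "\<dots> \<le> \<bar>A\<bar> / real n + (\<bar>V $ j $ i - 1 / (2 * real n) * (\<Sum>t=1..n. C t j i)\<bar> + K j i * norm (u n))"
        proof -
          have "x + a / 2 + s / 2 \<le> a + (x + k)" if "s \<le> k" "0 \<le> s" "0 \<le> a" for x a s k :: real
            using that by linarith
          from this[OF R R0] show ?thesis unfolding abs .
        qed
        finally show "\<bar>u n $ j * (V $ j $ i - 1 / (2 * real n) * (\<Sum>t=1..n. ?h t j i \<xi>))\<bar>
          \<le> norm (u n) * (\<bar>\<Sum>t=1..n. ?h t j i \<theta>0 - C t j i\<bar> / real n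
            + (\<bar>V $ j $ i - 1 / (2 * real n) * (\<Sum>t=1..n. C t j i)\<bar> + K j i * norm (u n)))"
          unfolding abs_mult A_def by (intro mult_mono component_le_norm_cart) auto
      qed
      finally show ?thesis by (simp add: sum_distrib_left[symmetric] mult.commute)
    qed
    have "norm (V *v u n + (1 / (2 * real n)) *\<^sub>R (\<Sum>t=1..n. \<chi> i. partial i (\<alpha> t) \<theta>0))
      \<le> (\<Sum>i\<in>UNIV. \<bar>(V *v u n + (1 / (2 * real n)) *\<^sub>R (\<Sum>t=1..n. \<chi> i. partial i (\<alpha> t) \<theta>0)) $ i\<bar>)"
      by (rule norm_le_l1_cart)
    also have "\<dots> = (\<Sum>i\<in>UNIV. \<bar>(V *v u n) $ i + 1 / (2 * real n) * (\<Sum>t=1..n. partial i (\<alpha> t) \<theta>0)\<bar>)"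
      by (simp only: vector_add_component vector_scaleR_component sum_component vec_lambda_beta real_scaleR_def)
    also have "\<dots> \<le> (\<Sum>i\<in>UNIV. (\<Sum>j\<in>UNIV. \<bar>\<Sum>t=1..n. ?h t j i \<theta>0 - C t j i\<bar> / real n
            + (\<bar>V $ j $ i - 1 / (2 * real n) * (\<Sum>t=1..n. C t j i)\<bar> + K j i * norm (u n))) * norm (u n))"
      by (rule sum_mono[OF comp])
    also have "\<dots> = (\<Sum>j\<in>UNIV. \<Sum>i\<in>UNIV. \<bar>\<Sum>t=1..n. ?h t j i \<theta>0 - C t j i\<bar> / real n
            + (\<bar>V $ j $ i - 1 / (2 * real n) * (\<Sum>t=1..n. C t j i)\<bar> + K j i * norm (u n))) * norm (u n)"
      unfolding sum_distrib_right[symmetric] by (subst sum.swap) simp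
    also have "(\<Sum>j\<in>UNIV. \<Sum>i\<in>UNIV. \<bar>\<Sum>t=1..n. ?h t j i \<theta>0 - C t j i\<bar> / real n
            + (\<bar>V $ j $ i - 1 / (2 * real n) * (\<Sum>t=1..n. C t j i)\<bar> + K j i * norm (u n)))
       = (\<Sum>i\<in>UNIV. \<Sum>j\<in>UNIV. \<bar>\<Sum>t=1..n. ?h t i j \<theta>0 - C t i j\<bar> / real n) + b n"
      unfolding b_def by (simp only: sum.distrib)
    finally show ?case .
  qed
  with b show ?thesis unfolding u_def small_remainder_def by blast
qed

section \<open>The score as a martingale difference\<close>

text \<open>Altering a function on a null set keeps it measurable for the completion. Thus
  \<open>grad_alpha\<close> and \<open>hess_alpha\<close> themselves become measurable once they
  agree almost everywhere with adapted versions.\<close>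

lemma borel_measurable_cong_completion:
  fixes f g :: "'a \<Rightarrow> 'b::topological_space"
  assumes "f \<in> borel_measurable (completion M)" "AE \<omega> in completion M. f \<omega> = g \<omega>"
  shows "g \<in> borel_measurable (completion M)"
proof (rule measurableI)
  fix A :: "'b set" assume A: "A \<in> sets borel"
  show "g -` A \<inter> space (completion M) \<in> sets (completion M)"
  proof (rule completion.in_sets_AE)
    show "AE \<omega> in completion M. \<omega> \<in> f -` A \<inter> space (completion M) \<longleftrightarrow> \<omega> \<in> g -` A \<inter> space (completion M)"
      using assms(2) by eventually_elim auto
  qed (use measurable_sets[OF assms(1) A] in auto)
qed simp

lemma borel_measurable_det:
  fixes A :: "'a \<Rightarrow> real ^ 'r ^ 'r"
  assumes [measurable]: "\<And>i j. (\<lambda>\<omega>. A \<omega> $ i $ j) \<in> borel_measurable G"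
  shows "(\<lambda>\<omega>. det (A \<omega>)) \<in> borel_measurable G"
  unfolding det_def by measurable

lemma borel_measurable_inv_entry:
  fixes A :: "'a \<Rightarrow> real ^ 'r ^ 'r"
  assumes A: "\<And>i j. (\<lambda>\<omega>. A \<omega> $ i $ j) \<in> borel_measurable G"
  shows "(\<lambda>\<omega>. inv_entry (A \<omega>) k l) \<in> borel_measurable G"
proof -
  have "(\<lambda>\<omega>. (\<chi> i j. if j = k then of_bool (i = l) else A \<omega> $ i $ j) $ i $ j) \<in> borel_measurable G" for i j
    using A by (cases "j = k") auto
  from borel_measurable_det[OF this] borel_measurable_det[OF A] show ?thesis
    unfolding inv_entry_def by measurable
qed

lemma borel_measurable_qcoef:
  fixes A :: "'a \<Rightarrow> real ^ 'r ^ 'r" and u :: "'a \<Rightarrow> real ^ 'r"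
  assumes A: "\<And>i j. (\<lambda>\<omega>. A \<omega> $ i $ j) \<in> borel_measurable G"
    and u[measurable]: "\<And>k. (\<lambda>\<omega>. u \<omega> $ k) \<in> borel_measurable G"
  shows "(\<lambda>\<omega>. qcoef (u \<omega>) (A \<omega>) a b) \<in> borel_measurable G"
proof -
  have [measurable]: "(\<lambda>\<omega>. inv_entry (A \<omega>) k l) \<in> borel_measurable G" "(\<lambda>\<omega>. det (A \<omega>)) \<in> borel_measurable G" for k l
    by (rule borel_measurable_inv_entry[OF A], rule borel_measurable_det[OF A])
  show ?thesis by (cases a; cases b; simp add: qcoef_def; measurable)
qed

text \<open>If \<open>v \<bullet> (A *v v)\<close> vanished, moving from \<open>v\<close> against
  \<open>w = A *v v\<close> would give the form the value
  \<open>- 2 * s * (w \<bullet> w) + s\<^sup>2 * p\<close>, negative for small \<open>s > 0\<close>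
  because invertibility makes \<open>w\<close> nonzero.\<close>

lemma psd_invertible_imp_pos_def:
  fixes A :: "real ^ 'n ^ 'n"
  assumes sym: "transpose A = A" and psd: "\<And>v. 0 \<le> v \<bullet> (A *v v)" and inv: "invertible A"
  shows "pos_def A"
  unfolding pos_def_def
proof (intro conjI allI impI sym)
  fix v :: "real ^ 'n" assume v: "v \<noteq> 0"
  have symi: "x \<bullet> (A *v y) = y \<bullet> (A *v x)" for x y
    by (metis dot_lmul_matrix inner_commute sym transpose_matrix_vector)
  show "0 < v \<bullet> (A *v v)"
  proof (rule ccontr)
    assume "\<not> 0 < v \<bullet> (A *v v)"
    then have z: "v \<bullet> (A *v v) = 0" using psd[of v] by simp
    define w where "w = A *v v"
    define p where "p = w \<bullet> (A *v w)"
    have p0: "0 \<le> p" unfolding p_def by (rule psd)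
    have ww: "w \<noteq> 0"
    proof
      assume "w = 0"
      then have "matrix_inv A *v (A *v v) = 0" by (simp add: w_def)
      then show False using v by (simp add: matrix_vector_mul_assoc matrix_inv_mult[OF inv])
    qed
    have lin: "2 * s * (w \<bullet> w) \<le> s\<^sup>2 * p" if "0 < s" for s
    proof -
      have "0 \<le> (v + (- s) *\<^sub>R w) \<bullet> (A *v (v + (- s) *\<^sub>R w))" by (rule psd)
      also have "\<dots> = - 2 * s * (w \<bullet> w) + s\<^sup>2 * p"
        using z symi[of v w]
        by (simp add: matrix_vector_right_distrib linear_scale[OF matrix_vector_mul_linear] inner_add_left inner_add_right
            linear_neg[OF matrix_vector_mul_linear] matrix_vector_mult_diff_distrib inner_diff_left inner_diff_right
            w_def[symmetric] p_def[symmetric] power2_eq_square algebra_simps)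
      finally show ?thesis by simp
    qed
    have wp: "0 < w \<bullet> w" using ww by simp
    \<comment> \<open>Chosen so that \<open>s * p \<le> w \<bullet> w\<close>, against
      \<open>lin\<close>; the summand 1 covers \<open>p = 0\<close>.\<close>
    define s where "s = (w \<bullet> w) / (p + 1)"
    have s: "0 < s" using wp p0 by (simp add: s_def)
    have "s * (2 * (w \<bullet> w)) \<le> s * (s * p)"
      using lin[OF s] by (simp only: power2_eq_square mult.assoc mult.left_commute)
    then have "2 * (w \<bullet> w) \<le> s * p" using s by (simp only: mult_le_cancel_left_pos)
    also have "\<dots> \<le> w \<bullet> w"
      using wp p0 by (simp add: s_def divide_le_eq)
    finally show False using wp by simp
  qed
qed

lemma pos_def_det_pos: "pos_def A \<Longrightarrow> 0 < det A"
proof -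
  assume "pos_def A"
  then obtain C where "det C \<noteq> 0" "A = C ** transpose C" by (rule pos_def_factor)
  then show ?thesis by (simp add: det_mul zero_less_mult_iff) linarith
qed

text \<open>Intermediate values. This carries positivity of the determinant from
  \<open>\<theta>0\<close> to nearby parameters, where almost surely under the true law only
  invertibility and smoothness of the covariance version are given.\<close>

lemma continuous_nonzero_pos:
  fixes f :: "'b::topological_space \<Rightarrow> real"
  assumes "connected U" "continuous_on U f" "\<And>x. x \<in> U \<Longrightarrow> f x \<noteq> 0" "x0 \<in> U" "0 < f x0" "x \<in> U"
  shows "0 < f x"
proof (rule ccontr)
  assume "\<not> 0 < f x"
  moreover have "connected (f ` U)" by (rule connected_continuous_image[OF assms(2,1)])
  ultimately have "{f x..f x0} \<subseteq> f ` U" using assms by (intro connected_contains_Icc) auto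
  then have "0 \<in> f ` U" using \<open>\<not> 0 < f x\<close> assms(5) by auto
  then show False using assms(3) by auto
qed

text \<open>Almost sure positive semidefiniteness is checked on a countable dense set of directions.\<close>

lemma (in sigma_finite_subalgebra) cond_second_moment_psd:
  fixes e :: "'a \<Rightarrow> real ^ 'r" and S :: "'a \<Rightarrow> real ^ 'r ^ 'r"
  assumes e[measurable]: "e \<in> borel_measurable M" and ee: "\<And>k l. integrable M (\<lambda>\<omega>. e \<omega> $ k * e \<omega> $ l)"
    and S: "\<And>k l. AE \<omega> in M. S \<omega> $ k $ l = real_cond_exp M F (\<lambda>\<omega>. e \<omega> $ k * e \<omega> $ l) \<omega>"
  shows "AE \<omega> in M. transpose (S \<omega>) = S \<omega> \<and> (\<forall>v. 0 \<le> v \<bullet> (S \<omega> *v v))"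
proof -
  obtain Q :: "(real ^ 'r) set" where Q: "countable Q" "\<And>X. open X \<Longrightarrow> X \<noteq> {} \<Longrightarrow> \<exists>v\<in>Q. v \<in> X"
    by (rule countable_dense_setE) blast
  have all: "AE \<omega> in M. \<forall>k l. S \<omega> $ k $ l = real_cond_exp M F (\<lambda>\<omega>. e \<omega> $ k * e \<omega> $ l) \<omega>"
    unfolding AE_all_countable using S by blast
  have "AE \<omega> in M. 0 \<le> v \<bullet> (S \<omega> *v v)" for v
  proof -
    have eq: "(v \<bullet> e \<omega>)\<^sup>2 = (\<Sum>p\<in>UNIV. (v $ fst p * v $ snd p) * (e \<omega> $ fst p * e \<omega> $ snd p))" for \<omega>
    proof -
      have "(v \<bullet> e \<omega>)\<^sup>2 = (\<Sum>i\<in>UNIV. \<Sum>j\<in>UNIV. (v $ i * e \<omega> $ i) * (v $ j * e \<omega> $ j))"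
        by (simp add: inner_vec_def power2_eq_square sum_product)
      also have "\<dots> = (\<Sum>p\<in>UNIV. (v $ fst p * v $ snd p) * (e \<omega> $ fst p * e \<omega> $ snd p))"
        unfolding sum_UNIV_pair by (rule sum.cong) auto
      finally show ?thesis .
    qed
    have "AE \<omega> in M. real_cond_exp M F (\<lambda>\<omega>. (v \<bullet> e \<omega>)\<^sup>2) \<omega>
      = (\<Sum>p\<in>UNIV. (v $ fst p * v $ snd p) * real_cond_exp M F (\<lambda>\<omega>. e \<omega> $ fst p * e \<omega> $ snd p) \<omega>)"
      by (rule real_cond_exp_linear_comb) (use ee eq in auto)
    moreover have "AE \<omega> in M. 0 \<le> real_cond_exp M F (\<lambda>\<omega>. (v \<bullet> e \<omega>)\<^sup>2) \<omega>"
      by (rule real_cond_exp_pos) auto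
    ultimately show ?thesis using all
    proof eventually_elim
      case (elim \<omega>)
      have "v \<bullet> (S \<omega> *v v) = (\<Sum>i\<in>UNIV. \<Sum>j\<in>UNIV. v $ i * v $ j * S \<omega> $ i $ j)"
        by (simp add: inner_vec_def matrix_vector_mult_def sum_distrib_left mult_ac)
      also have "\<dots> = (\<Sum>p\<in>UNIV. (v $ fst p * v $ snd p) * real_cond_exp M F (\<lambda>\<omega>. e \<omega> $ fst p * e \<omega> $ snd p) \<omega>)"
        unfolding sum_UNIV_pair using elim(3) by simp
      finally show ?case using elim(1,2) by simp
    qed
  qed
  then have "AE \<omega> in M. \<forall>v\<in>Q. 0 \<le> v \<bullet> (S \<omega> *v v)" using Q(1) by (subst AE_ball_countable) auto
  with all show ?thesis
  proof eventually_elim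
    case (elim \<omega>)
    have sym: "transpose (S \<omega>) = S \<omega>" using elim(1) by (simp add: vec_eq_iff transpose_def mult.commute)
    have c: "continuous_on UNIV (\<lambda>v. v \<bullet> (S \<omega> *v v))"
      by (intro continuous_on_inner continuous_on_id matrix_vector_mult_linear_continuous_on)
    have "0 \<le> v \<bullet> (S \<omega> *v v)" for v
    proof (rule ccontr)
      assume "\<not> 0 \<le> v \<bullet> (S \<omega> *v v)"
      then have "{v. v \<bullet> (S \<omega> *v v) < 0} \<noteq> {}" by (auto simp: not_le)
      moreover have "open {v. v \<bullet> (S \<omega> *v v) < 0}"
        by (rule open_Collect_less[OF c continuous_on_const])
      ultimately obtain v where "v \<in> Q" "v \<bullet> (S \<omega> *v v) < 0" using Q(2) by blast
      then show False using elim(2) by force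
    qed
    with sym show ?case by blast
  qed
qed

lemma nn_integral_le_imp_integrable:
  fixes f :: "'a \<Rightarrow> real"
  assumes f: "f \<in> borel_measurable M" "AE \<omega> in M. 0 \<le> f \<omega>" and le: "(\<integral>\<^sup>+\<omega>. ennreal (f \<omega>) \<partial>M) \<le> ennreal C" and C: "0 \<le> C"
  shows "integrable M f" "(\<integral>\<omega>. f \<omega> \<partial>M) \<le> C"
proof -
  show i: "integrable M f"
    using f le by (intro integrableI_nonneg) (auto intro: le_less_trans simp: less_top[symmetric] top_unique)
  show "(\<integral>\<omega>. f \<omega> \<partial>M) \<le> C"
    using le C unfolding nn_integral_eq_integral[OF i f(2)] by simp
qed

text \<open>Adapted stand-ins \<open>D\<close> and \<open>H\<close> for the gradient and the Hessian
  of \<open>\<alpha>\<close> at \<open>\<theta>0\<close>, with which they agree almost everywhere.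
  The last clause is conditional because integrability of the centered Hessian comes from the moment
  bound \<open>b\<close> of the final theorem and is not derived in the single step.\<close>

definition score_version ::
  "'a measure \<Rightarrow> 'a measure \<Rightarrow> 'a measure \<Rightarrow> real ^ 'm \<Rightarrow> (real ^ 'm \<Rightarrow> 'a \<Rightarrow> real) \<Rightarrow>
   ('a \<Rightarrow> real ^ 'm) \<Rightarrow> ('m \<Rightarrow> 'm \<Rightarrow> 'a \<Rightarrow> real) \<Rightarrow> bool" where
  "score_version N G G' \<theta>0 \<alpha> D H \<longleftrightarrow> D \<in> borel_measurable G' \<and> (\<forall>i j. H i j \<in> borel_measurable G') \<and>
     (AE \<omega> in N. \<forall>i. D \<omega> $ i = partial i (\<lambda>\<theta>. \<alpha> \<theta> \<omega>) \<theta>0) \<and>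
     (AE \<omega> in N. \<forall>i j. H i j \<omega> = partial i (partial j (\<lambda>\<theta>. \<alpha> \<theta> \<omega>)) \<theta>0) \<and>
     (\<forall>i. AE \<omega> in N. real_cond_exp N G (\<lambda>\<omega>. D \<omega> $ i) \<omega> = 0) \<and>
     (\<forall>i j. integrable N (\<lambda>\<omega>. H i j \<omega> - real_cond_exp N G (H i j) \<omega>) \<longrightarrow>
        (AE \<omega> in N. real_cond_exp N G (\<lambda>\<omega>. H i j \<omega> - real_cond_exp N G (H i j) \<omega>) \<omega> = 0))"

text \<open>One time step: \<open>G\<close> is the past and \<open>G'\<close> includes the present. The gradient and the Hessian of
  \<open>\<alpha>\<close> are combinations of the products of entries of \<open>(1, e)\<close> with coefficients from the past.\<close>

lemma score_step:
  fixes P0 :: "'a measure" and xt :: "'a \<Rightarrow> real ^ 'r" and mm :: "real ^ 'm \<Rightarrow> 'a \<Rightarrow> real ^ 'r"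
    and SS :: "real ^ 'm \<Rightarrow> 'a \<Rightarrow> real ^ 'r ^ 'r"
  defines "N \<equiv> completion P0"
  defines "\<alpha> \<equiv> \<lambda>\<theta> \<omega>. ln (det (SS \<theta> \<omega>)) + (xt \<omega> - mm \<theta> \<omega>) \<bullet> (matrix_inv (SS \<theta> \<omega>) *v (xt \<omega> - mm \<theta> \<omega>))"
  assumes P0: "prob_space P0" and subG: "subalgebra N G" and subG': "subalgebra N G'"
    and GG': "\<And>f :: 'a \<Rightarrow> real. f \<in> borel_measurable G \<Longrightarrow> f \<in> borel_measurable G'"
    and x: "xt \<in> borel_measurable G'" and x2: "integrable N (\<lambda>\<omega>. (norm (xt \<omega>))\<^sup>2)"
    and r: "0 < r" "ball \<theta>0 r \<subseteq> \<Theta>"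
    and mG: "\<And>\<theta> k. \<theta> \<in> \<Theta> \<Longrightarrow> (\<lambda>\<omega>. mm \<theta> \<omega> $ k) \<in> borel_measurable G"
    and SG: "\<And>\<theta> k l. \<theta> \<in> \<Theta> \<Longrightarrow> (\<lambda>\<omega>. SS \<theta> \<omega> $ k $ l) \<in> borel_measurable G"
    and m0: "\<And>k. AE \<omega> in N. mm \<theta>0 \<omega> $ k = real_cond_exp N G (\<lambda>\<omega>. xt \<omega> $ k) \<omega>"
    and S0: "\<And>k l. AE \<omega> in N. SS \<theta>0 \<omega> $ k $ l = real_cond_exp N G (\<lambda>\<omega>. (xt \<omega> - mm \<theta>0 \<omega>) $ k * (xt \<omega> - mm \<theta>0 \<omega>) $ l) \<omega>"
    and inv: "AE \<omega> in N. \<forall>\<theta>\<in>\<Theta>. invertible (SS \<theta> \<omega>)"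
    and smooth: "AE \<omega> in N. C2_on \<Theta> (\<lambda>\<theta>. xt \<omega> - mm \<theta> \<omega>) \<and> C2_on \<Theta> (\<lambda>\<theta>. SS \<theta> \<omega>)"
  shows "AE \<omega> in N. D2_on (ball \<theta>0 r) (\<lambda>\<theta>. \<alpha> \<theta> \<omega>)"
    and "\<exists>D H. score_version N G G' \<theta>0 \<alpha> D H"
proof -
  interpret prob_space N unfolding N_def by (rule prob_space.prob_space_completion[OF P0])
  interpret S: sigma_finite_subalgebra N G
    by (simp add: finite_measure_subalgebra.intro finite_measure_subalgebra_axioms.intro subG
      finite_measure_axioms finite_measure_subalgebra_is_sigma_finite)
  let ?U = "ball \<theta>0 r"
  have U: "open ?U" "\<theta>0 \<in> ?U" using r by auto
  then have \<theta>0: "\<theta>0 \<in> \<Theta>" using r by auto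
  define e where "e = (\<lambda>\<omega>. xt \<omega> - mm \<theta>0 \<omega>)"
  \<comment> \<open>The dependence of the innovation on the parameter is moved into
    \<open>u\<close>, which is determined by the past and vanishes at \<open>\<theta>0\<close>,
    while \<open>e\<close> stays fixed.\<close>
  define u where "u = (\<lambda>\<theta> \<omega>. mm \<theta> \<omega> - mm \<theta>0 \<omega>)"
  have eu: "xt \<omega> - mm \<theta> \<omega> = e \<omega> - u \<theta> \<omega>" for \<theta> \<omega> by (simp add: e_def u_def)
  have eG': "e \<in> borel_measurable G'"
    unfolding e_def borel_measurable_vec_iff using x GG'[OF mG[OF \<theta>0]] by (auto simp: borel_measurable_vec_iff intro!: borel_measurable_diff)
  have GN: "f \<in> borel_measurable N" if "f \<in> borel_measurable G" for f :: "'a \<Rightarrow> real" using measurable_from_subalg[OF subG that] .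
  have eN[measurable]: "e \<in> borel_measurable N" using measurable_from_subalg[OF subG' eG'] .
  have xN[measurable]: "xt \<in> borel_measurable N" using measurable_from_subalg[OF subG' x] .
  have mN[measurable]: "(\<lambda>\<omega>. mm \<theta>0 \<omega> $ k) \<in> borel_measurable N" for k by (rule GN[OF mG[OF \<theta>0]])

  have xk2: "integrable N (\<lambda>\<omega>. (xt \<omega> $ k)\<^sup>2)" for k
  proof (rule Bochner_Integration.integrable_bound[OF x2])
    show "AE \<omega> in N. norm ((xt \<omega> $ k)\<^sup>2) \<le> norm ((norm (xt \<omega>))\<^sup>2)"
      using component_le_norm_cart[of "xt _" k] by (intro AE_I2) (simp add: abs_le_square_iff[symmetric])
  qed measurable
  have xk: "integrable N (\<lambda>\<omega>. xt \<omega> $ k)" for k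
    by (rule square_integrable_imp_integrable[OF _ xk2]) simp
  \<comment> \<open>Conditional Jensen again: the conditional mean of a square integrable variable
    is square integrable.\<close>
  have mk2: "integrable N (\<lambda>\<omega>. (mm \<theta>0 \<omega> $ k)\<^sup>2)" for k
  proof -
    have "integrable N (\<lambda>\<omega>. (real_cond_exp N G (\<lambda>\<omega>. xt \<omega> $ k) \<omega>)\<^sup>2)"
      by (rule S.integrable_convex_cond_exp[where I = UNIV and q = "\<lambda>x. x\<^sup>2"])
         (use xk xk2 convex_power2 emeasure_space_1 in auto)
    moreover have "AE \<omega> in N. (real_cond_exp N G (\<lambda>\<omega>. xt \<omega> $ k) \<omega>)\<^sup>2 = (mm \<theta>0 \<omega> $ k)\<^sup>2"
      using m0[of k] by eventually_elim simp
    ultimately show ?thesis by (subst integrable_cong_AE[symmetric]) auto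
  qed
  have mk: "integrable N (\<lambda>\<omega>. mm \<theta>0 \<omega> $ k)" for k
    by (rule square_integrable_imp_integrable[OF _ mk2]) simp
  have ek2: "integrable N (\<lambda>\<omega>. (e \<omega> $ k)\<^sup>2)" for k
  proof -
    have "integrable N (\<lambda>\<omega>. (xt \<omega> $ k)\<^sup>2 - 2 * (xt \<omega> $ k * mm \<theta>0 \<omega> $ k) + (mm \<theta>0 \<omega> $ k)\<^sup>2)"
      using integrable_mult_of_squares[OF _ _ xk2 mk2, of k k] xk2 mk2 by auto
    then show ?thesis by (simp add: e_def power2_eq_square algebra_simps)
  qed
  have ekl: "integrable N (\<lambda>\<omega>. e \<omega> $ k * e \<omega> $ l)" for k l
    by (rule integrable_mult_of_squares) (use ek2 in auto)
  have ek: "integrable N (\<lambda>\<omega>. e \<omega> $ k)" for k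
    using Bochner_Integration.integrable_diff[OF xk mk] by (simp add: e_def)

  define y where "y = (\<lambda>(p :: 'r option \<times> 'r option) \<omega>. ext (e \<omega>) (fst p) * ext (e \<omega>) (snd p))"
  have ext_simps: "ext v None = 1" "ext v (Some k) = v $ k" for v :: "real ^ 'r" and k by (simp_all add: ext_def)
  have y: "integrable N (y p)" for p
    unfolding y_def by (cases "fst p"; cases "snd p") (simp_all add: ext_simps ek ekl)
  have yG': "y p \<in> borel_measurable G'" for p
    using eG' unfolding y_def borel_measurable_vec_iff by (cases "fst p"; cases "snd p") (auto simp: ext_simps intro!: borel_measurable_times)
  have ce: "AE \<omega> in N. real_cond_exp N G (\<lambda>\<omega>. e \<omega> $ k) \<omega> = 0" for k
    using S.real_cond_exp_diff[OF xk mk, of k k] S.real_cond_exp_F_meas[OF mk mG[OF \<theta>0], of k] m0[of k]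
    by eventually_elim (simp add: e_def)
  have ce1: "AE \<omega> in N. real_cond_exp N G (\<lambda>_. 1) \<omega> = 1"
    by (rule S.real_cond_exp_F_meas) auto

  have S0': "\<And>k l. AE \<omega> in N. SS \<theta>0 \<omega> $ k $ l = real_cond_exp N G (\<lambda>\<omega>. e \<omega> $ k * e \<omega> $ l) \<omega>"
    using S0 unfolding e_def .
  have psd: "AE \<omega> in N. transpose (SS \<theta>0 \<omega>) = SS \<theta>0 \<omega> \<and> (\<forall>v. 0 \<le> v \<bullet> (SS \<theta>0 \<omega> *v v))"
    by (rule S.cond_second_moment_psd[OF eN ekl S0'])
  \<comment> \<open>The paths on which all calculus in the parameter is carried out; results proved
    on each of them hold almost everywhere.\<close>
  define good where "good = (\<lambda>\<omega>. (\<forall>\<theta>\<in>?U. 0 < det (SS \<theta> \<omega>)) \<and> transpose (SS \<theta>0 \<omega>) = SS \<theta>0 \<omega> \<and>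
     (\<forall>k l. D2_on ?U (\<lambda>\<theta>. SS \<theta> \<omega> $ k $ l)) \<and> (\<forall>k. D2_on ?U (\<lambda>\<theta>. u \<theta> \<omega> $ k)))"
  have good: "AE \<omega> in N. good \<omega>"
    using inv smooth psd
  proof eventually_elim
    case (elim \<omega>)
    have DS: "D2_on ?U (\<lambda>\<theta>. SS \<theta> \<omega> $ k $ l)" for k l
      using elim(2) by (intro C2_on_imp_D2_on[where L = "\<lambda>A. A $ k $ l" and V = \<Theta>]
        bounded_linear_compose[OF bounded_linear_vec_nth bounded_linear_vec_nth] r U) auto
    have "D2_on ?U (\<lambda>\<theta>. e \<omega> $ k + - ((xt \<omega> - mm \<theta> \<omega>) $ k))" for k
      using elim(2) by (intro D2_on_add D2_on_const D2_on_uminus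
        C2_on_imp_D2_on[where L = "\<lambda>v. v $ k" and V = \<Theta>] bounded_linear_vec_nth r U) auto
    then have Du: "D2_on ?U (\<lambda>\<theta>. u \<theta> \<omega> $ k)" for k by (simp add: e_def u_def)
    have "pos_def (SS \<theta>0 \<omega>)" using elim \<theta>0 by (intro psd_invertible_imp_pos_def) auto
    then have p0: "0 < det (SS \<theta>0 \<omega>)" by (rule pos_def_det_pos)
    have "0 < det (SS \<theta> \<omega>)" if "\<theta> \<in> ?U" for \<theta>
    proof (rule continuous_nonzero_pos[where U = ?U and f = "\<lambda>\<theta>. det (SS \<theta> \<omega>)", OF _ _ _ U(2) p0 that])
      show "continuous_on ?U (\<lambda>\<theta>. det (SS \<theta> \<omega>))"
        using D2_onD(1)[OF D2_on_det[OF U(1) DS]]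
        by (intro continuous_at_imp_continuous_on ballI differentiable_imp_continuous_within)
      show "det (SS \<theta> \<omega>) \<noteq> 0" if "\<theta> \<in> ?U" for \<theta> using elim(1) r that by (auto simp: invertible_det_nz)
    qed simp
    then show ?case using DS Du elim(3) by (simp add: good_def)
  qed
  let ?c = "\<lambda>\<omega> a b \<theta>. qcoef (u \<theta> \<omega>) (SS \<theta> \<omega>) a b"
  have good_qcoef: "D2_on ?U (?c \<omega> a b)" if "good \<omega>" for \<omega> a b
    by (rule D2_on_qcoef) (use that U in \<open>auto simp: good_def\<close>)
  have good_\<alpha>: "\<alpha> \<theta> \<omega> = (\<Sum>a\<in>UNIV. \<Sum>b\<in>UNIV. ?c \<omega> a b \<theta> * (ext (e \<omega>) a * ext (e \<omega>) b))"
    if "good \<omega>" "\<theta> \<in> ?U" for \<omega> \<theta>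
  proof -
    have "det (SS \<theta> \<omega>) \<noteq> 0" using that unfolding good_def by (metis less_irrefl)
    then show ?thesis unfolding \<alpha>_def eu by (rule quadratic_form_ext)
  qed
  let ?w = "\<lambda>\<omega> a b. ext (e \<omega>) a * ext (e \<omega>) b"
  have good_partial: "D2_on ?U (\<lambda>\<theta>. \<alpha> \<theta> \<omega>)"
     "partial i (\<lambda>\<theta>. \<alpha> \<theta> \<omega>) \<theta>0 = (\<Sum>a\<in>UNIV. \<Sum>b\<in>UNIV. partial i (?c \<omega> a b) \<theta>0 * ?w \<omega> a b)"
     "partial i (partial j (\<lambda>\<theta>. \<alpha> \<theta> \<omega>)) \<theta>0 = (\<Sum>a\<in>UNIV. \<Sum>b\<in>UNIV. partial i (partial j (?c \<omega> a b)) \<theta>0 * ?w \<omega> a b)"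
    if "good \<omega>" for \<omega> i j
    by (rule partial_sum_const[where f = "?c \<omega>" and w = "?w \<omega>" and g = "\<lambda>\<theta>. \<alpha> \<theta> \<omega>", OF U good_qcoef[OF that] good_\<alpha>[OF that]]; assumption)+
  from good show "AE \<omega> in N. D2_on ?U (\<lambda>\<theta>. \<alpha> \<theta> \<omega>)"
    by eventually_elim (rule good_partial(1))

  \<comment> \<open>Built from difference quotients, hence measurable for \<open>G\<close> on the
    whole space; on good paths these are the true partial derivatives of the coefficients.\<close>
  define gc where "gc = (\<lambda>i p \<omega>. seq_partial r i (?c \<omega> (fst p) (snd p)) \<theta>0)"
  define hc where "hc = (\<lambda>i j p \<omega>. seq_partial r i (seq_partial r j (?c \<omega> (fst p) (snd p))) \<theta>0)"
  have cG: "(\<lambda>\<omega>. ?c \<omega> a b \<theta>) \<in> borel_measurable G" if "\<theta> \<in> ?U" for a b \<theta>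
    using that r mG[of \<theta>] mG[OF \<theta>0] by (intro borel_measurable_qcoef SG) (auto simp: u_def)
  have gcG: "gc i p \<in> borel_measurable G" and hcG: "hc i j p \<in> borel_measurable G" for i j p
    unfolding gc_def hc_def using cG by (intro borel_measurable_seq_partial2 r; simp)+
  define D where "D = (\<lambda>\<omega>. \<chi> i. \<Sum>p\<in>UNIV. gc i p \<omega> * y p \<omega>)"
  define H where "H = (\<lambda>i j \<omega>. \<Sum>p\<in>UNIV. hc i j p \<omega> * y p \<omega>)"
  have gc_eq: "gc i p \<omega> = partial i (?c \<omega> (fst p) (snd p)) \<theta>0" if "good \<omega>" for i p \<omega>
    unfolding gc_def by (rule seq_partial_eq[OF D2_onD(1)[OF good_qcoef[OF that] U(2)] r(1)])
  have hc_eq: "hc i j p \<omega> = partial i (partial j (?c \<omega> (fst p) (snd p))) \<theta>0" if "good \<omega>" for i j p \<omega>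
    unfolding hc_def by (rule seq_partial_seq_partial_eq[OF good_qcoef[OF that] r(1)])
  have D_eq: "D \<omega> $ i = partial i (\<lambda>\<theta>. \<alpha> \<theta> \<omega>) \<theta>0" if "good \<omega>" for i \<omega>
    unfolding D_def good_partial(2)[OF that] sum_UNIV_pair by (simp add: gc_eq[OF that] y_def)
  have H_eq: "H i j \<omega> = partial i (partial j (\<lambda>\<theta>. \<alpha> \<theta> \<omega>)) \<theta>0" if "good \<omega>" for i j \<omega>
    unfolding H_def good_partial(3)[OF that] sum_UNIV_pair by (simp add: hc_eq[OF that] y_def)
  have DG': "D \<in> borel_measurable G'"
    unfolding D_def using GG'[OF gcG] yG' by (intro borel_measurable_vec_lambda borel_measurable_sum borel_measurable_times)
  have HG': "H i j \<in> borel_measurable G'" for i j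
    unfolding H_def using GG'[OF hcG] yG' by (intro borel_measurable_sum borel_measurable_times)
  have DN: "(\<lambda>\<omega>. D \<omega> $ i) \<in> borel_measurable N" for i
    using measurable_from_subalg[OF subG' DG'] by (simp add: borel_measurable_vec_iff)
  have HN: "H i j \<in> borel_measurable N" for i j using measurable_from_subalg[OF subG' HG'] .
  have D0: "AE \<omega> in N. real_cond_exp N G (\<lambda>\<omega>. D \<omega> $ i) \<omega> = 0" for i
  proof -
    have "AE \<omega> in N. real_cond_exp N G (\<lambda>\<omega>. D \<omega> $ i) \<omega> = (\<Sum>p\<in>UNIV. gc i p \<omega> * real_cond_exp N G (y p) \<omega>)"
      by (rule S.real_cond_exp_linear_comb[OF gcG y DN]) (simp add: D_def)
    moreover have "AE \<omega> in N. \<forall>k. real_cond_exp N G (\<lambda>\<omega>. e \<omega> $ k) \<omega> = 0"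
      unfolding AE_all_countable using ce by blast
    moreover have "AE \<omega> in N. \<forall>k l. SS \<theta>0 \<omega> $ k $ l = real_cond_exp N G (\<lambda>\<omega>. e \<omega> $ k * e \<omega> $ l) \<omega>"
      unfolding AE_all_countable using S0' by blast
    ultimately show ?thesis using ce1 good
    proof eventually_elim
      case (elim \<omega>)
      \<comment> \<open>The score identity on a single path, with the conditional expectations of
        the products \<open>y (a, b)\<close> as weights.\<close>
      have "(\<Sum>a\<in>UNIV. \<Sum>b\<in>UNIV. partial i (\<lambda>\<theta>. ?c \<omega> a b \<theta>) \<theta>0 * real_cond_exp N G (y (a, b)) \<omega>) = 0"
      proof (rule score_identity[OF U])
        show "u \<theta>0 \<omega> = 0" by (simp add: u_def)
        show "SS \<theta>0 \<omega> $ k $ l = SS \<theta>0 \<omega> $ l $ k" for k l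
        proof -
          have "transpose (SS \<theta>0 \<omega>) = SS \<theta>0 \<omega>" using elim(5) unfolding good_def by blast
          then have "transpose (SS \<theta>0 \<omega>) $ k $ l = SS \<theta>0 \<omega> $ k $ l" by (simp only:)
          then show ?thesis by (simp only: transpose_def vec_lambda_beta)
        qed
      qed (use elim in \<open>auto simp: good_def y_def ext_simps\<close>)
      then show ?case using elim(1) unfolding sum_UNIV_pair by (simp add: gc_eq[OF elim(5)])
    qed
  qed
  have H0: "AE \<omega> in N. real_cond_exp N G (\<lambda>\<omega>. H i j \<omega> - real_cond_exp N G (H i j) \<omega>) \<omega> = 0"
    if "integrable N (\<lambda>\<omega>. H i j \<omega> - real_cond_exp N G (H i j) \<omega>)" for i j
    by (rule S.real_cond_exp_centered[where d = "hc i j" and y = y, OF hcG y HN _ that]) (simp add: H_def)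
  have "AE \<omega> in N. \<forall>i. D \<omega> $ i = partial i (\<lambda>\<theta>. \<alpha> \<theta> \<omega>) \<theta>0" using good by eventually_elim (simp add: D_eq)
  moreover have "AE \<omega> in N. \<forall>i j. H i j \<omega> = partial i (partial j (\<lambda>\<theta>. \<alpha> \<theta> \<omega>)) \<theta>0" using good by eventually_elim (simp add: H_eq)
  ultimately show "\<exists>D H. score_version N G G' \<theta>0 \<alpha> D H"
    unfolding score_version_def
    using DG' HG' D0 H0 by blast
qed

section \<open>Asymptotic normality of the quasi-likelihood estimators\<close>

text \<open>The past is generated by events of \<open>M\<close>, while \<open>N\<close> may carry
  more events; this covers the completed measure with the uncompleted past as filtration.\<close>

lemma filtered_prob_space_past:
  fixes x :: "nat \<Rightarrow> 'a \<Rightarrow> 'b::topological_space"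
  assumes N: "prob_space N" and sp: "space N = space M" and sets: "sets M \<subseteq> sets N"
    and x: "\<And>t. 1 \<le> t \<Longrightarrow> x t \<in> borel_measurable M"
  shows "filtered_prob_space N (past M x)"
    and "1 \<le> t \<Longrightarrow> x t \<in> borel_measurable (past M x t)"
proof -
  have gen: "{x s -` B \<inter> space M |s B. s \<in> {1..t} \<and> B \<in> sets borel} \<subseteq> Pow (space M)" for t by auto
  have past_sets: "sets (past M x t) = sigma_sets (space M) {x s -` B \<inter> space M |s B. s \<in> {1..t} \<and> B \<in> sets borel}" for t
    unfolding past_def by (rule sets_measure_of[OF gen])
  have past_space: "space (past M x t) = space M" for t
    unfolding past_def by (rule space_measure_of[OF gen])
  have past_sub: "sets (past M x t) \<subseteq> sets M" for t
    unfolding past_sets by (rule sets.sigma_sets_subset) (auto intro: measurable_sets[OF x])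
  have past_mono: "sets (past M x s) \<subseteq> sets (past M x t)" if "s \<le> t" for s t
    unfolding past_sets using that by (intro sigma_sets_mono') (auto intro: order_trans)
  interpret prob_space N by (rule N)
  show "filtered_prob_space N (past M x)"
  proof
    show "subalgebra N (past M x t)" for t
      using past_sub sets by (auto simp: subalgebra_def past_space sp)
  qed (rule past_mono)
  show "x t \<in> borel_measurable (past M x t)" if "1 \<le> t"
  proof (rule measurableI)
    show "x t -` B \<inter> space (past M x t) \<in> sets (past M x t)" if "B \<in> sets borel" for B
      unfolding past_space past_sets using that \<open>1 \<le> t\<close> by (intro sigma_sets.Basic) auto
  qed simp
qed

theorem theorem2p2:
  fixes M :: "'a measure"
    and P :: "real ^ 'm \<Rightarrow> 'a measure"
    and \<Theta> :: "(real ^ 'm) set" and \<theta>0 :: "real ^ 'm"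
    and x :: "nat \<Rightarrow> 'a \<Rightarrow> real ^ 'r"
    and m :: "nat \<Rightarrow> real ^ 'm \<Rightarrow> 'a \<Rightarrow> real ^ 'r"
    and S :: "nat \<Rightarrow> real ^ 'm \<Rightarrow> 'a \<Rightarrow> real ^ 'r ^ 'r"
    and est :: "nat \<Rightarrow> 'a \<Rightarrow> real ^ 'm"
    and V W :: "real ^ 'm ^ 'm" and C1 C2 :: real
  assumes "open \<Theta>" and "\<theta>0 \<in> \<Theta>"
    and prob: "\<And>\<theta>. \<theta> \<in> \<Theta> \<Longrightarrow>
      prob_space (P \<theta>) \<and> space (P \<theta>) = space M \<and> sets (P \<theta>) = sets M"
    and x_meas: "\<And>t. t \<ge> 1 \<Longrightarrow> x t \<in> borel_measurable M"
    and x_sq: "\<And>\<theta> t. \<theta> \<in> \<Theta> \<Longrightarrow> t \<ge> 1 \<Longrightarrow> integrable (P \<theta>) (\<lambda>\<omega>. (norm (x t \<omega>))\<^sup>2)"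
    and m_version: "\<And>\<theta> t i. \<theta> \<in> \<Theta> \<Longrightarrow> t \<ge> 1 \<Longrightarrow>
      cond_expect_version (P \<theta>) (past M x (t - 1)) (\<lambda>\<omega>. x t \<omega> $ i) (\<lambda>\<omega>. m t \<theta> \<omega> $ i)"
    and S_version: "\<And>\<theta> t i j. \<theta> \<in> \<Theta> \<Longrightarrow> t \<ge> 1 \<Longrightarrow>
      cond_expect_version (P \<theta>) (past M x (t - 1))
        (\<lambda>\<omega>. innov x m t \<theta> \<omega> $ i * innov x m t \<theta> \<omega> $ j) (\<lambda>\<omega>. S t \<theta> \<omega> $ i $ j)"
    and S_inv: "\<And>t. t \<ge> 1 \<Longrightarrow> AE \<omega> in P \<theta>0. \<forall>\<theta>\<in>\<Theta>. invertible (S t \<theta> \<omega>)"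
    and smooth: "\<And>t. t \<ge> 1 \<Longrightarrow>
      AE \<omega> in P \<theta>0. C2_on \<Theta> (\<lambda>\<theta>. innov x m t \<theta> \<omega>) \<and> C2_on \<Theta> (\<lambda>\<theta>. S t \<theta> \<omega>)"
    and "C1 > 0" and "C2 > 0"
    and a: "\<And>t i. t \<ge> 1 \<Longrightarrow>
      (\<integral>\<^sup>+\<omega>. ennreal (\<bar>grad_alpha x m S t \<theta>0 \<omega> $ i\<bar> ^ 4) \<partial>P \<theta>0) \<le> ennreal C1"
    and b: "\<And>t i j. t \<ge> 1 \<Longrightarrow>
      (\<integral>\<^sup>+\<omega>. ennreal (\<bar>hess_alpha x m S t \<theta>0 \<omega> $ i $ j
          - cond_expect (P \<theta>0) (past M x (t - 1)) (\<lambda>\<omega>. hess_alpha x m S t \<theta>0 \<omega> $ i $ j) \<omega>\<bar>\<^sup>2)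
        \<partial>P \<theta>0) \<le> ennreal C2"
    and c: "\<And>i j. AE \<omega> in P \<theta>0.
      (\<lambda>n. 1 / (2 * real n) * (\<Sum>t = 1..n. cond_expect (P \<theta>0) (past M x (t - 1))
          (\<lambda>\<omega>. hess_alpha x m S t \<theta>0 \<omega> $ i $ j) \<omega>)) \<longlonglongrightarrow> V $ i $ j"
    and V_pos: "pos_def V"
    and d: "\<And>i j. AE \<omega> in P \<theta>0. \<exists>\<delta>>0.
      limsup (\<lambda>n. SUP \<Delta>\<in>{0<..<\<delta>}.
        SUP \<theta>s\<in>{\<theta>s. \<exists>\<theta>. norm (\<theta> - \<theta>0) < \<Delta> \<and> \<theta>s \<in> closed_segment \<theta>0 \<theta>}.
          ereal (1 / (real n * \<Delta>) *
            \<bar>\<Sum>t = 1..n. hess_alpha x m S t \<theta>s \<omega> $ i $ j - hess_alpha x m S t \<theta>0 \<omega> $ i $ j\<bar>)) < \<infinity>"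
    and e: "AE \<omega> in P \<theta>0.
      (\<lambda>n. (1 / real n) *\<^sub>R (\<Sum>t = 1..n. grad_sq_cond (P \<theta>0) x m S t \<theta>0 \<omega>)
          - (1 / real n) *\<^sub>R (\<Sum>t = 1..n. grad_sq_mean (P \<theta>0) x m S t \<theta>0)) \<longlonglongrightarrow> 0"
    and W_lim: "(\<lambda>n. (1 / (4 * real n)) *\<^sub>R (\<Sum>t = 1..n. grad_sq_mean (P \<theta>0) x m S t \<theta>0)) \<longlonglongrightarrow> W"
    and W_pos: "pos_def W"
    and est: "qml_estimators (P \<theta>0) \<Theta> \<theta>0 x m S est"
  shows "weakly_converges
    (\<lambda>n. distr (P \<theta>0) borel (\<lambda>\<omega>. sqrt (real n) *\<^sub>R (est n \<omega> - \<theta>0)))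
    (mvnormal 0 (matrix_inv V ** W ** matrix_inv V))"
proof -
  \<comment> \<open>The completion makes almost surely defined derivatives measurable; null sets,
    integrals of nonnegative functions and the laws of the estimators are the same as for
    \<open>P \<theta>0\<close>.\<close>
  define N where "N = completion (P \<theta>0)"
  define F where "F = past M x"
  let ?\<alpha> = "\<lambda>t \<theta> \<omega>. alpha x m S t \<theta> \<omega>"
  let ?h = "\<lambda>t i j \<omega>. hess_alpha x m S t \<theta>0 \<omega> $ i $ j"
  have P0: "prob_space (P \<theta>0)" "space (P \<theta>0) = space M" "sets (P \<theta>0) = sets M"
    using prob[OF \<open>\<theta>0 \<in> \<Theta>\<close>] by auto
  have spN: "space N = space M" by (simp add: N_def P0)
  have setsN: "sets M \<subseteq> sets N" using P0(3) by (auto simp: N_def intro: sets_completionI_sets)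
  have pN: "prob_space N" unfolding N_def by (rule prob_space.prob_space_completion[OF P0(1)])
  have x1: "\<And>t. 1 \<le> t \<Longrightarrow> x t \<in> borel_measurable M" using x_meas by simp
  have AEN: "(AE \<omega> in N. Q \<omega>) \<longleftrightarrow> (AE \<omega> in P \<theta>0. Q \<omega>)" for Q unfolding N_def by (rule AE_completion_iff)
  have past_eq: "past (P \<theta>) x = past M x" if "\<theta> \<in> \<Theta>" for \<theta>
    using prob[OF that] by (simp add: past_def[abs_def])
  have ce: "cond_expect (P \<theta>0) G f = real_cond_exp N G f" for G f by (simp add: cond_expect_def N_def)
  interpret filtered_prob_space N F
    unfolding F_def by (rule filtered_prob_space_past(1)[OF pN spN setsN x1])
  have xF: "x t \<in> borel_measurable (F t)" if "1 \<le> t" for t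
    unfolding F_def by (rule filtered_prob_space_past(2)[OF pN spN setsN x1 that])
  obtain r where r: "0 < r" "ball \<theta>0 r \<subseteq> \<Theta>"
    using \<open>open \<Theta>\<close> \<open>\<theta>0 \<in> \<Theta>\<close> by (auto simp: open_contains_ball)
  have mF: "(\<lambda>\<omega>. m t \<theta> \<omega> $ k) \<in> borel_measurable (F (t - 1))" if "1 \<le> t" "\<theta> \<in> \<Theta>" for t \<theta> k
    using m_version[OF that(2) that(1), of k] by (simp add: cond_expect_version_def F_def)
  have SF: "(\<lambda>\<omega>. S t \<theta> \<omega> $ k $ l) \<in> borel_measurable (F (t - 1))" if "1 \<le> t" "\<theta> \<in> \<Theta>" for t \<theta> k l
    using S_version[OF that(2) that(1), of k l] by (simp add: cond_expect_version_def F_def)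

  have smooth_step: "AE \<omega> in N. D2_on (ball \<theta>0 r) (\<lambda>\<theta>. ?\<alpha> t \<theta> \<omega>)" and ex_step: "\<exists>D H. score_version N (F (t - 1)) (F t) \<theta>0 (?\<alpha> t) D H" if t: "1 \<le> t" for t
  proof -
    have alpha_eq: "?\<alpha> t = (\<lambda>\<theta> \<omega>. ln (det (S t \<theta> \<omega>)) + (x t \<omega> - m t \<theta> \<omega>) \<bullet> (matrix_inv (S t \<theta> \<omega>) *v (x t \<omega> - m t \<theta> \<omega>)))"
      by (simp add: alpha_def[abs_def] innov_def)
    have GG': "f \<in> borel_measurable (F t)" if "f \<in> borel_measurable (F (t - 1))" for f :: "'a \<Rightarrow> real"
      by (rule measurable_F_mono[OF _ that]) simp
    have x2: "integrable N (\<lambda>\<omega>. (norm (x t \<omega>))\<^sup>2)"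
      using x_sq[OF \<open>\<theta>0 \<in> \<Theta>\<close> t] by (simp add: N_def integrable_completion borel_measurable_integrable)
    have m0: "AE \<omega> in N. m t \<theta>0 \<omega> $ k = real_cond_exp N (F (t - 1)) (\<lambda>\<omega>. x t \<omega> $ k) \<omega>" for k
      using m_version[OF \<open>\<theta>0 \<in> \<Theta>\<close> t, of k] by (simp add: cond_expect_version_def AEN ce F_def)
    have S0: "AE \<omega> in N. S t \<theta>0 \<omega> $ k $ l = real_cond_exp N (F (t - 1)) (\<lambda>\<omega>. (x t \<omega> - m t \<theta>0 \<omega>) $ k * (x t \<omega> - m t \<theta>0 \<omega>) $ l) \<omega>" for k l
      using S_version[OF \<open>\<theta>0 \<in> \<Theta>\<close> t, of k l] by (simp add: cond_expect_version_def AEN ce F_def innov_def)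
    have inv: "AE \<omega> in N. \<forall>\<theta>\<in>\<Theta>. invertible (S t \<theta> \<omega>)" using S_inv[OF t] by (simp add: AEN)
    have sm: "AE \<omega> in N. C2_on \<Theta> (\<lambda>\<theta>. x t \<omega> - m t \<theta> \<omega>) \<and> C2_on \<Theta> (\<lambda>\<theta>. S t \<theta> \<omega>)"
      using smooth[OF t] by (simp add: AEN innov_def)
    note ss = score_step[where SS = "S t" and mm = "m t" and xt = "x t" and G' = "F t" and \<Theta> = \<Theta>,
        OF P0(1), folded N_def, OF sub sub GG' xF[OF t] x2 r mF[OF t] SF[OF t] m0 S0 inv sm]
    show "AE \<omega> in N. D2_on (ball \<theta>0 r) (\<lambda>\<theta>. ?\<alpha> t \<theta> \<omega>)" unfolding alpha_eq by (rule ss(1))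
    show "\<exists>D H. score_version N (F (t - 1)) (F t) \<theta>0 (?\<alpha> t) D H" unfolding alpha_eq by (rule ss(2))
  qed
  have "\<exists>D H. \<forall>t. 1 \<le> t \<longrightarrow> score_version N (F (t - 1)) (F t) \<theta>0 (?\<alpha> t) (D t) (H t)" using ex_step by metis
  then obtain D :: "nat \<Rightarrow> 'a \<Rightarrow> real ^ 'm" and H where DH: "\<And>t. 1 \<le> t \<Longrightarrow> score_version N (F (t - 1)) (F t) \<theta>0 (?\<alpha> t) (D t) (H t)" by blast
  have D: "D t \<in> borel_measurable (F t)" and HF: "H t i j \<in> borel_measurable (F t)"
    and D_eq: "AE \<omega> in N. \<forall>i. D t \<omega> $ i = partial i (\<lambda>\<theta>. ?\<alpha> t \<theta> \<omega>) \<theta>0"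
    and H_eq: "AE \<omega> in N. \<forall>i j. H t i j \<omega> = partial i (partial j (\<lambda>\<theta>. ?\<alpha> t \<theta> \<omega>)) \<theta>0"
    and D0: "AE \<omega> in N. real_cond_exp N (F (t - 1)) (\<lambda>\<omega>. D t \<omega> $ i) \<omega> = 0"
    and H0: "integrable N (\<lambda>\<omega>. H t i j \<omega> - real_cond_exp N (F (t - 1)) (H t i j) \<omega>) \<Longrightarrow>
         AE \<omega> in N. real_cond_exp N (F (t - 1)) (\<lambda>\<omega>. H t i j \<omega> - real_cond_exp N (F (t - 1)) (H t i j) \<omega>) \<omega> = 0"
    if "1 \<le> t" for t i j
    using DH[OF that] unfolding score_version_def by blast+
  have DN: "(\<lambda>\<omega>. D t \<omega> $ i) \<in> borel_measurable N" if "1 \<le> t" for t i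
    using measurable_F[OF D[OF that]] by (simp add: borel_measurable_vec_iff)
  have HN: "H t i j \<in> borel_measurable N" if "1 \<le> t" for t i j by (rule measurable_F[OF HF[OF that]])
  have grad_eq: "AE \<omega> in N. D t \<omega> $ i = grad_alpha x m S t \<theta>0 \<omega> $ i" if "1 \<le> t" for t i
    using D_eq[OF that] by eventually_elim (simp add: grad_alpha_def)
  have hess_eq: "AE \<omega> in N. H t i j \<omega> = ?h t i j \<omega>" if "1 \<le> t" for t i j
    using H_eq[OF that] by eventually_elim (simp add: hess_alpha_def)
  have gradN: "(\<lambda>\<omega>. grad_alpha x m S t \<theta>0 \<omega> $ i) \<in> borel_measurable N" if "1 \<le> t" for t i
    unfolding N_def by (rule borel_measurable_cong_completion[OF DN[OF that, unfolded N_def] grad_eq[OF that, unfolded N_def]])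
  have hessN: "?h t i j \<in> borel_measurable N" if "1 \<le> t" for t i j
    unfolding N_def by (rule borel_measurable_cong_completion[OF HN[OF that, unfolded N_def] hess_eq[OF that, unfolded N_def]])
  \<comment> \<open>Measurability of the Hessian for the completion, just established, permits the
    passage from \<open>H\<close> to the Hessian under the conditional expectation.\<close>
  have H_ce: "AE \<omega> in N. real_cond_exp N (F (t - 1)) (H t i j) \<omega> = real_cond_exp N (F (t - 1)) (?h t i j) \<omega>" if t: "1 \<le> t" for t i j
  proof -
    interpret G: sigma_finite_subalgebra N "F (t - 1)" by (rule sigma_finite_sub)
    show ?thesis by (rule G.real_cond_exp_cong[OF hess_eq[OF t] HN[OF t] hessN[OF t]])
  qed

  have D4: "integrable N (\<lambda>\<omega>. (D t \<omega> $ i) ^ 4) \<and> (\<integral>\<omega>. (D t \<omega> $ i) ^ 4 \<partial>N) \<le> C1" if t: "1 \<le> t" for t i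
  proof -
    have "(\<integral>\<^sup>+\<omega>. ennreal ((D t \<omega> $ i) ^ 4) \<partial>N) = (\<integral>\<^sup>+\<omega>. ennreal (\<bar>grad_alpha x m S t \<theta>0 \<omega> $ i\<bar> ^ 4) \<partial>N)"
    proof (rule nn_integral_cong_AE)
      show "AE \<omega> in N. ennreal ((D t \<omega> $ i) ^ 4) = ennreal (\<bar>grad_alpha x m S t \<theta>0 \<omega> $ i\<bar> ^ 4)"
        using grad_eq[OF t, of i] by eventually_elim simp
    qed
    also have "\<dots> \<le> ennreal C1" unfolding N_def nn_integral_completion by (rule a) (use t in simp)
    finally have le: "(\<integral>\<^sup>+\<omega>. ennreal ((D t \<omega> $ i) ^ 4) \<partial>N) \<le> ennreal C1" .
    have "(\<lambda>\<omega>. (D t \<omega> $ i) ^ 4) \<in> borel_measurable N" using DN[OF t] by measurable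
    from nn_integral_le_imp_integrable[OF this _ le] \<open>C1 > 0\<close> show ?thesis by simp
  qed
  \<comment> \<open>The martingale difference is built from the adapted version; the bound
    \<open>b\<close> concerns the Hessian itself and passes to \<open>L\<close> by almost sure
    equality.\<close>
  define L where "L = (\<lambda>t i j \<omega>. H t i j \<omega> - real_cond_exp N (F (t - 1)) (H t i j) \<omega>)"
  have L_eq: "AE \<omega> in N. L t i j \<omega> = ?h t i j \<omega> - real_cond_exp N (F (t - 1)) (?h t i j) \<omega>" if t: "1 \<le> t" for t i j
    using hess_eq[OF t, of i j] H_ce[OF t, of i j] by eventually_elim (simp add: L_def)
  have LF: "L t i j \<in> borel_measurable (F t)" if t: "1 \<le> t" for t i j
  proof -
    have "real_cond_exp N (F (t - 1)) (H t i j) \<in> borel_measurable (F t)"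
      by (rule measurable_F_mono[OF _ borel_measurable_cond_exp]) simp
    then show ?thesis using HF[OF t] unfolding L_def by measurable
  qed
  have LN: "L t i j \<in> borel_measurable N" if "1 \<le> t" for t i j by (rule measurable_F[OF LF[OF that]])
  have L2: "integrable N (\<lambda>\<omega>. (L t i j \<omega>)\<^sup>2) \<and> (\<integral>\<omega>. (L t i j \<omega>)\<^sup>2 \<partial>N) \<le> C2" if t: "1 \<le> t" for t i j
  proof -
    have "(\<integral>\<^sup>+\<omega>. ennreal ((L t i j \<omega>)\<^sup>2) \<partial>N)
      = (\<integral>\<^sup>+\<omega>. ennreal (\<bar>?h t i j \<omega> - cond_expect (P \<theta>0) (past M x (t - 1)) (?h t i j) \<omega>\<bar>\<^sup>2) \<partial>N)"
    proof (rule nn_integral_cong_AE)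
      show "AE \<omega> in N. ennreal ((L t i j \<omega>)\<^sup>2)
          = ennreal (\<bar>?h t i j \<omega> - cond_expect (P \<theta>0) (past M x (t - 1)) (?h t i j) \<omega>\<bar>\<^sup>2)"
        using L_eq[OF t, of i j] by eventually_elim (simp add: ce F_def)
    qed
    also have "\<dots> \<le> ennreal C2" unfolding N_def nn_integral_completion by (rule b) (use t in simp)
    finally have le: "(\<integral>\<^sup>+\<omega>. ennreal ((L t i j \<omega>)\<^sup>2) \<partial>N) \<le> ennreal C2" .
    have "(\<lambda>\<omega>. (L t i j \<omega>)\<^sup>2) \<in> borel_measurable N" using LN[OF t] by measurable
    from nn_integral_le_imp_integrable[OF this _ le] \<open>C2 > 0\<close> show ?thesis by simp
  qed
  have L0: "AE \<omega> in N. real_cond_exp N (F (t - 1)) (L t i j) \<omega> = 0" if t: "1 \<le> t" for t i j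
  proof -
    have "integrable N (L t i j)"
      by (rule square_integrable_imp_integrable) (use L2[OF t] LN[OF t] in auto)
    then show ?thesis using H0[OF t] unfolding L_def by simp
  qed

  have Dlim: "AE \<omega> in N. (\<lambda>n. (\<Sum>t=1..n. real_cond_exp N (F (t - 1)) (\<lambda>\<omega>. D t \<omega> $ i * D t \<omega> $ j) \<omega>) / real n) \<longlonglongrightarrow> 4 * W $ i $ j" for i j
  proof -
    have "AE \<omega> in N. \<forall>t\<in>{1..}. real_cond_exp N (F (t - 1)) (\<lambda>\<omega>. D t \<omega> $ i * D t \<omega> $ j) \<omega> = grad_sq_cond (P \<theta>0) x m S t \<theta>0 \<omega> $ i $ j"
    proof (subst AE_ball_countable, simp, intro ballI)
      fix t :: nat assume "t \<in> {1..}"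
      then have t: "1 \<le> t" by simp
      interpret G: sigma_finite_subalgebra N "F (t - 1)" by (rule sigma_finite_sub)
      have "AE \<omega> in N. D t \<omega> $ i * D t \<omega> $ j = grad_alpha x m S t \<theta>0 \<omega> $ i * grad_alpha x m S t \<theta>0 \<omega> $ j"
        using grad_eq[OF t, of i] grad_eq[OF t, of j] by eventually_elim simp
      from G.real_cond_exp_cong[OF this]
      have "AE \<omega> in N. real_cond_exp N (F (t - 1)) (\<lambda>\<omega>. D t \<omega> $ i * D t \<omega> $ j) \<omega>
        = real_cond_exp N (F (t - 1)) (\<lambda>\<omega>. grad_alpha x m S t \<theta>0 \<omega> $ i * grad_alpha x m S t \<theta>0 \<omega> $ j) \<omega>"
        using DN[OF t] gradN[OF t] by auto
      then show "AE \<omega> in N. real_cond_exp N (F (t - 1)) (\<lambda>\<omega>. D t \<omega> $ i * D t \<omega> $ j) \<omega> = grad_sq_cond (P \<theta>0) x m S t \<theta>0 \<omega> $ i $ j"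
        by (simp add: grad_sq_cond_def ce F_def past_eq[OF \<open>\<theta>0 \<in> \<Theta>\<close>])
    qed
    moreover have "AE \<omega> in N. (\<lambda>n. (1 / real n) *\<^sub>R (\<Sum>t = 1..n. grad_sq_cond (P \<theta>0) x m S t \<theta>0 \<omega>)
          - (1 / real n) *\<^sub>R (\<Sum>t = 1..n. grad_sq_mean (P \<theta>0) x m S t \<theta>0)) \<longlonglongrightarrow> 0"
      using e by (simp add: AEN)
    ultimately show ?thesis
    proof eventually_elim
      case (elim \<omega>)
      \<comment> \<open>Assumption \<open>e\<close> compares conditional with unconditional
        averages; the latter converge to \<open>4 *\<^sub>R W\<close> by the definition of
        \<open>W\<close>.\<close>
      have "(\<lambda>n. 4 *\<^sub>R ((1 / (4 * real n)) *\<^sub>R (\<Sum>t = 1..n. grad_sq_mean (P \<theta>0) x m S t \<theta>0))) \<longlonglongrightarrow> 4 *\<^sub>R W"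
        by (intro tendsto_scaleR tendsto_const W_lim)
      from tendsto_add[OF elim(2) this]
      have "(\<lambda>n. (1 / real n) *\<^sub>R (\<Sum>t = 1..n. grad_sq_cond (P \<theta>0) x m S t \<theta>0 \<omega>)) \<longlonglongrightarrow> 4 *\<^sub>R W" by simp
      then have "(\<lambda>n. ((1 / real n) *\<^sub>R (\<Sum>t = 1..n. grad_sq_cond (P \<theta>0) x m S t \<theta>0 \<omega>)) $ i $ j) \<longlonglongrightarrow> (4 *\<^sub>R W) $ i $ j"
        by (intro tendsto_vec_nth)
      moreover have "((1 / real n) *\<^sub>R (\<Sum>t = 1..n. grad_sq_cond (P \<theta>0) x m S t \<theta>0 \<omega>)) $ i $ j
          = (\<Sum>t=1..n. real_cond_exp N (F (t - 1)) (\<lambda>\<omega>. D t \<omega> $ i * D t \<omega> $ j) \<omega>) / real n" for n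
        using elim(1) by (simp add: sum_component)
      ultimately show ?case by (simp only: vector_scaleR_component real_scaleR_def)
    qed
  qed

  have est_meas: "est n \<in> borel_measurable (past M x n)" if "1 \<le> n" for n
    using est that past_eq[OF \<open>\<theta>0 \<in> \<Theta>\<close>] by (simp add: qml_estimators_def)
  have u: "(\<lambda>\<omega>. est n \<omega> - \<theta>0) \<in> borel_measurable N" if "1 \<le> n" for n
    using measurable_F[OF est_meas[OF that, folded F_def]] by measurable

  have expansion: "\<exists>E\<in>sets N. prob E > 1 - \<epsilon> \<and> (AE \<omega> in N. \<omega> \<in> E \<longrightarrow>
        small_remainder V (\<lambda>t. D t \<omega>) (\<lambda>t i j. L t i j \<omega>) (\<lambda>n. est n \<omega> - \<theta>0))"
    if \<epsilon>: "0 < \<epsilon>" for \<epsilon>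
  proof -
    obtain E n0 where E: "E \<in> sets (P \<theta>0)" "measure (P \<theta>0) E > 1 - \<epsilon>"
      and stat: "\<And>\<omega> n i. \<omega> \<in> E \<Longrightarrow> n0 < n \<Longrightarrow> partial i (\<lambda>\<theta>. Q x m S n \<theta> \<omega>) (est n \<omega>) = 0"
    proof -
      from conjunct2[OF conjunct2[OF est[unfolded qml_estimators_def]], THEN spec, THEN mp, OF \<epsilon>]
      obtain E n0 where "E \<in> sets (P \<theta>0)" "measure (P \<theta>0) E > 1 - \<epsilon>"
        and *: "\<forall>\<omega>\<in>E. \<forall>n>n0. est n \<omega> \<in> \<Theta> \<and> (\<forall>i. partial i (\<lambda>\<theta>. Q x m S n \<theta> \<omega>) (est n \<omega>) = 0) \<and>
           rel_min_on \<Theta> (\<lambda>\<theta>. Q x m S n \<theta> \<omega>) (est n \<omega>)"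
        by (elim bexE conjE exE)
      then show ?thesis using that[of E n0] by simp
    qed
    have "AE \<omega> in N. \<forall>t\<in>{1..}. D2_on (ball \<theta>0 r) (\<lambda>\<theta>. ?\<alpha> t \<theta> \<omega>) \<and> (\<forall>i. D t \<omega> $ i = partial i (\<lambda>\<theta>. ?\<alpha> t \<theta> \<omega>) \<theta>0) \<and>
       (\<forall>i j. L t i j \<omega> = ?h t i j \<omega> - real_cond_exp N (F (t - 1)) (?h t i j) \<omega>)"
    proof (subst AE_ball_countable, simp, intro ballI)
      fix t :: nat assume "t \<in> {1..}"
      then have t: "1 \<le> t" by simp
      have "AE \<omega> in N. \<forall>i j. L t i j \<omega> = ?h t i j \<omega> - real_cond_exp N (F (t - 1)) (?h t i j) \<omega>"
        unfolding AE_all_countable using L_eq[OF t] by blast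
      with smooth_step[OF t] D_eq[OF t]
      show "AE \<omega> in N. D2_on (ball \<theta>0 r) (\<lambda>\<theta>. ?\<alpha> t \<theta> \<omega>) \<and> (\<forall>i. D t \<omega> $ i = partial i (\<lambda>\<theta>. ?\<alpha> t \<theta> \<omega>) \<theta>0) \<and>
       (\<forall>i j. L t i j \<omega> = ?h t i j \<omega> - real_cond_exp N (F (t - 1)) (?h t i j) \<omega>)"
        by eventually_elim blast
    qed
    moreover have "AE \<omega> in N. (\<lambda>n. est n \<omega>) \<longlonglongrightarrow> \<theta>0"
      using est by (simp add: AEN qml_estimators_def)
    moreover have "AE \<omega> in N. \<forall>i j. (\<lambda>n. 1 / (2 * real n) * (\<Sum>t = 1..n. real_cond_exp N (F (t - 1)) (?h t i j) \<omega>)) \<longlonglongrightarrow> V $ i $ j"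
      unfolding AE_all_countable using c by (simp add: AEN ce F_def)
    moreover have "AE \<omega> in N. \<forall>i j. \<exists>\<delta>>0.
      limsup (\<lambda>n. SUP \<Delta>\<in>{0<..<\<delta>}.
        SUP \<theta>s\<in>{\<theta>s. \<exists>\<theta>. norm (\<theta> - \<theta>0) < \<Delta> \<and> \<theta>s \<in> closed_segment \<theta>0 \<theta>}.
          ereal (1 / (real n * \<Delta>) *
            \<bar>\<Sum>t = 1..n. hess_alpha x m S t \<theta>s \<omega> $ i $ j - ?h t i j \<omega>\<bar>)) < \<infinity>"
      unfolding AE_all_countable using d by (simp add: AEN)
    ultimately have "AE \<omega> in N. \<omega> \<in> E \<longrightarrow>
        small_remainder V (\<lambda>t. D t \<omega>) (\<lambda>t i j. L t i j \<omega>) (\<lambda>n. est n \<omega> - \<theta>0)"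
    proof eventually_elim
      case (elim \<omega>)
      show ?case
      proof
        assume \<omega>: "\<omega> \<in> E"
        have hess: "partial i (partial j (\<lambda>\<theta>. ?\<alpha> t \<theta> \<omega>)) \<theta> = hess_alpha x m S t \<theta> \<omega> $ i $ j" for t i j \<theta>
          by (simp add: hess_alpha_def)
        have Dsum: "(\<Sum>t=1..n. D t \<omega>) = (\<Sum>t=1..n. \<chi> i. partial i (\<lambda>\<theta>. ?\<alpha> t \<theta> \<omega>) \<theta>0)" for n
          using elim(1) by (intro sum.cong) (auto simp: vec_eq_iff)
        have Lsum: "(\<Sum>t=1..n. L t i j \<omega>) = (\<Sum>t=1..n. ?h t i j \<omega> - real_cond_exp N (F (t - 1)) (?h t i j) \<omega>)" for n i j
          using elim(1) by (intro sum.cong) auto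
        \<comment> \<open>The versions agree with the derivatives for \<open>t \<ge> 1\<close> only,
          so they are exchanged under the sums, with the definition opened and closed again.\<close>
        show "small_remainder V (\<lambda>t. D t \<omega>) (\<lambda>t i j. L t i j \<omega>) (\<lambda>n. est n \<omega> - \<theta>0)"
          unfolding small_remainder_def Dsum Lsum hess[symmetric]
          unfolding small_remainder_def[symmetric]
        proof (rule score_expansion[where r = r and ?n0.0 = n0 and q = "\<lambda>n. real CARD('r) * real n / 2 * ln (2 * pi)"])
          show "partial i (\<lambda>\<theta>. 1 / 2 * (\<Sum>t = 1..n. ?\<alpha> t \<theta> \<omega>) + real CARD('r) * real n / 2 * ln (2 * pi)) (est n \<omega>) = 0"
            if "n0 < n" for n i
            using stat[OF \<omega> that, of i] unfolding Q_def .
          show "transpose V = V" using V_pos by (simp add: pos_def_def)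
        qed (use r elim hess in auto)
      qed
    qed
    moreover have "E \<in> sets N" "prob E > 1 - \<epsilon>" using E by (auto simp: N_def)
    ultimately show ?thesis by blast
  qed
  have "weakly_converges (\<lambda>n. distr N borel (\<lambda>\<omega>. sqrt (real n) *\<^sub>R (est n \<omega> - \<theta>0))) (mvnormal 0 (matrix_inv V ** W ** matrix_inv V))"
    by (rule estimator_clt[where D = D and L = L and ?C1.0 = C1 and ?C2.0 = C2])
       (use D D4 D0 Dlim LF L2 L0 u V_pos W_pos expansion in auto)
  moreover have "distr N borel (\<lambda>\<omega>. sqrt (real n) *\<^sub>R (est n \<omega> - \<theta>0)) = distr (P \<theta>0) borel (\<lambda>\<omega>. sqrt (real n) *\<^sub>R (est n \<omega> - \<theta>0))" for n
    unfolding N_def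
  proof (rule distr_completion)
    show "(\<lambda>\<omega>. sqrt (real n) *\<^sub>R (est n \<omega> - \<theta>0)) \<in> borel_measurable (P \<theta>0)"
    \<comment> \<open>Measurability of \<open>est 0\<close> is not provided, but the factor
      \<open>sqrt 0\<close> makes the function constant.\<close>
    proof (cases "n = 0")
      case False
      have "subalgebra (P \<theta>0) (past M x n)"
        using filtered_prob_space.sub[OF filtered_prob_space_past(1)[OF P0(1,2) _ x1]] P0(3) by auto
      from measurable_from_subalg[OF this est_meas] False show ?thesis by simp
    qed simp
  qed
  ultimately show ?thesis by simp
qed

end
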